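(* Let $T$ be a sesqui-Eulerian circle-tree with a direction $\omega_T$. Then either $T$ is a signed-graph circuit, or there exist $n\ge 2$ and a closed positive walk on $T$ of the form \[ W=P_1C_1P_2C_2\cdots P_nC_n \] (a concatenation, where each $C_i$ is traversed as a closed walk once around a circle) satisfying: (a) $C_1,\dots,C_n$ are the end blocks of $T$, and $P_1,\dots,P_n$ are paths of positive length; (b) each edge of a circle block of $T$ that is not an end block appears in exactly one of the paths $P_i$, and each edge of a block path of $T$ appears in exactly two of the paths $P_i$; (c) for each $i=1,\dots,n$ (indices taken cyclically, $C_{n+1}=C_1$, $P_{n+1}=P_1$), the subgraph $C_i\cup P_{i+1}\cup C_{i+1}$ is a signed-graph circuit of Type III and the restriction of $\omega_T$ to it is a direction of it; (d) $I_T=\frac12\sum_{i=1}^n I_{T_i}$, where $T_i$ is the subgraph $C_i\cup P_{i+1}\cup C_{i+1}$ of $T$; i.e. $T$ is a conformal half-integral positive linear combination of signed-graph circuits.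
   Context: All graphs are finite; loops and multiple edges are allowed. A signed graph is a graph with a sign function $\sigma$ on edges with values $\pm1$. Each edge $e$ has two ends $(u,e),(v,e)$ ($u,v$ its endpoints; a loop has two distinct ends). A walk $v_0e_1v_1\cdots e_nv_n$ has sign $\prod\sigma(e_i)$ and is closed if $n\ge1$ and $v_0=v_n$. A circle is a connected 2-regular subgraph; its sign is the product of its edge signs. A signed-graph circuit is a subgraph of one of three types: Type I, a positive circle; Type II, two negative circles meeting in exactly one vertex; Type III, two vertex-disjoint negative circles together with a path of positive length joining them that is internally disjoint from both circles. An orientation $\omega$ assigns $\omega(v,e)\in\{\pm1\}$ to each edge end with $\sigma(e)=-\omega(u,e)\omega(v,e)$; a sink (source) is a vertex all of whose ends have value $+1$ ($-1$). A cut-vertex is a vertex whose deletion increases the number of components, or a vertex incident with a loop and another edge. A block is a maximal connected subgraph without cut-vertices; an end block is a block sharing a vertex with exactly one other block. A circle-tree is a signed graph $T$ with nonempty edge set that is connected, whose blocks are circles or single edges, whose end blocks are circles, and in which each cut-vertex lies in exactly two blocks. Circle blocks are the blocks that are circles; block paths are the paths (possibly of length $0$, i.e. a common vertex of two circle blocks) connecting pairs of circle blocks through non-circle blocks. $T$ is sesqui-Eulerian if each circle block has sign $(-1)^p$, $p$ the number of cut-vertices of $T$ on it. A direction of a sesqui-Eulerian circle-tree $T$ is an orientation $\omega_T$ of $T$ with no sink and no source such that each circle block $C$, oriented by $\omega_T$, has a sink or source at each cut-vertex of $T$ on $C$. (A Type III circuit is a sesqui-Eulerian circle-tree, so it has directions.)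 The indicator $I_T$ of a circle-tree $T$ is the function on edges equal to $1$ on circle-block edges, $2$ on block-path edges, $0$ elsewhere. *)

theory Defs
  imports Complex_Main
begin

section \<open>Signed graphs\<close>

text \<open>
  Loops and multiple edges are allowed.  The two ends of an edge \<open>e\<close> are \<open>(e, False)\<close> and
  \<open>(e, True)\<close>, located at the vertices \<open>endpt G e False\<close> and \<open>endpt G e True\<close>; thus a loop has
  two distinct ends at one vertex.  The labelling of the ends by booleans carries no meaning.
\<close>

record ('v, 'e) sgraph =
  verts :: "'v set"
  edges :: "'e set"
  endpt :: "'e \<Rightarrow> bool \<Rightarrow> 'v"
  esign :: "'e \<Rightarrow> int"

definition signed_graph :: "('v, 'e) sgraph \<Rightarrow> bool" where
  "signed_graph G \<longleftrightarrow> finite (verts G) \<and> finite (edges G) \<and>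
     (\<forall>e\<in>edges G. \<forall>b. endpt G e b \<in> verts G) \<and> (\<forall>e\<in>edges G. esign G e \<in> {1, -1})"

text \<open>
  A subgraph carries the same endpoint and sign functions as the ambient graph (also on edges
  outside of it), so it is determined by its vertex and edge sets.
\<close>

definition subgraph :: "('v, 'e) sgraph \<Rightarrow> ('v, 'e) sgraph \<Rightarrow> bool" where
  "subgraph H G \<longleftrightarrow> signed_graph H \<and> verts H \<subseteq> verts G \<and> edges H \<subseteq> edges G \<and>
     endpt H = endpt G \<and> esign H = esign G"

definition graph_union :: "('v, 'e) sgraph \<Rightarrow> ('v, 'e) sgraph \<Rightarrow> ('v, 'e) sgraph" where
  "graph_union G H = G\<lparr>verts := verts G \<union> verts H, edges := edges G \<union> edges H\<rparr>"

definition incident :: "('v, 'e) sgraph \<Rightarrow> 'v \<Rightarrow> 'e \<Rightarrow> bool" where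
  "incident G v e \<longleftrightarrow> e \<in> edges G \<and> (\<exists>b. endpt G e b = v)"

definition is_loop_at :: "('v, 'e) sgraph \<Rightarrow> 'v \<Rightarrow> 'e \<Rightarrow> bool" where
  "is_loop_at G v e \<longleftrightarrow> e \<in> edges G \<and> (\<forall>b. endpt G e b = v)"

definition delete_vertex :: "('v, 'e) sgraph \<Rightarrow> 'v \<Rightarrow> ('v, 'e) sgraph" where
  "delete_vertex G v = G\<lparr>verts := verts G - {v}, edges := {e \<in> edges G. \<not> incident G v e}\<rparr>"

definition ends_at :: "('v, 'e) sgraph \<Rightarrow> 'v \<Rightarrow> ('e \<times> bool) set" where
  "ends_at G v = {(e, b). e \<in> edges G \<and> endpt G e b = v}"


section \<open>Walks and paths\<close>

text \<open>
  The walk \<open>v\<^sub>0 e\<^sub>1 v\<^sub>1 \<dots> e\<^sub>n v\<^sub>n\<close> is given by its initial vertex \<open>v\<^sub>0\<close> and the list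
  \<open>[(e\<^sub>1, v\<^sub>1), \<dots>, (e\<^sub>n, v\<^sub>n)]\<close>, so that concatenation of walks is concatenation of lists.
\<close>

fun walk :: "('v, 'e) sgraph \<Rightarrow> 'v \<Rightarrow> ('e \<times> 'v) list \<Rightarrow> 'v \<Rightarrow> bool" where
  "walk G u [] v \<longleftrightarrow> u \<in> verts G \<and> u = v"
| "walk G u ((e, x) # p) v \<longleftrightarrow>
     e \<in> edges G \<and> (\<exists>b. endpt G e b = u \<and> endpt G e (\<not> b) = x) \<and> walk G x p v"

definition walk_sign :: "('v, 'e) sgraph \<Rightarrow> ('e \<times> 'v) list \<Rightarrow> int" where
  "walk_sign G p = prod_list (map (\<lambda>(e, x). esign G e) p)"

definition closed_walk :: "('v, 'e) sgraph \<Rightarrow> 'v \<Rightarrow> ('e \<times> 'v) list \<Rightarrow> bool" where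
  "closed_walk G u p \<longleftrightarrow> p \<noteq> [] \<and> walk G u p u"

definition path :: "('v, 'e) sgraph \<Rightarrow> 'v \<Rightarrow> ('e \<times> 'v) list \<Rightarrow> 'v \<Rightarrow> bool" where
  "path G u p v \<longleftrightarrow> walk G u p v \<and> distinct (u # map snd p)"

definition walk_edges :: "('e \<times> 'v) list \<Rightarrow> 'e set" where
  "walk_edges p = fst ` set p"

definition walk_verts :: "'v \<Rightarrow> ('e \<times> 'v) list \<Rightarrow> 'v set" where
  "walk_verts u p = insert u (snd ` set p)"

definition walk_subgraph :: "('v, 'e) sgraph \<Rightarrow> 'v \<Rightarrow> ('e \<times> 'v) list \<Rightarrow> ('v, 'e) sgraph" where
  "walk_subgraph G u p = G\<lparr>verts := walk_verts u p, edges := walk_edges p\<rparr>"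


section \<open>Connectedness, circles, blocks\<close>

definition connection :: "('v, 'e) sgraph \<Rightarrow> ('v \<times> 'v) set" where
  "connection G = {(u, v). u \<in> verts G \<and> v \<in> verts G \<and> (\<exists>p. walk G u p v)}"

definition num_components :: "('v, 'e) sgraph \<Rightarrow> nat" where
  "num_components G = card (verts G // connection G)"

definition connected_graph :: "('v, 'e) sgraph \<Rightarrow> bool" where
  "connected_graph G \<longleftrightarrow> verts G \<noteq> {} \<and> (\<forall>u\<in>verts G. \<forall>v\<in>verts G. \<exists>p. walk G u p v)"

definition circle :: "('v, 'e) sgraph \<Rightarrow> bool" where
  "circle C \<longleftrightarrow> signed_graph C \<and> connected_graph C \<and> (\<forall>v\<in>verts C. card (ends_at C v) = 2)"

definition circle_sign :: "('v, 'e) sgraph \<Rightarrow> int" where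
  "circle_sign C = (\<Prod>e\<in>edges C. esign C e)"

text \<open>\<open>c\<close> is a closed walk from \<open>x\<close> going exactly once around the circle \<open>C\<close>.\<close>

definition once_around :: "('v, 'e) sgraph \<Rightarrow> 'v \<Rightarrow> ('e \<times> 'v) list \<Rightarrow> bool" where
  "once_around C x c \<longleftrightarrow> circle C \<and> closed_walk C x c \<and>
     distinct (map fst c) \<and> distinct (map snd c) \<and> walk_edges c = edges C"

definition cut_vertex :: "('v, 'e) sgraph \<Rightarrow> 'v \<Rightarrow> bool" where
  "cut_vertex G v \<longleftrightarrow> v \<in> verts G \<and>
     (num_components (delete_vertex G v) > num_components G \<or>
      (\<exists>e f. is_loop_at G v e \<and> incident G v f \<and> f \<noteq> e))"

definition block :: "('v, 'e) sgraph \<Rightarrow> ('v, 'e) sgraph \<Rightarrow> bool" where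
  "block G B \<longleftrightarrow> subgraph B G \<and> connected_graph B \<and> (\<nexists>v. cut_vertex B v) \<and>
     (\<forall>B'. subgraph B' G \<and> connected_graph B' \<and> (\<nexists>v. cut_vertex B' v) \<and> subgraph B B' \<longrightarrow> B' = B)"

definition end_block :: "('v, 'e) sgraph \<Rightarrow> ('v, 'e) sgraph \<Rightarrow> bool" where
  "end_block G B \<longleftrightarrow> block G B \<and> (\<exists>!B'. block G B' \<and> B' \<noteq> B \<and> verts B \<inter> verts B' \<noteq> {})"

definition circle_block :: "('v, 'e) sgraph \<Rightarrow> ('v, 'e) sgraph \<Rightarrow> bool" where
  "circle_block G C \<longleftrightarrow> block G C \<and> circle C"


section \<open>Signed-graph circuits\<close>

definition circuit_type1 :: "('v, 'e) sgraph \<Rightarrow> bool" where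
  "circuit_type1 H \<longleftrightarrow> circle H \<and> circle_sign H = 1"

text \<open>The condition \<open>C\<^sub>1 \<noteq> C\<^sub>2\<close> matters for loops: a loop meets itself in exactly one vertex.\<close>

definition circuit_type2 :: "('v, 'e) sgraph \<Rightarrow> bool" where
  "circuit_type2 H \<longleftrightarrow> (\<exists>C\<^sub>1 C\<^sub>2. subgraph C\<^sub>1 H \<and> subgraph C\<^sub>2 H \<and> C\<^sub>1 \<noteq> C\<^sub>2 \<and>
     circle C\<^sub>1 \<and> circle_sign C\<^sub>1 = -1 \<and> circle C\<^sub>2 \<and> circle_sign C\<^sub>2 = -1 \<and>
     (\<exists>x. verts C\<^sub>1 \<inter> verts C\<^sub>2 = {x}) \<and> H = graph_union C\<^sub>1 C\<^sub>2)"

definition circuit_type3 :: "('v, 'e) sgraph \<Rightarrow> bool" where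
  "circuit_type3 H \<longleftrightarrow> (\<exists>C\<^sub>1 C\<^sub>2 u p v. subgraph C\<^sub>1 H \<and> subgraph C\<^sub>2 H \<and>
     circle C\<^sub>1 \<and> circle_sign C\<^sub>1 = -1 \<and> circle C\<^sub>2 \<and> circle_sign C\<^sub>2 = -1 \<and>
     verts C\<^sub>1 \<inter> verts C\<^sub>2 = {} \<and>
     path H u p v \<and> p \<noteq> [] \<and> u \<in> verts C\<^sub>1 \<and> v \<in> verts C\<^sub>2 \<and>
     snd ` set (butlast p) \<inter> (verts C\<^sub>1 \<union> verts C\<^sub>2) = {} \<and>
     H = graph_union (graph_union C\<^sub>1 (walk_subgraph H u p)) C\<^sub>2)"

definition sg_circuit :: "('v, 'e) sgraph \<Rightarrow> bool" where
  "sg_circuit H \<longleftrightarrow> circuit_type1 H \<or> circuit_type2 H \<or> circuit_type3 H"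


section \<open>Orientations\<close>

text \<open>
  \<open>\<omega> e b\<close> is the value at the end \<open>(e, b)\<close>.  Values on edges outside \<open>G\<close> are irrelevant, so the
  restriction of \<open>\<omega>\<close> to a subgraph is \<open>\<omega>\<close> itself, considered on that subgraph.
\<close>

definition orientation :: "('v, 'e) sgraph \<Rightarrow> ('e \<Rightarrow> bool \<Rightarrow> int) \<Rightarrow> bool" where
  "orientation G \<omega> \<longleftrightarrow>
     (\<forall>e\<in>edges G. (\<forall>b. \<omega> e b \<in> {1, -1}) \<and> esign G e = - (\<omega> e False * \<omega> e True))"

definition sink :: "('v, 'e) sgraph \<Rightarrow> ('e \<Rightarrow> bool \<Rightarrow> int) \<Rightarrow> 'v \<Rightarrow> bool" where
  "sink G \<omega> v \<longleftrightarrow> v \<in> verts G \<and> (\<forall>(e, b)\<in>ends_at G v. \<omega> e b = 1)"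

definition source :: "('v, 'e) sgraph \<Rightarrow> ('e \<Rightarrow> bool \<Rightarrow> int) \<Rightarrow> 'v \<Rightarrow> bool" where
  "source G \<omega> v \<longleftrightarrow> v \<in> verts G \<and> (\<forall>(e, b)\<in>ends_at G v. \<omega> e b = -1)"


section \<open>Circle-trees\<close>

definition circle_tree :: "('v, 'e) sgraph \<Rightarrow> bool" where
  "circle_tree T \<longleftrightarrow> signed_graph T \<and> edges T \<noteq> {} \<and> connected_graph T \<and>
     (\<forall>B. block T B \<longrightarrow> circle B \<or> card (edges B) = 1) \<and>
     (\<forall>B. end_block T B \<longrightarrow> circle B) \<and>
     (\<forall>v. cut_vertex T v \<longrightarrow> card {B. block T B \<and> v \<in> verts B} = 2)"

definition sesqui_Eulerian :: "('v, 'e) sgraph \<Rightarrow> bool" where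
  "sesqui_Eulerian T \<longleftrightarrow>
     (\<forall>C. circle_block T C \<longrightarrow> circle_sign C = (-1) ^ card {v \<in> verts C. cut_vertex T v})"

definition direction :: "('v, 'e) sgraph \<Rightarrow> ('e \<Rightarrow> bool \<Rightarrow> int) \<Rightarrow> bool" where
  "direction T \<omega> \<longleftrightarrow> orientation T \<omega> \<and> (\<nexists>v. sink T \<omega> v) \<and> (\<nexists>v. source T \<omega> v) \<and>
     (\<forall>C v. circle_block T C \<and> v \<in> verts C \<and> cut_vertex T v \<longrightarrow> sink C \<omega> v \<or> source C \<omega> v)"

definition block_path :: "('v, 'e) sgraph \<Rightarrow> 'v \<Rightarrow> ('e \<times> 'v) list \<Rightarrow> 'v \<Rightarrow> bool" where
  "block_path T u p v \<longleftrightarrow> path T u p v \<and>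
     (\<exists>C\<^sub>1 C\<^sub>2. circle_block T C\<^sub>1 \<and> circle_block T C\<^sub>2 \<and> C\<^sub>1 \<noteq> C\<^sub>2 \<and> u \<in> verts C\<^sub>1 \<and> v \<in> verts C\<^sub>2) \<and>
     (\<forall>e\<in>walk_edges p. \<exists>B. block T B \<and> \<not> circle B \<and> e \<in> edges B)"

definition indicator :: "('v, 'e) sgraph \<Rightarrow> 'e \<Rightarrow> real" where
  "indicator T e =
     (if \<exists>C. circle_block T C \<and> e \<in> edges C then 1
      else if \<exists>u p v. block_path T u p v \<and> e \<in> walk_edges p then 2
      else 0)"

end

(* The tour of T: give every circle block one of its two cyclic orientations, take each bridge in
   both directions, and let the successor of a dart be the next dart in the same block, except
   that at a cut-vertex the tour switches to the other block.  This is a permutation of the darts,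
   and it has a single orbit because removing a cut-vertex separates its two blocks.  A direction
   is coherent along the tour, so the tour is a positive closed walk.  A shortest closed piece of
   the tour must be an end block; hence the tour alternates between complete end circles C_i and
   pieces P_i without repeated vertices, and the circuits are C_i, P_(i+1), C_(i+1). *)

theory Submission
  imports Defs
begin

section \<open>Walks, cut-vertices and blocks\<close>

text \<open>The cyclic orientation of each circle block may be chosen arbitrarily because coherence
  is forced locally. At a cut-vertex all ends in one block carry the same value (by the
  sink-or-source condition for a circle, trivially for a bridge), so the absence of sinks and
  sources gives its two blocks opposite values, and switching blocks keeps the tour coherent. At any
  other vertex there is one circle block with just two ends, which must differ. The tree structure
  is never set up as an object of its own. It enters through one fact: a path with two distinct ends
  in a block stays in that block. From this come the separation at a cut-vertex and hence the single
  orbit. Without cut-vertices \<open>T\<close> is of Type I. If two end blocks meet,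
  \<open>T\<close> is of Type II; this is the only way in which a piece P_i can be empty, and all
  other cases fall under the decomposition.\<close>

lemma ex_bool_flip: "(\<exists>c. P c) \<longleftrightarrow> P b \<or> P (\<not> b)"
  by (cases b) (simp_all add: ex_bool_eq disj_commute)

lemma all_bool_flip: "(\<forall>c. P c) \<longleftrightarrow> P b \<and> P (\<not> b)"
  by (cases b) (simp_all add: all_bool_eq conj_commute)

lemma walk_start: "walk G u p v \<Longrightarrow> signed_graph G \<Longrightarrow> u \<in> verts G"
  by (cases p) (auto simp: signed_graph_def)

lemma walk_append:
  "walk G u p v \<Longrightarrow> walk G v q w \<Longrightarrow> walk G u (p @ q) w"
  by (induction p arbitrary: u) auto

lemma walk_appendD:
  assumes "walk G u (p @ q) w" and "signed_graph G"
  obtains v where "walk G u p v" "walk G v q w"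
  using assms(1)
proof (induction p arbitrary: u thesis)
  case Nil
  then show ?case using walk_start[OF _ assms(2)] by fastforce
next
  case (Cons a p)
  obtain e x where a: "a = (e, x)" by force
  from Cons.prems a have "walk G x (p @ q) w" by simp
  then obtain v where "walk G x p v" "walk G v q w" using Cons.IH by blast
  then show ?case using Cons.prems a by auto
qed

lemma walk_subgraph_mono:
  "walk H u p v \<Longrightarrow> verts H \<subseteq> verts G \<Longrightarrow> edges H \<subseteq> edges G \<Longrightarrow> endpt H = endpt G \<Longrightarrow>
     walk G u p v"
  by (induction p arbitrary: u) auto

lemma walk_end_in_verts: "walk G u p v \<Longrightarrow> v \<in> walk_verts u p"
proof (induction p arbitrary: u)
  case (Cons a p)
  then show ?case by (cases a) (auto simp: walk_verts_def)
qed (auto simp: walk_verts_def)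

lemma walk_edges_subset: "walk G u p v \<Longrightarrow> walk_edges p \<subseteq> edges G"
proof (induction p arbitrary: u)
  case (Cons a p)
  then have "walk G (snd a) p v" "fst a \<in> edges G" by (cases a; auto)+
  then show ?case using Cons.IH by (auto simp: walk_edges_def)
qed (auto simp: walk_edges_def)

lemma walk_verts_subset:
  "walk G u p v \<Longrightarrow> signed_graph G \<Longrightarrow> walk_verts u p \<subseteq> verts G"
proof (induction p arbitrary: u)
  case (Cons a p)
  then show ?case using walk_start[OF Cons.prems]
    by (cases a) (auto simp: walk_verts_def)
qed (auto simp: walk_verts_def)

lemma walk_edge: "e \<in> edges G \<Longrightarrow> signed_graph G \<Longrightarrow> walk G (endpt G e b) [(e, endpt G e (\<not> b))] (endpt G e (\<not> b))"
  by (auto simp: signed_graph_def)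

lemma walk_rev:
  assumes "walk G u p v" "signed_graph G"
  shows "\<exists>q. walk G v q u"
  using assms(1)
proof (induction p arbitrary: u)
  case Nil
  then have "walk G v [] u" by auto
  then show ?case by blast
next
  case (Cons a p)
  obtain e x where a: "a = (e, x)" by force
  from Cons.prems a obtain b where b: "e \<in> edges G" "endpt G e b = u" "endpt G e (\<not> b) = x" and "walk G x p v"
    by auto
  then obtain q where "walk G v q x" using Cons.IH by blast
  moreover have "walk G x [(e, u)] u" using walk_edge[OF b(1) assms(2), of "\<not> b"] b by simp
  ultimately have "walk G v (q @ [(e, u)]) u" by (rule walk_append)
  then show ?case by blast
qed

text \<open>Connectedness is used below mostly in this form: a vertex set that no edge leaves and
  that contains one vertex of a connected graph contains them all.\<close>

lemma walk_closed_set: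
  assumes "walk G u p v" "u \<in> X"
    and "\<And>e b. e \<in> edges G \<Longrightarrow> endpt G e b \<in> X \<Longrightarrow> endpt G e (\<not> b) \<in> X"
  shows "v \<in> X"
  using assms(1,2)
proof (induction p arbitrary: u)
  case (Cons a p)
  then show ?case using assms(3) by (cases a) auto
qed auto

lemma walk_delete:
  "walk G u p v \<Longrightarrow> z \<notin> walk_verts u p \<Longrightarrow> walk (delete_vertex G z) u p v"
proof (induction p arbitrary: u)
  case Nil
  then show ?case by (auto simp: delete_vertex_def walk_verts_def)
next
  case (Cons a p)
  obtain e x where a: "a = (e, x)" by force
  from Cons.prems a obtain b where b: "e \<in> edges G" "endpt G e b = u" "endpt G e (\<not> b) = x" "walk G x p v"
    by auto
  have "z \<notin> walk_verts x p" "u \<noteq> z" "x \<noteq> z" using Cons.prems a by (auto simp: walk_verts_def)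
  moreover have "\<not> incident G z e"
    using b calculation by (simp add: incident_def ex_bool_flip[of _ b])
  ultimately show ?case using Cons.IH[OF b(4)] b a
    by (auto simp: delete_vertex_def)
qed

lemma delete_vertex_simps [simp]:
  "verts (delete_vertex G v) = verts G - {v}"
  "edges (delete_vertex G v) = {e \<in> edges G. \<forall>b. endpt G e b \<noteq> v}"
  "endpt (delete_vertex G v) = endpt G"
  "esign (delete_vertex G v) = esign G"
  by (auto simp: delete_vertex_def incident_def)

lemma graph_union_simps [simp]:
  "verts (graph_union G H) = verts G \<union> verts H"
  "edges (graph_union G H) = edges G \<union> edges H"
  "endpt (graph_union G H) = endpt G"
  "esign (graph_union G H) = esign G"
  by (auto simp: graph_union_def)

lemma walk_subgraph_simps [simp]:
  "verts (walk_subgraph G u p) = walk_verts u p"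
  "edges (walk_subgraph G u p) = walk_edges p"
  "endpt (walk_subgraph G u p) = endpt G"
  "esign (walk_subgraph G u p) = esign G"
  by (auto simp: walk_subgraph_def)

lemma signed_graph_delete: "signed_graph G \<Longrightarrow> signed_graph (delete_vertex G v)"
  by (auto simp: signed_graph_def)

text \<open>A shortest walk is a path, because the stretch between two visits to the same vertex
  could be cut out.\<close>

lemma walk_imp_path:
  assumes "walk G u p v" "signed_graph G"
  obtains q where "path G u q v"
proof -
  obtain q where q: "walk G u q v" and min: "\<And>q'. walk G u q' v \<Longrightarrow> length q \<le> length q'"
    using ex_has_least_nat[of "\<lambda>q. walk G u q v" p length] assms(1) by blast
  have "distinct (u # map snd q)"
  proof (rule ccontr)
    assume "\<not> distinct (u # map snd q)"
    then obtain as bs cs y where dec: "u # map snd q = as @ [y] @ bs @ [y] @ cs"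
      using not_distinct_decomp by blast
    define i where "i = length as"
    define j where "j = length as + length bs + 1"
    have ij: "i < j" "j \<le> length q"
      using arg_cong[OF dec, of length] by (auto simp: i_def j_def)
    have at: "(u # map snd q) ! i = y" "(u # map snd q) ! j = y"
      unfolding dec by (auto simp: i_def j_def nth_append)
    have tk: "walk G u (take k q) ((u # map snd q) ! k) \<and> walk G ((u # map snd q) ! k) (drop k q) v"
      if "k \<le> length q" for k
      using q that
    proof (induction q arbitrary: u k)
      case Nil
      then show ?case by auto
    next
      case (Cons a q)
      obtain e x where a: "a = (e, x)" by force
      show ?case
      proof (cases k)
        case 0
        then show ?thesis using Cons.prems walk_start[OF _ assms(2)] by fastforce
      next
        case (Suc k')
        have "walk G x q v" using Cons.prems a by simp
        then show ?thesis using Cons.IH[of x k'] Cons.prems a Suc by (auto simp: nth_Cons')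
      qed
    qed
    have "walk G u (take i q @ drop j q) v"
      using tk[of i] tk[of j] at ij walk_append by (metis less_or_eq_imp_le order_trans)
    then have "length q \<le> length (take i q @ drop j q)" using min by blast
    then show False using ij by simp
  qed
  then show ?thesis using that q unfolding path_def by blast
qed

text \<open>Supplies the paths for \<open>block_contains_path\<close>: leave \<open>u\<close> by a
  chosen edge and reach \<open>v\<close> without passing \<open>u\<close> again.\<close>

lemma path_Cons:
  assumes "path (delete_vertex G u) w p v" "e \<in> edges G" "endpt G e b = u" "endpt G e (\<not> b) = w"
    "signed_graph G"
  shows "path G u ((e, w) # p) v"
proof -
  have w: "walk (delete_vertex G u) w p v" and d: "distinct (w # map snd p)"
    using assms(1) by (simp_all add: path_def)
  have "walk_verts w p \<subseteq> verts G - {u}"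
    using walk_verts_subset[OF w signed_graph_delete[OF assms(5)]] by simp
  then have "u \<notin> set (w # map snd p)" by (auto simp: walk_verts_def)
  moreover have "walk G w p v" by (rule walk_subgraph_mono[OF w]) auto
  ultimately show ?thesis using assms(2-4) d by (auto simp: path_def)
qed

lemma subgraphD:
  assumes "subgraph H G"
  shows "signed_graph H" "verts H \<subseteq> verts G" "edges H \<subseteq> edges G" "endpt H = endpt G" "esign H = esign G"
  using assms by (auto simp: subgraph_def)

lemma subgraph_trans: "subgraph H G \<Longrightarrow> subgraph G K \<Longrightarrow> subgraph H K"
  by (auto simp: subgraph_def)

lemma walk_subgraphI: "subgraph H G \<Longrightarrow> walk H u p v \<Longrightarrow> walk G u p v"
  by (auto simp: subgraph_def intro: walk_subgraph_mono)

section \<open>Components and cut-vertices\<close>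

lemma equiv_connection:
  assumes "signed_graph G"
  shows "equiv (verts G) (connection G)"
proof (rule equivI)
  show "connection G \<subseteq> verts G \<times> verts G" by (auto simp: connection_def)
  have "walk G x [] x" if "x \<in> verts G" for x using that by simp
  then show "refl_on (verts G) (connection G)"
    unfolding refl_on_def connection_def by blast
  show "sym (connection G)" unfolding sym_def connection_def using walk_rev[OF _ assms] by blast
  show "trans (connection G)"
    unfolding trans_def connection_def using walk_append by fast
qed

lemma finite_components:
  assumes "signed_graph G"
  shows "finite (verts G // connection G)"
  using assms by (intro finite_quotient) (auto simp: signed_graph_def connection_def)

text \<open>The bound is \<open>\<le> 1\<close> and not \<open>= 1\<close> because the graph may be
  empty after a vertex deletion.\<close>

lemma num_components_le_1_iff:
  assumes "signed_graph G"
  shows "num_components G \<le> 1 \<longleftrightarrow> (\<forall>a\<in>verts G. \<forall>b\<in>verts G. \<exists>p. walk G a p b)"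
proof
  note eq = equiv_connection[OF assms]
  have fin: "finite (verts G // connection G)"
    by (rule finite_components[OF assms])
  assume le: "num_components G \<le> 1"
  show "\<forall>a\<in>verts G. \<forall>b\<in>verts G. \<exists>p. walk G a p b"
  proof (intro ballI)
    fix a b assume "a \<in> verts G" "b \<in> verts G"
    then have "connection G `` {a} \<in> verts G // connection G" "connection G `` {b} \<in> verts G // connection G"
      by (auto intro: quotientI)
    then have "connection G `` {a} = connection G `` {b}"
      using le card_le_Suc0_iff_eq[OF fin] unfolding num_components_def by auto
    then have "(a, b) \<in> connection G" using eq \<open>b \<in> verts G\<close> by (simp add: eq_equiv_class_iff \<open>a \<in> verts G\<close>)
    then show "\<exists>p. walk G a p b" by (auto simp: connection_def)
  qed
next
  note eq = equiv_connection[OF assms]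
  assume "\<forall>a\<in>verts G. \<forall>b\<in>verts G. \<exists>p. walk G a p b"
  then have "connection G = verts G \<times> verts G" by (auto simp: connection_def)
  then have "X = verts G" if "X \<in> verts G // connection G" for X
    using that by (auto simp: quotient_def)
  then have "verts G // connection G \<subseteq> {verts G}" by blast
  then show "num_components G \<le> 1" unfolding num_components_def
    using card_mono[of "{verts G}"] by simp
qed

lemma num_components_connected:
  assumes "signed_graph G" "connected_graph G"
  shows "num_components G = 1"
proof -
  have "num_components G \<le> 1" using assms num_components_le_1_iff by (auto simp: connected_graph_def)
  moreover obtain v where v: "v \<in> verts G" using assms by (auto simp: connected_graph_def)
  moreover have "finite (verts G // connection G)"
    by (rule finite_components[OF assms(1)])
  moreover have "verts G // connection G \<noteq> {}" using v by (auto simp: quotient_def)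
  ultimately show ?thesis unfolding num_components_def
    using card_gt_0_iff[of "verts G // connection G"] by linarith
qed

lemma cut_vertex_connected_iff:
  assumes "signed_graph G" "connected_graph G"
  shows "cut_vertex G v \<longleftrightarrow> v \<in> verts G \<and>
    ((\<exists>a\<in>verts G - {v}. \<exists>b\<in>verts G - {v}. \<nexists>p. walk (delete_vertex G v) a p b) \<or>
     (\<exists>e f. is_loop_at G v e \<and> incident G v f \<and> f \<noteq> e))"
proof -
  have "num_components (delete_vertex G v) > num_components G \<longleftrightarrow> \<not> num_components (delete_vertex G v) \<le> 1"
    using num_components_connected[OF assms] by linarith
  then show ?thesis
    unfolding cut_vertex_def num_components_le_1_iff[OF signed_graph_delete[OF assms(1)]] by auto
qed

section \<open>Nonseparable graphs and blocks\<close>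

definition nonseparable :: "('v, 'e) sgraph \<Rightarrow> bool" where
  "nonseparable G \<longleftrightarrow> signed_graph G \<and> connected_graph G \<and> (\<nexists>v. cut_vertex G v)"

lemma nonseparable_walk_avoiding:
  assumes "nonseparable G" "a \<in> verts G" "b \<in> verts G" "a \<noteq> v" "b \<noteq> v"
  obtains p where "walk (delete_vertex G v) a p b"
proof (cases "v \<in> verts G")
  case True
  have "signed_graph G" "connected_graph G" "\<not> cut_vertex G v" using assms(1) by (auto simp: nonseparable_def)
  then have "\<forall>a\<in>verts G - {v}. \<forall>b\<in>verts G - {v}. \<exists>p. walk (delete_vertex G v) a p b"
    using True by (simp add: cut_vertex_connected_iff)
  then show ?thesis using that assms(2-5) by auto
next
  case False
  have "signed_graph G" using assms by (simp add: nonseparable_def)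
  \<comment> \<open>Deleting a vertex outside \<open>G\<close> changes nothing, so users of the
    lemma need not know whether \<open>v\<close> lies in \<open>G\<close>.\<close>
  then have "delete_vertex G v = G"
    using False by (auto simp: signed_graph_def intro!: sgraph.equality)
  moreover obtain p where "walk G a p b"
    using assms(1-3) unfolding nonseparable_def connected_graph_def by blast
  ultimately show ?thesis using that by simp
qed

text \<open>The loop clause of \<open>cut_vertex\<close> forbids a second edge at \<open>v\<close>,
  and then connectedness leaves room for no further vertex.\<close>

lemma nonseparable_loop:
  assumes "nonseparable G" "e \<in> edges G" "endpt G e b = v" "endpt G e (\<not> b) = v"
  shows "verts G = {v}" "edges G = {e}"
proof -
  have sg: "signed_graph G" "connected_graph G" using assms by (auto simp: nonseparable_def)
  have loop: "is_loop_at G v e" using assms(2-4) by (simp add: is_loop_at_def all_bool_flip[of _ b])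
  have v: "v \<in> verts G" using sg assms by (auto simp: signed_graph_def)
  have only: "f = e" if "f \<in> edges G" "endpt G f b' = v" for f b'
    using that loop v assms(1) unfolding nonseparable_def cut_vertex_def incident_def by blast
  have "w = v" if w: "w \<in> verts G" for w
  proof -
    obtain p where "walk G v p w" using sg(2) w v unfolding connected_graph_def by blast
    moreover have "endpt G f (\<not> c) \<in> {v}" if "f \<in> edges G" "endpt G f c \<in> {v}" for f c
      using only[of f c] that loop by (simp add: is_loop_at_def)
    ultimately have "w \<in> {v}" using walk_closed_set[of G v p w "{v}"] by blast
    then show ?thesis by simp
  qed
  then show "verts G = {v}" using v by blast
  have "f = e" if "f \<in> edges G" for f
    using only[OF that, of True] \<open>verts G = {v}\<close> sg(1) that by (simp add: signed_graph_def)
  then show "edges G = {e}" using assms(2) by blast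
qed

lemma blockD:
  assumes "block G B"
  shows "subgraph B G" "nonseparable B"
  using assms by (auto simp: block_def nonseparable_def subgraph_def)

lemma block_maximal:
  assumes "block G B" "nonseparable H" "subgraph H G" "subgraph B H"
  shows "H = B"
  using assms by (auto simp: block_def nonseparable_def)

text \<open>Among the nonseparable subgraphs of \<open>G\<close> containing \<open>H\<close>, one
  with the largest number of vertices plus edges is maximal for inclusion.\<close>

lemma nonseparable_in_block:
  assumes "nonseparable H" "subgraph H G" "signed_graph G"
  obtains B where "block G B" "subgraph H B"
proof -
  let ?Q = "\<lambda>K. nonseparable K \<and> subgraph K G \<and> subgraph H K"
  let ?m = "\<lambda>K. card (verts K) + card (edges K)"
  have fin: "finite (verts G)" "finite (edges G)" using assms by (auto simp: signed_graph_def)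
  have "?Q H" using assms by (auto simp: subgraph_def)
  moreover have "\<forall>K. ?Q K \<longrightarrow> ?m K < Suc (card (verts G) + card (edges G))"
    using fin by (auto simp: subgraph_def card_mono add_mono less_Suc_eq_le)
  ultimately obtain K where K: "?Q K" "\<forall>K'. ?Q K' \<longrightarrow> ?m K' \<le> ?m K"
    using ex_has_greatest_nat[of ?Q H ?m] by blast
  have "K' = K" if "nonseparable K'" "subgraph K' G" "subgraph K K'" for K'
  proof -
    have "?m K' \<le> ?m K" using K that subgraph_trans by blast
    moreover have fK: "finite (verts K')" "finite (edges K')" using that by (auto simp: nonseparable_def signed_graph_def)
    moreover have "card (verts K) \<le> card (verts K')" "card (edges K) \<le> card (edges K')"
      using that fK by (auto simp: subgraph_def card_mono)
    ultimately have "card (verts K) = card (verts K')" "card (edges K) = card (edges K')" by linarith+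
    then have "verts K = verts K'" "edges K = edges K'"
      using card_subset_eq[OF fK(1)] card_subset_eq[OF fK(2)] that(3) by (auto simp: subgraph_def)
    then show ?thesis using that by (auto simp: subgraph_def)
  qed
  then have "block G K" using K unfolding block_def nonseparable_def subgraph_def by blast
  then show ?thesis using that K by blast
qed

text \<open>An edge with its endpoints is nonseparable: deleting an endpoint leaves at most one
  vertex, and the loop clause would need a second edge.\<close>

lemma edge_in_block:
  assumes "signed_graph G" "e \<in> edges G"
  obtains B where "block G B" "e \<in> edges B"
proof -
  define H where "H = G\<lparr>verts := {endpt G e False, endpt G e True}, edges := {e}\<rparr>"
  have simps: "verts H = {endpt G e False, endpt G e True}" "edges H = {e}" "endpt H = endpt G" "esign H = esign G"
    by (auto simp: H_def)
  have sg: "signed_graph H"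
    using assms by (simp add: signed_graph_def simps all_bool_eq)
  have "\<exists>p. walk H u p v" if uv: "u \<in> verts H" "v \<in> verts H" for u v
  proof (cases "u = v")
    case True
    then have "walk H u [] v" using uv by simp
    then show ?thesis by blast
  next
    case False
    then obtain b where "endpt G e b = u" "endpt G e (\<not> b) = v" using uv unfolding simps by auto
    then have "walk H u [(e, v)] v" using uv simps by auto
    then show ?thesis by blast
  qed
  then have con: "connected_graph H" by (auto simp: connected_graph_def simps)
  have "\<not> cut_vertex H v" for v
  proof
    assume "cut_vertex H v"
    then consider a b where "a \<in> verts H - {v}" "b \<in> verts H - {v}" "v \<in> verts H" "\<nexists>p. walk (delete_vertex H v) a p b"
      | e' f where "is_loop_at H v e'" "incident H v f" "f \<noteq> e'"
      unfolding cut_vertex_connected_iff[OF sg con] by blast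
    then show False
    proof cases
      case 1
      then have "a = b" unfolding simps by auto
      then have "walk (delete_vertex H v) a [] b" using 1 by simp
      then show False using 1 by blast
    next
      case 2
      then show False by (auto simp: is_loop_at_def incident_def simps)
    qed
  qed
  then have "nonseparable H" using sg con by (auto simp: nonseparable_def)
  moreover have "subgraph H G" using assms sg by (auto simp: subgraph_def simps signed_graph_def)
  ultimately obtain B where "block G B" "subgraph H B" using nonseparable_in_block assms by metis
  then show ?thesis using that by (auto simp: subgraph_def simps)
qed

text \<open>Any vertex \<open>z\<close> other than \<open>y\<close> misses at least one of the two
  halves; that half survives the deletion of \<open>z\<close> in
  \<open>block_contains_path\<close>.\<close>

lemma path_split:
  assumes "path G u p v" "signed_graph G" "y \<in> walk_verts u p"
  obtains q r where "p = q @ r" "walk G u q y" "walk G y r v" "walk_verts u q \<inter> walk_verts y r = {y}"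
proof -
  have "\<exists>q r. p = q @ r \<and> last (u # map snd q) = y"
  proof (cases "y = u")
    case True
    then have "p = [] @ p \<and> last (u # map snd []) = y" by simp
    then show ?thesis by blast
  next
    case False
    then have "y \<in> snd ` set p" using assms(3) by (auto simp: walk_verts_def)
    then obtain a where "a \<in> set p" "snd a = y" by auto
    then obtain q r where "p = q @ a # r" using split_list by metis
    then have "p = (q @ [a]) @ r \<and> last (u # map snd (q @ [a])) = y" using \<open>snd a = y\<close> by simp
    then show ?thesis by blast
  qed
  then obtain q r where qr: "p = q @ r" "last (u # map snd q) = y" by blast
  have wl: "walk G a q w \<Longrightarrow> last (a # map snd q) = w" for a w
    by (induction q arbitrary: a) auto
  obtain w where w: "walk G u q w" "walk G w r v" 
    using assms qr walk_appendD unfolding path_def by metis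
  then have [simp]: "w = y" using wl qr by metis
  have "y \<in> walk_verts u q" using qr(2) by (auto simp: walk_verts_def last_map split: if_splits)
  moreover have "walk_verts u q \<inter> snd ` set r = {}"
    using assms(1) qr unfolding path_def walk_verts_def by auto
  ultimately have "walk_verts u q \<inter> walk_verts y r = {y}" by (auto simp: walk_verts_def)
  then show ?thesis using that qr w by simp
qed

lemma walk_within_walk_subgraph:
  assumes "walk G u p v" "walk_edges p \<subseteq> edges H" "walk_verts u p \<subseteq> verts H" "endpt H = endpt G"
  shows "walk H u p v"
  using assms
  by (induction p arbitrary: u) (auto simp: walk_edges_def walk_verts_def)

lemma walk_edges_endpoints:
  assumes "walk G u p v" "e \<in> walk_edges p"
  shows "endpt G e b \<in> walk_verts u p"
  using assms
proof (induction p arbitrary: u)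
  case (Cons a p)
  obtain e' x where a: "a = (e', x)" by force
  show ?case
  proof (cases "e = e'")
    case True
    then obtain c where "endpt G e c = u" "endpt G e (\<not> c) = x" using Cons.prems a by auto
    then have "endpt G e b \<in> {u, x}" by (cases "b = c") auto
    then show ?thesis using a by (auto simp: walk_verts_def)
  next
    case False
    then have "endpt G e b \<in> walk_verts x p"
      using Cons a by (auto simp: walk_edges_def)
    then show ?thesis using a by (auto simp: walk_verts_def)
  qed
qed (auto simp: walk_edges_def)

lemma path_no_loop:
  assumes "path G u p v" "e \<in> walk_edges p"
  shows "endpt G e b \<noteq> endpt G e (\<not> b)"
  using assms
proof (induction p arbitrary: u)
  case (Cons a p)
  obtain e' x where a: "a = (e', x)" by force
  show ?case
  proof (cases "e = e'")
    case True
    then obtain c where "endpt G e c = u" "endpt G e (\<not> c) = x" "u \<noteq> x"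
      using Cons.prems a by (auto simp: path_def)
    then show ?thesis by (cases "b = c") auto
  next
    case False
    then show ?thesis using Cons a by (auto simp: path_def walk_edges_def)
  qed
qed (auto simp: walk_edges_def)

text \<open>A hub argument: every walk is routed through \<open>B\<close>. It serves both for a
  graph and for the graph after a vertex deletion.\<close>

lemma connected_viaI:
  assumes sg: "signed_graph H" and B: "B \<noteq> {}" "\<And>a b. a \<in> B \<Longrightarrow> b \<in> B \<Longrightarrow> \<exists>p. walk H a p b"
    and to: "\<And>a. a \<in> verts H \<Longrightarrow> \<exists>b\<in>B. \<exists>p. walk H a p b"
    and uv: "u \<in> verts H" "v \<in> verts H"
  shows "\<exists>p. walk H u p v"
proof -
  obtain a p where a: "a \<in> B" "walk H u p a" using to uv by blast
  obtain b q where b: "b \<in> B" "walk H v q b" using to uv by blast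
  obtain q' where q': "walk H b q' v" using walk_rev[OF b(2) sg] by blast
  obtain r where r: "walk H a r b" using B a b by blast
  show ?thesis using walk_append[OF a(2) walk_append[OF r q']] by blast
qed

text \<open>Attaching to \<open>B\<close> a path between two of its vertices creates no cut-vertex: when \<open>z\<close> is
  deleted, every remaining vertex of the path still reaches one of its two ends.\<close>

lemma block_contains_path:
  assumes bl: "block G B" and sgG: "signed_graph G" and pa: "path G v p a"
    and vB: "v \<in> verts B" and aB: "a \<in> verts B" and va: "v \<noteq> a"
  shows "walk_edges p \<subseteq> edges B"
proof -
  note B = blockD[OF bl] and BG = subgraphD[OF blockD(1)[OF bl]]
  have wp: "walk G v p a" using pa by (simp add: path_def)
  define H where "H = graph_union B (walk_subgraph G v p)"
  have simps: "verts H = verts B \<union> walk_verts v p" "edges H = edges B \<union> walk_edges p"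
    "endpt H = endpt G" "esign H = esign G" using BG by (auto simp: H_def)
  have fin: "finite (walk_edges p)" "finite (walk_verts v p)" by (auto simp: walk_edges_def walk_verts_def)
  have wpG: "walk_edges p \<subseteq> edges G" "walk_verts v p \<subseteq> verts G"
    using walk_edges_subset[OF wp] walk_verts_subset[OF wp sgG] by auto
  have sg: "signed_graph H"
    using BG(1,4,5) fin wpG sgG walk_edges_endpoints[OF wp]
    unfolding signed_graph_def simps by auto
  have BH: "subgraph B H" using BG by (auto simp: subgraph_def simps)
  have HG: "subgraph H G" using BG wpG sg by (auto simp: subgraph_def simps)
  have conB: "connected_graph B" using B by (auto simp: nonseparable_def)
  have split: "\<exists>q r. walk H v q y \<and> walk H y r a \<and> walk_verts v q \<inter> walk_verts y r = {y}"
    if y: "y \<in> walk_verts v p" for y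
  proof -
    obtain q r where qr: "p = q @ r" "walk G v q y" "walk G y r a" "walk_verts v q \<inter> walk_verts y r = {y}"
      using path_split[OF pa sgG y] by metis
    have "walk H v q y" using qr
      by (intro walk_within_walk_subgraph[OF qr(2)]) (auto simp: simps walk_edges_def walk_verts_def)
    moreover have "walk_verts y r \<subseteq> walk_verts v p" using y qr(1) by (auto simp: walk_verts_def)
    then have "walk H y r a" using qr
      by (intro walk_within_walk_subgraph[OF qr(3)]) (auto simp: simps walk_edges_def)
    ultimately show ?thesis using qr by blast
  qed
  have con: "connected_graph H"
  proof -
    have "\<exists>p. walk H x p y" if "x \<in> verts H" "y \<in> verts H" for x y
    proof (rule connected_viaI[OF sg, of "verts B"])
      show "verts B \<noteq> {}" using vB by auto
      show "\<exists>p. walk H a p b" if "a \<in> verts B" "b \<in> verts B" for a b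
        using that conB walk_subgraphI[OF BH] unfolding connected_graph_def by blast
      show "\<exists>b\<in>verts B. \<exists>p. walk H a p b" if "a \<in> verts H" for a
      proof (cases "a \<in> verts B")
        case True
        then have "walk H a [] a" using that by simp
        then show ?thesis using True by blast
      next
        case False
        then show ?thesis using split[of a] that simps aB by auto
      qed
    qed (use that in auto)
    then show ?thesis using vB by (auto simp: connected_graph_def simps)
  qed
  have "\<not> cut_vertex H z" for z
  proof
    assume "cut_vertex H z"
    then consider x y where "x \<in> verts H - {z}" "y \<in> verts H - {z}" "\<nexists>p. walk (delete_vertex H z) x p y"
      | e' f where "is_loop_at H z e'" "incident H z f" "f \<noteq> e'"
      unfolding cut_vertex_connected_iff[OF sg con] by blast
    then show False
    proof cases
      case 1
      have "\<exists>p. walk (delete_vertex H z) x p y"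
      proof (rule connected_viaI[OF signed_graph_delete[OF sg], of "verts B - {z}"])
        show "verts B - {z} \<noteq> {}" using vB aB va by auto
        show "\<exists>p. walk (delete_vertex H z) a p b" if ab: "a \<in> verts B - {z}" "b \<in> verts B - {z}" for a b
        proof -
          obtain p where "walk (delete_vertex B z) a p b" using nonseparable_walk_avoiding[OF B(2)] ab by blast
          then have "walk (delete_vertex H z) a p b"
            by (rule walk_subgraph_mono) (use BH in \<open>auto simp: subgraph_def\<close>)
          then show ?thesis by blast
        qed
        show "\<exists>b\<in>verts B - {z}. \<exists>p. walk (delete_vertex H z) c p b"
          if c: "c \<in> verts (delete_vertex H z)" for c
        proof (cases "c \<in> verts B")
          case True
          then have "walk (delete_vertex H z) c [] c" using c by simp
          moreover have "c \<in> verts B - {z}" using True c by simp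
          ultimately show ?thesis by blast
        next
          case False
          then obtain q r where qr: "walk H v q c" "walk H c r a" "walk_verts v q \<inter> walk_verts c r = {c}"
            using split[of c] c simps by auto
          have "v \<in> walk_verts v q" by (simp add: walk_verts_def)
          moreover have "a \<in> walk_verts c r" using walk_end_in_verts[OF qr(2)] .
          ultimately have "z \<notin> walk_verts v q \<or> z \<notin> walk_verts c r" "z \<notin> walk_verts v q \<longrightarrow> z \<noteq> v"
            "z \<notin> walk_verts c r \<longrightarrow> z \<noteq> a" using qr(3) c by auto
          moreover have "\<exists>p. walk (delete_vertex H z) c p v" if "z \<notin> walk_verts v q"
            using walk_rev[OF walk_delete[OF qr(1) that] signed_graph_delete[OF sg]] by blast
          moreover have "\<exists>p. walk (delete_vertex H z) c p a" if "z \<notin> walk_verts c r"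
            using walk_delete[OF qr(2) that] by blast
          ultimately show ?thesis using vB aB by blast
        qed
      qed (use 1 in auto)
      then show False using 1 by blast
    next
      \<comment> \<open>A loop cannot lie on the path, and a loop of \<open>B\<close> would shrink
        \<open>B\<close> to one vertex although it contains both \<open>v\<close> and
        \<open>a\<close>.\<close>
      case 2
      then have e': "e' \<in> edges H" "endpt G e' False = z" "endpt G e' True = z" by (auto simp: is_loop_at_def simps)
      then have "e' \<notin> walk_edges p" using path_no_loop[OF pa, of e' False] by auto
      then have "e' \<in> edges B" using e' simps by auto
      then have "verts B = {z}" using nonseparable_loop(1)[OF B(2), of e' False z] e' BG by auto
      then show False using vB aB va by auto
    qed
  qed
  then have "nonseparable H" using sg con by (auto simp: nonseparable_def)
  then have "H = B" using block_maximal[OF bl _ HG BH] by blast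
  then show ?thesis using simps by auto
qed

text \<open>Let \<open>g\<close> be an edge of \<open>B'\<close> at a shared vertex. Inside
  \<open>B'\<close> it can be continued, without returning to that vertex, to another shared vertex;
  this path has both ends in \<open>B\<close>, so it lies in \<open>B\<close>. Hence the shared
  vertices are closed under the edges of \<open>B'\<close>, \<open>B'\<close> is a subgraph of
  \<open>B\<close>, and maximality gives equality.\<close>

lemma blocks_share_two_vertices:
  assumes "block G B" "block G B'" "signed_graph G" "v \<in> verts B \<inter> verts B'" "a \<in> verts B \<inter> verts B'" "v \<noteq> a"
  shows "B = B'"
proof -
  note B = blockD[OF assms(1)] and B' = blockD[OF assms(2)]
  note BG = subgraphD[OF B(1)] and B'G = subgraphD[OF B'(1)]
  let ?X = "verts B \<inter> verts B'"
  have step: "g \<in> edges B \<and> endpt B' g (\<not> b) \<in> ?X" if g: "g \<in> edges B'" "endpt B' g b \<in> ?X" for g b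
  proof -
    let ?x = "endpt B' g b" and ?w = "endpt B' g (\<not> b)"
    obtain c where c: "c \<in> ?X" "c \<noteq> ?x" using assms(4-6) by metis
    have xw: "?w \<noteq> ?x"
    proof
      assume "?w = ?x"
      then have "verts B' = {?x}" using nonseparable_loop(1)[OF B'(2) g(1)] by auto
      then show False using c by auto
    qed
    have w: "?w \<in> verts B'" using B'G(1) g by (auto simp: signed_graph_def)
    obtain p where "walk (delete_vertex B' ?x) ?w p c"
      using nonseparable_walk_avoiding[OF B'(2), of ?w c ?x] w c xw by auto
    then obtain q where "path (delete_vertex B' ?x) ?w q c"
      using walk_imp_path signed_graph_delete[OF B'G(1)] by metis
    then have "path B' ?x ((g, ?w) # q) c" using path_Cons[OF _ g(1) refl refl B'G(1)] by blast
    then have "path G ?x ((g, ?w) # q) c"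
      unfolding path_def using walk_subgraphI[OF B'(1)] by blast
    then have "walk_edges ((g, ?w) # q) \<subseteq> edges B"
      using block_contains_path[OF assms(1,3)] g c by auto
    then have "g \<in> edges B" by (auto simp: walk_edges_def)
    moreover from this have "?w \<in> verts B" using BG(1,4) B'G(4) by (auto simp: signed_graph_def)
    ultimately show ?thesis using w by auto
  qed
  have "w \<in> ?X" if w: "w \<in> verts B'" for w
  proof -
    obtain p where "walk B' v p w" using w assms(4) B'(2) unfolding nonseparable_def connected_graph_def by blast
    then show ?thesis using walk_closed_set[of B' v p w ?X] assms(4) step by blast
  qed
  moreover from this have "edges B' \<subseteq> edges B" using step B'G(1) by (auto simp: signed_graph_def)
  ultimately have "subgraph B' B" using BG B'G by (auto simp: subgraph_def)
  then show ?thesis using block_maximal[OF assms(2) B(2) B(1)] by blast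
qed

text \<open>A loop gives only one common vertex and is handled by \<open>nonseparable_loop\<close>;
  any other edge gives two.\<close>

lemma blocks_share_edge:
  assumes "block G B" "block G B'" "signed_graph G" "e \<in> edges B" "e \<in> edges B'"
  shows "B = B'"
proof (cases "endpt G e True = endpt G e False")
  case True
  note B = blockD[OF assms(1)] and B' = blockD[OF assms(2)]
  note BG = subgraphD[OF B(1)] and B'G = subgraphD[OF B'(1)]
  have "verts B = {endpt G e False}" "edges B = {e}"
    using nonseparable_loop[OF B(2) assms(4), of False "endpt G e False"] True BG by auto
  moreover have "verts B' = {endpt G e False}" "edges B' = {e}"
    using nonseparable_loop[OF B'(2) assms(5), of False "endpt G e False"] True B'G by auto
  ultimately show ?thesis using BG B'G by (auto intro!: sgraph.equality)
next
  case False
  have "endpt G e b \<in> verts B \<inter> verts B'" for b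
    using subgraphD(1,4)[OF blockD(1)[OF assms(1)]] subgraphD(1,4)[OF blockD(1)[OF assms(2)]] assms(4,5)
    unfolding signed_graph_def by (metis IntI)
  then show ?thesis using blocks_share_two_vertices[OF assms(1-3) _ _ False] by blast
qed

lemma connected_edge_at:
  assumes "connected_graph H" "signed_graph H" "edges H \<noteq> {}" "v \<in> verts H"
  obtains e b where "e \<in> edges H" "endpt H e b = v"
proof -
  obtain e where e: "e \<in> edges H" using assms(3) by blast
  then have "endpt H e True \<in> verts H" using assms(2) by (auto simp: signed_graph_def)
  then obtain p where p: "walk H v p (endpt H e True)" using assms(1,4) unfolding connected_graph_def by blast
  show ?thesis
  proof (cases p)
    case Nil
    then show ?thesis using p e that by auto
  next
    case (Cons a q)
    then show ?thesis using p that by (cases a) auto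
  qed
qed

text \<open>Otherwise an edge of \<open>B'\<close> at \<open>v\<close> could be continued, avoiding
  \<open>v\<close>, to a neighbour of \<open>v\<close> in \<open>B\<close>. That path would lie in
  \<open>B\<close>, and the blocks would share an edge. Loops at \<open>v\<close> are excluded
  first, since together with a second edge they make \<open>v\<close> a cut-vertex.\<close>

lemma in_two_blocks_cut_vertex:
  assumes "block G B" "block G B'" "signed_graph G" "connected_graph G"
    and "edges B \<noteq> {}" "edges B' \<noteq> {}" "v \<in> verts B" "v \<in> verts B'" "B \<noteq> B'"
  shows "cut_vertex G v"
proof (rule ccontr)
  assume ncut: "\<not> cut_vertex G v"
  note B = blockD[OF assms(1)] and B' = blockD[OF assms(2)]
  note BG = subgraphD[OF B(1)] and B'G = subgraphD[OF B'(1)]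
  obtain e b where e: "e \<in> edges B" "endpt G e b = v"
    using connected_edge_at[of B v] assms BG B(2) unfolding nonseparable_def by metis
  obtain f c where f: "f \<in> edges B'" "endpt G f c = v"
    using connected_edge_at[of B' v] assms B'G B'(2) unfolding nonseparable_def by metis
  have ne: "e \<noteq> f" using blocks_share_edge[OF assms(1-3)] e f assms(9) by blast
  have v: "v \<in> verts G" using BG assms by auto
  have noloop: "\<not> is_loop_at G v e'" "\<not> (incident G v f' \<and> is_loop_at G v e' \<and> f' \<noteq> e')" for e' f'
  proof -
    show "\<not> (incident G v f' \<and> is_loop_at G v e' \<and> f' \<noteq> e')" for e' f'
      using ncut v unfolding cut_vertex_def by blast
    moreover have "incident G v e" "incident G v f" using e f BG B'G by (auto simp: incident_def)
    ultimately show "\<not> is_loop_at G v e'" using ne by metis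
  qed
  let ?a = "endpt G e (\<not> b)" and ?w = "endpt G f (\<not> c)"
  have "?a \<noteq> v" using noloop(1)[of e] e BG(3) by (auto simp: is_loop_at_def all_bool_flip[of _ b])
  moreover have "?w \<noteq> v" using noloop(1)[of f] f B'G(3) by (auto simp: is_loop_at_def all_bool_flip[of _ c])
  moreover have "?a \<in> verts B" using e BG(1,4) by (auto simp: signed_graph_def)
  moreover have "?w \<in> verts G" using f B'G(1,2,4) by (auto simp: signed_graph_def)
  ultimately have aw: "?a \<in> verts G - {v}" "?w \<in> verts G - {v}" "?a \<in> verts B" "?a \<noteq> v" using BG(2) by auto
  have "\<forall>a\<in>verts G - {v}. \<forall>b\<in>verts G - {v}. \<exists>p. walk (delete_vertex G v) a p b"
    using ncut v cut_vertex_connected_iff[OF assms(3,4), of v] by blast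
  then obtain p where "walk (delete_vertex G v) ?w p ?a" using aw by blast
  then obtain q where "path (delete_vertex G v) ?w q ?a"
    using walk_imp_path signed_graph_delete[OF assms(3)] by metis
  then have "path G v ((f, ?w) # q) ?a" using path_Cons[OF _ _ f(2) refl assms(3)] f(1) B'G(3) by blast
  then have "walk_edges ((f, ?w) # q) \<subseteq> edges B"
    using block_contains_path[OF assms(1,3)] aw assms(7) by blast
  then have "f \<in> edges B" by (auto simp: walk_edges_def)
  then show False using blocks_share_edge[OF assms(1-3)] f(1) assms(9) by blast
qed

text \<open>Every walk to \<open>v\<close> arrives through an edge of \<open>B\<close>, so it passes
  a vertex of \<open>B\<close> just before, and \<open>B\<close> without \<open>v\<close> is still
  connected. Used to compare the cut-vertices of \<open>part C\<close> with those of
  \<open>T\<close>.\<close>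

lemma not_cut_vertex_in_single_block:
  assumes S: "signed_graph S" "connected_graph S" and B: "subgraph B S" "nonseparable B" and v: "v \<in> verts B"
    and all: "\<And>e b. e \<in> edges S \<Longrightarrow> endpt S e b = v \<Longrightarrow> e \<in> edges B"
  shows "\<not> cut_vertex S v"
proof
  note BS = subgraphD[OF B(1)]
  assume "cut_vertex S v"
  then consider x y where "x \<in> verts S - {v}" "y \<in> verts S - {v}" "\<nexists>p. walk (delete_vertex S v) x p y"
    | e f where "is_loop_at S v e" "incident S v f" "f \<noteq> e"
    unfolding cut_vertex_connected_iff[OF S] by blast
  then show False
  proof cases
    case 1
    have reach: "\<exists>b\<in>verts B - {v}. \<exists>p. walk (delete_vertex S v) a p b" if "walk S a p v" "a \<noteq> v" for a p
      using that
    proof (induction p arbitrary: a)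
      case (Cons s p)
      obtain e x where s: "s = (e, x)" by force
      from Cons.prems s obtain b where b: "e \<in> edges S" "endpt S e b = a" "endpt S e (\<not> b) = x" "walk S x p v"
        by auto
      have aS: "a \<in> verts S" using b S(1) by (auto simp: signed_graph_def)
      show ?case
      proof (cases "x = v")
        case True
        then have "e \<in> edges B" using all b by blast
        then have "a \<in> verts B" using b BS(1,4) by (auto simp: signed_graph_def)
        moreover have "walk (delete_vertex S v) a [] a" using aS Cons.prems by simp
        ultimately show ?thesis using Cons.prems(2) by blast
      next
        case False
        then obtain c q where c: "c \<in> verts B - {v}" "walk (delete_vertex S v) x q c" using Cons.IH b by blast
        have "\<forall>c. endpt S e c \<noteq> v" using b False Cons.prems(2) by (simp add: all_bool_flip[of _ b])
        then have "walk (delete_vertex S v) a (s # q) c" using b c s by auto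
        then show ?thesis using c by blast
      qed
    qed auto
    have "\<exists>p. walk (delete_vertex S v) x p y"
    proof (rule connected_viaI[OF signed_graph_delete[OF S(1)], of "verts B - {v}"])
      have to: "\<exists>b\<in>verts B - {v}. \<exists>p. walk (delete_vertex S v) a p b" if a: "a \<in> verts (delete_vertex S v)" for a
      proof -
        obtain p where "walk S a p v" using S(2) a v BS(2) unfolding connected_graph_def by fastforce
        then show ?thesis using reach a by auto
      qed
      then show "verts B - {v} \<noteq> {}" using 1(1) by fastforce
      show "\<exists>b\<in>verts B - {v}. \<exists>p. walk (delete_vertex S v) a p b" if "a \<in> verts (delete_vertex S v)" for a
        using to that .
      show "\<exists>p. walk (delete_vertex S v) a p b" if ab: "a \<in> verts B - {v}" "b \<in> verts B - {v}" for a b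
      proof -
        obtain p where "walk (delete_vertex B v) a p b" using nonseparable_walk_avoiding[OF B(2)] ab by blast
        then have "walk (delete_vertex S v) a p b"
          by (rule walk_subgraph_mono) (use BS in auto)
        then show ?thesis by blast
      qed
    qed (use 1 in auto)
    then show False using 1 by blast
  next
    case 2
    then have ef: "e \<in> edges B" "endpt S e True = v" "endpt S e False = v" "f \<in> edges B"
      using all unfolding is_loop_at_def incident_def by blast+
    then have "edges B = {e}" using nonseparable_loop(2)[OF B(2), of e True v] BS by auto
    then show False using ef 2 by auto
  qed
qed

text \<open>\<open>S\<close> consists of the edges on the side of \<open>B\<close> when \<open>G\<close> is pulled apart at \<open>v\<close>.\<close>

lemma block_side:
  assumes bl: "block G B" and sg: "signed_graph G" and v: "v \<in> verts B"
  obtains S where "\<And>e b. e \<in> edges G \<Longrightarrow> endpt G e b = v \<Longrightarrow> e \<in> S \<longleftrightarrow> e \<in> edges B"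
    and "\<And>e g b c. e \<in> S \<Longrightarrow> g \<in> edges G \<Longrightarrow> endpt G e b = endpt G g c \<Longrightarrow> endpt G e b \<noteq> v \<Longrightarrow> g \<in> S"
proof -
  note B = blockD[OF bl]
  note BG = subgraphD[OF B(1)]
  \<comment> \<open>\<open>?r\<close> marks the side of \<open>B\<close>: the vertices still joined
    to the rest of \<open>B\<close> after \<open>v\<close> is deleted.\<close>
  let ?r = "\<lambda>w. w \<noteq> v \<and> (\<exists>a\<in>verts B - {v}. \<exists>p. walk (delete_vertex G v) w p a)"
  define S where "S = {e \<in> edges G. e \<in> edges B \<or> (\<exists>b. ?r (endpt G e b))}"
  have rB: "?r w" if "w \<in> verts B" "w \<noteq> v" for w
  proof -
    have "walk (delete_vertex G v) w [] w" using that BG(2) by auto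
    then show ?thesis using that by blast
  qed
  have 1: "e \<in> S \<longleftrightarrow> e \<in> edges B" if e: "e \<in> edges G" "endpt G e b = v" for e b
  proof
    assume "e \<in> S"
    show "e \<in> edges B"
    proof (rule ccontr)
      \<comment> \<open>Such an edge would begin a path from \<open>v\<close> to another vertex of
        \<open>B\<close>, and this path lies in \<open>B\<close>.\<close>
      assume "e \<notin> edges B"
      then obtain c where c: "?r (endpt G e c)" using \<open>e \<in> S\<close> S_def by auto
      then have "c = (\<not> b)" using e by (cases "c = b") auto
      obtain a p where a: "a \<in> verts B - {v}" "walk (delete_vertex G v) (endpt G e c) p a" using c by blast
      then obtain q where "path (delete_vertex G v) (endpt G e c) q a"
        using walk_imp_path signed_graph_delete[OF sg] by metis
      then have "path G v ((e, endpt G e c) # q) a"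
        using path_Cons[OF _ e(1,2) _ sg] \<open>c = (\<not> b)\<close> by blast
      then have "walk_edges ((e, endpt G e c) # q) \<subseteq> edges B"
        using block_contains_path[OF bl sg] a v by blast
      then show False using \<open>e \<notin> edges B\<close> by (auto simp: walk_edges_def)
    qed
  qed (use e S_def in auto)
  have 2: "g \<in> S" if g: "e \<in> S" "g \<in> edges G" "endpt G e b = endpt G g c" "endpt G e b \<noteq> v" for e g b c
  proof -
    have "?r (endpt G e b)"
    proof (cases "e \<in> edges B")
      case True
      then have "endpt G e b \<in> verts B" using BG(1,4) by (auto simp: signed_graph_def)
      then show ?thesis using rB g by blast
    next
      case False
      then obtain b' where b': "?r (endpt G e b')" "e \<in> edges G" using g(1) S_def by auto
      show ?thesis
      proof (cases "b' = b")
        case True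
        then show ?thesis using b' by simp
      next
        case False
        then have nb: "b' = (\<not> b)" by auto
        then have "\<forall>c. endpt G e c \<noteq> v" using b' g(4) by (simp add: all_bool_flip[of _ b])
        then have "walk (delete_vertex G v) (endpt G e b) ((e, endpt G e b') # p) a"
          if "walk (delete_vertex G v) (endpt G e b') p a" for p a using that nb b'(2) by auto
        then show ?thesis using b' g(4) by blast
      qed
    qed
    then show ?thesis using g S_def by auto
  qed
  show ?thesis using that 1 2 by blast
qed

section \<open>Iterates of an injective map, and basic facts on circles\<close>

lemma funpow_return:
  assumes "finite A" "inj_on g A" "g ` A \<subseteq> A" "x \<in> A"
  obtains n where "n > 0" "(g ^^ n) x = x"
proof -
  have inA: "(g ^^ n) x \<in> A" for n using assms(3,4) by (induction n) auto
  then have "finite (range (\<lambda>n. (g ^^ n) x))" using assms(1) by (meson finite_subset image_subsetI)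
  then have "\<not> inj (\<lambda>n. (g ^^ n) x)" using finite_imageD infinite_UNIV_nat by blast
  then obtain i j where ij: "i < j" "(g ^^ i) x = (g ^^ j) x" by (metis linorder_injI)
  \<comment> \<open>Injectivity strips the common first \<open>i\<close> iterations.\<close>
  have "(g ^^ (j - i)) x = x" using ij
  proof (induction i arbitrary: j)
    case (Suc i)
    then obtain j' where j': "j = Suc j'" using less_imp_Suc_add by blast
    then have "(g ^^ i) x = (g ^^ j') x" using Suc.prems inA assms(2) by (auto dest: inj_onD)
    then show ?case using Suc j' by auto
  qed auto
  then show ?thesis using that ij by (meson zero_less_diff)
qed

lemma circle_edges_nonempty: "circle C \<Longrightarrow> edges C \<noteq> {}"
proof
  assume C: "circle C" "edges C = {}"
  then obtain v where "v \<in> verts C" unfolding circle_def connected_graph_def by blast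
  then have "card (ends_at C v) = 2" using C by (auto simp: circle_def)
  then show False using C(2) by (auto simp: ends_at_def)
qed

text \<open>At a vertex of \<open>C\<close> both graphs have exactly two ends, so \<open>C\<close>
  already contains every edge of \<open>D\<close> there, and connectedness of \<open>D\<close> does
  the rest.\<close>

lemma circle_subgraph_eq:
  assumes "circle C" "circle D" "subgraph C D"
  shows "C = D"
proof -
  note CD = subgraphD[OF assms(3)]
  have fin: "finite (ends_at D v)" if "v \<in> verts D" for v
    using assms(2) that by (auto simp: circle_def intro: card_ge_0_finite)
  have ends: "ends_at C v = ends_at D v" if v: "v \<in> verts C" for v
    using fin v CD assms by (intro card_subset_eq) (auto simp: circle_def ends_at_def)
  have step: "e \<in> edges C \<and> endpt D e (\<not> b) \<in> verts C" if "e \<in> edges D" "endpt D e b \<in> verts C" for e b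
  proof -
    have "(e, b) \<in> ends_at C (endpt D e b)" using ends that by (simp add: ends_at_def)
    then have "e \<in> edges C" by (simp add: ends_at_def)
    then show ?thesis using CD(1,4) by (auto simp: signed_graph_def)
  qed
  obtain u where u: "u \<in> verts C" using assms(1) unfolding circle_def connected_graph_def by blast
  have "w \<in> verts C" if w: "w \<in> verts D" for w
  proof -
    obtain p where "walk D u p w" using u w CD(2) assms(2) unfolding circle_def connected_graph_def by blast
    then show ?thesis using walk_closed_set[of D u p w "verts C"] u step by blast
  qed
  moreover from this have "edges D \<subseteq> edges C" using step assms(2) by (auto simp: circle_def signed_graph_def)
  ultimately show ?thesis using CD by (auto intro!: sgraph.equality)
qed

text \<open>The first vertex of a path carries only one end of the path's edges, so no circle uses
  the first edge; induction removes it.\<close>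

lemma no_circle_in_path:
  assumes "path G u p v" "circle D" "endpt D = endpt G" "edges D \<subseteq> walk_edges p"
  shows False
  using assms(1,4)
proof (induction p arbitrary: u)
  case Nil
  then show ?case using circle_edges_nonempty[OF assms(2)] by (auto simp: walk_edges_def)
next
  case (Cons a p)
  obtain e x where a: "a = (e, x)" by force
  have p: "path G x p v" "u \<notin> walk_verts x p" "walk G x p v"
    using Cons.prems a by (auto simp: path_def walk_verts_def)
  show ?case
  proof (cases "e \<in> edges D")
    case False
    then show ?thesis using Cons a p by (auto simp: walk_edges_def)
  next
    case True
    obtain b where b: "endpt G e b = u" "endpt G e (\<not> b) = x" "u \<noteq> x"
      using Cons.prems a by (auto simp: path_def)
    have "u \<in> verts D" using True b assms(2,3) by (auto simp: circle_def signed_graph_def)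
    then have "card (ends_at D u) = 2" using assms(2) by (auto simp: circle_def)
    moreover have "ends_at D u \<subseteq> {(e, b)}"
    proof clarify
      fix g c assume "(g, c) \<in> ends_at D u"
      then have g: "g \<in> edges D" "endpt G g c = u" using assms(3) by (auto simp: ends_at_def)
      then have "g \<notin> walk_edges p" using walk_edges_endpoints[OF p(3), of g c] p(2) by auto
      then have "g = e" using g(1) Cons.prems(2) a by (auto simp: walk_edges_def)
      moreover from this have "c = b" using g b by (cases "c = b") auto
      ultimately show "g = e \<and> c = b" by blast
    qed
    ultimately show False using card_mono[of "{(e, b)}" "ends_at D u"] by simp
  qed
qed

lemma loop_circle:
  assumes "signed_graph B" "verts B = {v}" "edges B = {e}"
  shows "circle B"
proof -
  have ep: "endpt B e b = v" for b using assms by (auto simp: signed_graph_def)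
  have "walk B v [] v" using assms by simp
  then have "connected_graph B" unfolding connected_graph_def assms(2) by blast
  moreover have "ends_at B v = {(e, True), (e, False)}" using ep assms(3) by (auto simp: ends_at_def)
  ultimately show ?thesis using assms by (simp add: circle_def)
qed

lemma single_edge_block:
  assumes "nonseparable B" "\<not> circle B" "card (edges B) = 1"
  obtains e where "edges B = {e}" "verts B = {endpt B e True, endpt B e False}"
    "endpt B e True \<noteq> endpt B e False"
proof -
  obtain e where e: "edges B = {e}" using assms(3) card_1_singletonE by blast
  have sg: "signed_graph B" "connected_graph B" using assms(1) by (auto simp: nonseparable_def)
  have V: "verts B = {endpt B e True, endpt B e False}"
  proof
    show "verts B \<subseteq> {endpt B e True, endpt B e False}"
    proof
      fix v assume "v \<in> verts B"
      then obtain f b where "f \<in> edges B" "endpt B f b = v" using connected_edge_at[OF sg(2,1)] e by blast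
      then show "v \<in> {endpt B e True, endpt B e False}" using e by (cases b) auto
    qed
  qed (use sg e in \<open>auto simp: signed_graph_def\<close>)
  moreover have "endpt B e True \<noteq> endpt B e False"
    using loop_circle[OF sg(1) _ e] V assms(2) by auto
  ultimately show ?thesis using that e by blast
qed

section \<open>Cyclic orientation of a circle\<close>

abbreviation tail :: "('v, 'e) sgraph \<Rightarrow> 'e \<times> bool \<Rightarrow> 'v" where
  "tail G d \<equiv> endpt G (fst d) (snd d)"

abbreviation head :: "('v, 'e) sgraph \<Rightarrow> 'e \<times> bool \<Rightarrow> 'v" where
  "head G d \<equiv> endpt G (fst d) (\<not> snd d)"

text \<open>A dart \<open>(e, b)\<close> stands for the edge \<open>e\<close> traversed from its end \<open>b\<close> to its end \<open>\<not> b\<close>.\<close>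

definition cyclic_orientation :: "('v, 'e) sgraph \<Rightarrow> ('e \<times> bool) set \<Rightarrow> bool" where
  "cyclic_orientation C R \<longleftrightarrow> R \<subseteq> edges C \<times> UNIV \<and> (\<forall>e\<in>edges C. \<exists>!b. (e, b) \<in> R) \<and>
     (\<forall>v\<in>verts C. \<exists>!d. d \<in> R \<and> tail C d = v) \<and> (\<forall>v\<in>verts C. \<exists>!d. d \<in> R \<and> head C d = v)"

text \<open>Follow the circle from an arbitrary dart, always leaving a vertex by the end other than
  the one just used. The orbit \<open>R\<close> never contains both directions of an edge
  (\<open>no_turn\<close>, \<open>no_flip\<close>), and it reaches all vertices because the circle
  is connected.\<close>

lemma circle_cyclic_orientation:
  assumes C: "circle C"
  obtains R where "cyclic_orientation C R"
proof -
  have sg: "signed_graph C" and con: "connected_graph C" and card2: "\<And>v. v \<in> verts C \<Longrightarrow> card (ends_at C v) = 2"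
    using C by (auto simp: circle_def)
  define A where "A = edges C \<times> (UNIV :: bool set)"
  define flip where "flip = (\<lambda>d::'b \<times> bool. (fst d, \<not> snd d))"
  have flip[simp]: "flip (flip d) = d" "flip d \<noteq> d" "d \<noteq> flip d" "fst (flip d) = fst d" "snd (flip d) = (\<not> snd d)" for d
    by (auto simp: flip_def prod_eq_iff)
  have flipA: "flip d \<in> A \<longleftrightarrow> d \<in> A" for d by (auto simp: A_def flip_def mem_Times_iff)
  have finA: "finite A" using sg by (auto simp: A_def signed_graph_def)
  have ends: "d \<in> ends_at C v \<longleftrightarrow> d \<in> A \<and> tail C d = v" for d v by (cases d) (auto simp: ends_at_def A_def)
  have vC: "tail C d \<in> verts C" "head C d \<in> verts C" if "d \<in> A" for d
    using that sg by (auto simp: A_def signed_graph_def)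
  \<comment> \<open>Degree two, in the form used below: there are no three distinct ends at a
    vertex.\<close>
  have three: False if "x \<in> ends_at C v" "y \<in> ends_at C v" "z \<in> ends_at C v" "x \<noteq> y" "y \<noteq> z" "x \<noteq> z" for x y z v
  proof -
    have "v \<in> verts C" using that(1) vC ends by auto
    then have "card (ends_at C v) = 2" "finite (ends_at C v)" using card2 by (auto intro: card_ge_0_finite)
    then have "card {x, y, z} \<le> 2" using that card_mono[of "ends_at C v" "{x,y,z}"] by auto
    then show False using that by auto
  qed
  have ex: "\<exists>d'. d' \<in> A \<and> tail C d' = head C d \<and> d' \<noteq> flip d" if "d \<in> A" for d
  proof -
    have "card (ends_at C (head C d)) = 2" using card2 vC that by blast
    moreover have "flip d \<in> ends_at C (head C d)" using that flipA by (auto simp: ends)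
    ultimately have "ends_at C (head C d) \<noteq> {flip d}" by auto
    then show ?thesis using \<open>flip d \<in> _\<close> ends by blast
  qed
  define g where "g d = (SOME d'. d' \<in> A \<and> tail C d' = head C d \<and> d' \<noteq> flip d)" for d
  have g: "g d \<in> A" "tail C (g d) = head C d" "g d \<noteq> flip d" if "d \<in> A" for d
    using someI_ex[OF ex[OF that]] unfolding g_def by blast+
  have gI: "d' = g d" if "d \<in> A" "d' \<in> A" "tail C d' = head C d" "d' \<noteq> flip d" for d d'
    using three[of d' "head C d" "g d" "flip d"] g[OF that(1)] that flipA by (auto simp: ends)
  \<comment> \<open>Going backwards means following the reversed darts; the injectivity of
    \<open>g\<close> comes from this.\<close>
  have gflip: "g (flip (g d)) = flip d" if "d \<in> A" for d
    using gI[of "flip (g d)" "flip d"] that flipA g[OF that] by auto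
  have g_inj: "inj_on g A"
    by (rule inj_onI) (metis gflip flip(1))
  have iter: "(g ^^ n) d \<in> A" if "d \<in> A" for n d using that g(1) by (induction n) auto
  \<comment> \<open>If the orbit ran through \<open>d\<close> and later through its reversal, one
    dart could be stripped from both ends of that stretch. This leads down to \<open>n = 0\<close>
    or \<open>n = 1\<close>, where a dart would equal its reversal or \<open>g\<close> would turn
    back.\<close>
  have no_turn: "d \<in> A \<Longrightarrow> (g ^^ n) d \<noteq> flip d" for n d
  proof (induction n arbitrary: d rule: less_induct)
    case (less n)
    consider "n = 0" | "n = 1" | m where "n = Suc (Suc m)" by (metis One_nat_def not0_implies_Suc)
    then show ?case
    proof cases
      case 3
      show ?thesis
      proof
        assume "(g ^^ n) d = flip d"
        then have "g ((g ^^ m) (g d)) = g (flip (g d))" using 3 gflip less.prems by (simp add: funpow_swap1)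
        then have "(g ^^ m) (g d) = flip (g d)"
          using inj_onD[OF g_inj] iter[OF g(1)] g(1) less.prems flipA by blast
        then show False using less.IH[of m "g d"] 3 g(1) less.prems by auto
      qed
    qed (use g(3) less.prems in auto)
  qed
  obtain d0 where d0: "d0 \<in> A" using circle_edges_nonempty[OF C] by (auto simp: A_def)
  define R where "R = range (\<lambda>n. (g ^^ n) d0)"
  have RA: "R \<subseteq> A" using iter[OF d0] unfolding R_def by blast
  have RI: "(g ^^ n) d0 \<in> R" for n unfolding R_def by (rule rangeI)
  have RE: "\<exists>n. d = (g ^^ n) d0" if "d \<in> R" for d using that unfolding R_def by blast
  have gO: "g d \<in> R" if "d \<in> R" for d
  proof -
    obtain n where "d = (g ^^ n) d0" using RE[OF \<open>d \<in> R\<close>] by blast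
    then show ?thesis using RI[of "Suc n"] by simp
  qed
  have no_flip: "flip d \<notin> R" if dR: "d \<in> R" for d
  proof
    assume fR: "flip d \<in> R"
    obtain j where j: "flip d = (g ^^ j) d0" using RE[OF fR] by blast
    obtain i where i: "d = (g ^^ i) d0" using RE[OF dR] by blast
    have dA: "d \<in> A" using dR RA by blast
    show False
    proof (cases "i \<le> j")
      case True
      then have "flip d = (g ^^ (j - i + i)) d0" using j by simp
      then have "flip d = (g ^^ (j - i)) d" using i by (simp only: funpow_add o_apply)
      then show False using no_turn[OF dA, of "j - i"] by simp
    next
      case False
      then have "d = (g ^^ (i - j + j)) d0" using i by simp
      then have "d = (g ^^ (i - j)) (flip d)" using j by (simp only: funpow_add o_apply)
      then show False using no_turn[of "flip d" "i - j"] dA flipA by simp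
    qed
  qed
  have pred: "\<exists>d'\<in>R. g d' = d" if dR: "d \<in> R" for d
  proof -
    have dA: "d \<in> A" using dR RA by blast
    obtain n where n: "n > 0" "(g ^^ n) d = d"
      using funpow_return[OF finA g_inj _ dA] g(1) by blast
    obtain i where i: "d = (g ^^ i) d0" using RE[OF dR] by blast
    obtain m where m: "n = Suc m" using n gr0_implies_Suc by blast
    then have "g ((g ^^ m) d) = d" using n by simp
    moreover have "(g ^^ m) d \<in> R" using RI[of "m + i"] i by (simp add: funpow_add)
    ultimately show ?thesis by blast
  qed
  \<comment> \<open>Degree two again: the departure of \<open>d\<close> and the arrival of its
    predecessor use up all ends at the vertex.\<close>
  have at: "\<exists>d'\<in>R. g d' = d \<and> ends_at C (tail C d) = {d, flip d'}" if dR: "d \<in> R" for d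
  proof -
    obtain d' where d': "d' \<in> R" "g d' = d" using pred[OF dR] by blast
    then have dA: "d \<in> A" "flip d' \<in> A" using RA flipA dR by blast+
    moreover have "tail C (flip d') = tail C d" "d \<noteq> flip d'" using d' g[of d'] RA by auto
    ultimately have "x \<in> {d, flip d'}" if "x \<in> ends_at C (tail C d)" for x
      using three[of x "tail C d" d "flip d'"] that by (auto simp: ends)
    then show ?thesis using d' dA \<open>tail C (flip d') = tail C d\<close> ends by blast
  qed
  let ?X = "tail C ` R"
  have step: "((e, b) \<in> R \<or> (e, \<not> b) \<in> R) \<and> endpt C e (\<not> b) \<in> ?X" if e: "e \<in> edges C" "endpt C e b \<in> ?X" for e b
  proof -
    obtain d where d: "d \<in> R" "endpt C e b = tail C d" using e(2) by blast
    obtain d' where d': "d' \<in> R" "g d' = d" "ends_at C (tail C d) = {d, flip d'}" using at d by blast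
    have "(e, b) \<in> ends_at C (tail C d)" using d e(1) by (simp add: ends_at_def)
    then consider "(e, b) = d" | "(e, b) = flip d'" using d' by auto
    then show ?thesis
    proof cases
      case 1
      then have "tail C (g d) = endpt C e (\<not> b)" using g(2) d RA by auto
      then have "endpt C e (\<not> b) \<in> ?X" using gO[OF d(1)] by (intro image_eqI[of _ _ "g d"]) simp_all
      then show ?thesis using 1 d by auto
    next
      case 2
      then have d'_eq: "d' = (e, \<not> b)" by (simp add: flip_def prod_eq_iff)
      then have "endpt C e (\<not> b) \<in> ?X" using d'(1) by (intro image_eqI[of _ _ d']) simp_all
      then show ?thesis using d'(1) d'_eq by blast
    qed
  qed
  have "d0 \<in> R" unfolding R_def by (metis funpow_0 rangeI)
  then have X: "v \<in> ?X" if v: "v \<in> verts C" for v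
  proof -
    obtain p where "walk C (tail C d0) p v" using v con vC d0 unfolding connected_graph_def by blast
    then show ?thesis using walk_closed_set[of C "tail C d0" p v ?X] step \<open>d0 \<in> R\<close> by blast
  qed
  have one: "\<exists>!b. (e, b) \<in> R" if e: "e \<in> edges C" for e
  proof -
    have "endpt C e True \<in> ?X" using e X sg by (auto simp: signed_graph_def)
    then have "(e, True) \<in> R \<or> (e, False) \<in> R" using step[OF e, of True] by simp
    moreover have "(e, \<not> b) \<notin> R" if "(e, b) \<in> R" for b using no_flip[OF that] by (simp add: flip_def)
    ultimately show ?thesis by (metis (full_types) not_True_eq_False not_False_eq_True)
  qed
  have io: "(\<exists>!d. d \<in> R \<and> tail C d = v) \<and> (\<exists>!d. d \<in> R \<and> head C d = v)" if v: "v \<in> verts C" for v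
  proof -
    obtain d where d: "d \<in> R" "v = tail C d" using X[OF v] by blast
    obtain d' where d': "d' \<in> R" "g d' = d" "ends_at C (tail C d) = {d, flip d'}" using at d by blast
    have out: "x = d" if "x \<in> R" "tail C x = v" for x
    proof -
      have "x \<in> {d, flip d'}" using that RA d' d ends by blast
      then show ?thesis using no_flip[OF d'(1)] that(1) by blast
    qed
    have into: "x = d'" if "x \<in> R" "head C x = v" for x
    proof -
      have "x \<in> A" using that(1) RA by blast
      then have "g x = d" using out[OF gO[OF that(1)]] that(2) g(2)[of x] by simp
      then show ?thesis using inj_onD[OF g_inj, of x d'] d'(1,2) \<open>x \<in> A\<close> RA by auto
    qed
    have "head C d' = v" using g(2)[of d'] d(2) d'(1,2) RA by auto
    then have "\<exists>!x. x \<in> R \<and> head C x = v"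
      by (intro ex1I[of _ d']) (use into d'(1) in blast)+
    moreover have "\<exists>!x. x \<in> R \<and> tail C x = v"
      by (intro ex1I[of _ d]) (use out d in blast)+
    ultimately show ?thesis by blast
  qed
  have "cyclic_orientation C R"
    unfolding cyclic_orientation_def using RA[unfolded A_def] one io by (intro conjI ballI) simp_all
  then show ?thesis using that by blast
qed

section \<open>The tour of a directed circle-tree\<close>

text \<open>Without a cut-vertex \<open>T\<close> is a single circle, which
  \<open>circle_tree_without_cut_vertex\<close> treats separately. Here every block has a cut-vertex
  (\<open>block_has_cut_vertex\<close>).\<close>

locale directed_circle_tree =
  fixes T :: "('v, 'e) sgraph" and \<omega> :: "'e \<Rightarrow> bool \<Rightarrow> int"
  assumes circle_tree: "circle_tree T" and sesqui_Eulerian: "sesqui_Eulerian T"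
    and direction: "direction T \<omega>" and cut_vertex_exists: "\<exists>v. cut_vertex T v"
begin

lemma signed_graph_T: "signed_graph T" and connected_T: "connected_graph T" and edges_T: "edges T \<noteq> {}"
  using circle_tree by (auto simp: circle_tree_def)

section \<open>Blocks and darts of the circle-tree\<close>

definition dblk :: "'e \<times> bool \<Rightarrow> ('v, 'e) sgraph" where
  "dblk d = (THE B. block T B \<and> fst d \<in> edges B)"

lemma dblk_eq: "dblk d = B" if "block T B" "fst d \<in> edges B"
  unfolding dblk_def using that blocks_share_edge[OF _ _ signed_graph_T] by (intro the_equality) blast+

lemma dblk: "block T (dblk d)" "fst d \<in> edges (dblk d)" if "fst d \<in> edges T"
proof -
  obtain B where "block T B" "fst d \<in> edges B" using edge_in_block[OF signed_graph_T \<open>fst d \<in> edges T\<close>] .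
  then show "block T (dblk d)" "fst d \<in> edges (dblk d)" using dblk_eq by auto
qed

lemma block_T:
  assumes "block T B"
  shows "signed_graph B" "connected_graph B" "nonseparable B" "verts B \<subseteq> verts T" "edges B \<subseteq> edges T"
    "endpt B = endpt T" "esign B = esign T"
  using blockD[OF assms] by (auto simp: subgraph_def nonseparable_def)

lemma block_endpt: "block T B \<Longrightarrow> e \<in> edges B \<Longrightarrow> endpt T e b \<in> verts B"
  using block_T[of B] by (auto simp: signed_graph_def)

lemma non_circle_block: "block T B \<Longrightarrow> \<not> circle B \<Longrightarrow> card (edges B) = 1"
  using circle_tree by (auto simp: circle_tree_def)

lemma block_edges_nonempty: "block T B \<Longrightarrow> edges B \<noteq> {}"
  using non_circle_block circle_edges_nonempty by fastforce

lemma non_cut_block_unique: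
  "block T B \<Longrightarrow> block T B' \<Longrightarrow> v \<in> verts B \<Longrightarrow> v \<in> verts B' \<Longrightarrow> \<not> cut_vertex T v \<Longrightarrow> B = B'"
  using in_two_blocks_cut_vertex[OF _ _ signed_graph_T connected_T] block_edges_nonempty by blast

lemma cut_vertex_other_block:
  assumes "cut_vertex T v" "block T B" "v \<in> verts B"
  obtains B' where "block T B'" "v \<in> verts B'" "B' \<noteq> B"
    "\<And>B''. block T B'' \<Longrightarrow> v \<in> verts B'' \<Longrightarrow> B'' = B \<or> B'' = B'"
proof -
  have "card {B. block T B \<and> v \<in> verts B} = 2" using circle_tree assms(1) by (auto simp: circle_tree_def)
  then obtain B1 B2 where B12: "{B. block T B \<and> v \<in> verts B} = {B1, B2}" "B1 \<noteq> B2" by (auto simp: card_2_iff)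
  then have "\<And>X. block T X \<and> v \<in> verts X \<longleftrightarrow> X = B1 \<or> X = B2" by blast
  then show ?thesis using that[of B1] that[of B2] assms(2,3) B12(2) by metis
qed

lemma non_circle_blockE:
  assumes "block T B" "\<not> circle B"
  obtains e where "edges B = {e}" "verts B = {endpt T e True, endpt T e False}" "endpt T e True \<noteq> endpt T e False"
  using single_edge_block[OF block_T(3)[OF assms(1)] assms(2) non_circle_block[OF assms]] block_T(6)[OF assms(1)]
  by metis

lemma orientation_value: "e \<in> edges T \<Longrightarrow> \<omega> e b = 1 \<or> \<omega> e b = -1"
  using direction by (auto simp: direction_def orientation_def)

lemma orientation_sign: "e \<in> edges T \<Longrightarrow> esign T e = - (\<omega> e b * \<omega> e (\<not> b))"
  using direction by (cases b) (auto simp: direction_def orientation_def)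

text \<open>The form in which the absence of sinks and sources is used.\<close>

lemma both_values_at:
  assumes "v \<in> verts T" "s = 1 \<or> s = -1"
  obtains e b where "e \<in> edges T" "endpt T e b = v" "\<omega> e b = s"
proof -
  have "\<not> sink T \<omega> v" "\<not> source T \<omega> v" using direction by (auto simp: direction_def)
  then obtain e b f c where "e \<in> edges T" "endpt T e b = v" "\<omega> e b \<noteq> 1"
    "f \<in> edges T" "endpt T f c = v" "\<omega> f c \<noteq> -1"
    using assms(1) unfolding sink_def source_def ends_at_def by blast
  then show ?thesis using that[of e b] that[of f c] orientation_value[of e b] orientation_value[of f c] assms(2)
    by auto
qed

text \<open>Otherwise the single edge of the block would have the only end at \<open>v\<close>, so
  \<open>v\<close> would be a sink or a source.\<close>

lemma non_circle_block_cut_vertex: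
  assumes "block T B" "\<not> circle B" "v \<in> verts B"
  shows "cut_vertex T v"
proof (rule ccontr)
  assume ncut: "\<not> cut_vertex T v"
  obtain e where e: "edges B = {e}" "verts B = {endpt T e True, endpt T e False}" "endpt T e True \<noteq> endpt T e False"
    using non_circle_blockE[OF assms(1,2)] .
  obtain c where c: "endpt T e c = v" using e(2) assms(3) by auto
  have only: "f = e \<and> b = c" if f: "f \<in> edges T" "endpt T f b = v" for f b
  proof -
    have "block T (dblk (f, b))" "f \<in> edges (dblk (f, b))" using dblk[of "(f, b)"] f by simp_all
    then have "dblk (f, b) = B" using non_cut_block_unique[OF _ assms(1) _ assms(3) ncut] block_endpt[of _ f b] f(2) by blast
    then have "f = e" using \<open>f \<in> edges (dblk (f, b))\<close> e(1) by simp
    then show ?thesis using f(2) c e(3) by (cases b; cases c) auto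
  qed
  have v: "v \<in> verts T" using assms block_T by blast
  obtain f b where "f \<in> edges T" "endpt T f b = v" "\<omega> f b = 1" using both_values_at[OF v, of 1] by auto
  then have "\<omega> e c = 1" using only by blast
  obtain f b where "f \<in> edges T" "endpt T f b = v" "\<omega> f b = -1" using both_values_at[OF v, of "-1"] by auto
  then have "\<omega> e c = -1" using only by blast
  then show False using \<open>\<omega> e c = 1\<close> by simp
qed

text \<open>Either of the two cyclic orientations will do: coherence (\<open>nxt_coherent\<close>)
  is proved for an arbitrary choice.\<close>

definition orient :: "('v, 'e) sgraph \<Rightarrow> ('e \<times> bool) set" where
  "orient C = (SOME R. cyclic_orientation C R)"

lemma cyclic_orientationD:
  assumes "cyclic_orientation C R"
  shows "e \<in> edges C \<Longrightarrow> \<exists>!b. (e, b) \<in> R" "v \<in> verts C \<Longrightarrow> \<exists>!d. d \<in> R \<and> tail C d = v"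
    "v \<in> verts C \<Longrightarrow> \<exists>!d. d \<in> R \<and> head C d = v"
  using assms unfolding cyclic_orientation_def by simp_all

lemma orient: "circle C \<Longrightarrow> cyclic_orientation C (orient C)"
  unfolding orient_def using circle_cyclic_orientation by (metis someI_ex)

definition darts :: "('e \<times> bool) set" where
  "darts = {d. fst d \<in> edges T \<and> (circle (dblk d) \<longrightarrow> d \<in> orient (dblk d))}"

lemma dart_edge: "d \<in> darts \<Longrightarrow> fst d \<in> edges T"
  by (simp add: darts_def)

lemma dart_block:
  assumes "d \<in> darts"
  shows "block T (dblk d)" "fst d \<in> edges (dblk d)" "tail T d \<in> verts (dblk d)" "head T d \<in> verts (dblk d)"
    "tail T d \<in> verts T" "head T d \<in> verts T"
  using dblk[OF dart_edge[OF assms]] block_endpt block_T(4) by blast+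

lemma finite_darts: "finite darts"
proof (rule finite_subset)
  show "darts \<subseteq> edges T \<times> UNIV" using dart_edge by (auto simp: mem_Times_iff)
  show "finite (edges T \<times> (UNIV :: bool set))" using signed_graph_T by (auto simp: signed_graph_def)
qed

lemma circle_dart_iff:
  assumes "block T B" "circle B"
  shows "d \<in> darts \<and> dblk d = B \<longleftrightarrow> d \<in> orient B"
proof
  assume d: "d \<in> orient B"
  then have "fst d \<in> edges B" using orient[OF assms(2)] by (auto simp: cyclic_orientation_def)
  then have "dblk d = B" "fst d \<in> edges T" using dblk_eq[OF assms(1)] block_T(5)[OF assms(1)] by auto
  then show "d \<in> darts \<and> dblk d = B" using d by (simp add: darts_def)
qed (use assms in \<open>auto simp: darts_def\<close>)

lemma non_circle_dart: "fst d \<in> edges T \<Longrightarrow> \<not> circle (dblk d) \<Longrightarrow> d \<in> darts"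
  by (simp add: darts_def)

lemma unique_circle_dart:
  assumes "e \<in> edges T" "circle (dblk (e, b))"
  shows "\<exists>!c. (e, c) \<in> darts"
proof -
  have B: "block T (dblk (e, b))" "e \<in> edges (dblk (e, b))" using dblk[of "(e, b)"] assms by simp_all
  have "dblk (e, c) = dblk (e, b)" for c by (simp add: dblk_def)
  then have "(e, c) \<in> darts \<longleftrightarrow> (e, c) \<in> orient (dblk (e, b))" for c
    using circle_dart_iff[OF B(1) assms(2), of "(e, c)"] by blast
  moreover have "\<exists>!c. (e, c) \<in> orient (dblk (e, b))"
    using cyclic_orientationD(1)[OF orient[OF assms(2)] B(2)] .
  ultimately show ?thesis by simp
qed

lemma dart_exists: "e \<in> edges T \<Longrightarrow> \<exists>b. (e, b) \<in> darts"
  using unique_circle_dart[of e True] non_circle_dart[of "(e, True)"] by auto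

text \<open>For a circle this is its cyclic orientation; for a bridge both directions are darts and
  the endpoints differ. It makes the successor determined once its block is known, and
  \<open>nxt\<close> injective.\<close>

lemma out_dart: "\<exists>!d. d \<in> darts \<and> tail T d = v \<and> dblk d = B" (is ?A)
  and in_dart: "\<exists>!d. d \<in> darts \<and> head T d = v \<and> dblk d = B" (is ?B)
  if B: "block T B" and v: "v \<in> verts B"
proof -
  have "?A \<and> ?B"
  proof (cases "circle B")
    case True
    have "(\<exists>!d. d \<in> orient B \<and> tail T d = v) \<and> (\<exists>!d. d \<in> orient B \<and> head T d = v)"
      using cyclic_orientationD(2,3)[OF orient[OF True] v] unfolding block_T(6)[OF B] by simp
    moreover have "d \<in> darts \<and> tail T d = v \<and> dblk d = B \<longleftrightarrow> d \<in> orient B \<and> tail T d = v"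
      "d \<in> darts \<and> head T d = v \<and> dblk d = B \<longleftrightarrow> d \<in> orient B \<and> head T d = v" for d
      using circle_dart_iff[OF B True, of d] by blast+
    ultimately show ?thesis by simp
  next
    case False
    obtain e where e: "edges B = {e}" "verts B = {endpt T e True, endpt T e False}" "endpt T e True \<noteq> endpt T e False"
      using non_circle_blockE[OF B False] .
    obtain c where c: "endpt T e c = v" using e(2) v by auto
    have "dblk d = B \<and> d \<in> darts \<longleftrightarrow> fst d = e" for d
      using dblk_eq[OF B, of d] non_circle_dart[of d] dart_block(2)[of d] e(1) block_T(5)[OF B] False by auto
    moreover have "endpt T e x = v \<longleftrightarrow> x = c" for x
      using c e(3) by (cases x; cases c) auto
    ultimately have "d \<in> darts \<and> tail T d = v \<and> dblk d = B \<longleftrightarrow> d = (e, c)"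
      "d \<in> darts \<and> head T d = v \<and> dblk d = B \<longleftrightarrow> d = (e, \<not> c)" for d
      unfolding prod_eq_iff fst_conv snd_conv by metis+
    then show ?thesis by simp
  qed
  then show ?A ?B by auto
qed

lemma out_dart_eq: "d \<in> darts \<Longrightarrow> d' \<in> darts \<Longrightarrow> tail T d = tail T d' \<Longrightarrow> dblk d = dblk d' \<Longrightarrow> d = d'"
  using out_dart[of "dblk d" "tail T d"] dart_block[of d] by metis

lemma in_dart_eq: "d \<in> darts \<Longrightarrow> d' \<in> darts \<Longrightarrow> head T d = head T d' \<Longrightarrow> dblk d = dblk d' \<Longrightarrow> d = d'"
  using in_dart[of "dblk d" "head T d"] dart_block[of d] by metis

text \<open>The choice is in fact determined: at a cut-vertex there is only one other block, and a
  block has only one dart leaving a given vertex.\<close>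

definition nxt :: "'e \<times> bool \<Rightarrow> 'e \<times> bool" where
  "nxt d = (SOME d'. d' \<in> darts \<and> tail T d' = head T d \<and> (dblk d' = dblk d \<longleftrightarrow> \<not> cut_vertex T (head T d)))"

lemma nxt:
  assumes "d \<in> darts"
  shows "nxt d \<in> darts" "tail T (nxt d) = head T d" "dblk (nxt d) = dblk d \<longleftrightarrow> \<not> cut_vertex T (head T d)"
proof -
  have "\<exists>d'. d' \<in> darts \<and> tail T d' = head T d \<and> (dblk d' = dblk d \<longleftrightarrow> \<not> cut_vertex T (head T d))"
  proof (cases "cut_vertex T (head T d)")
    case True
    then obtain B' where "block T B'" "head T d \<in> verts B'" "B' \<noteq> dblk d"
      using cut_vertex_other_block dart_block[OF assms] by metis
    then show ?thesis using True out_dart[of B' "head T d"] by blast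
  next
    case False
    then show ?thesis using out_dart[of "dblk d" "head T d"] dart_block[OF assms] by blast
  qed
  from someI_ex[OF this]
  show "nxt d \<in> darts" "tail T (nxt d) = head T d" "dblk (nxt d) = dblk d \<longleftrightarrow> \<not> cut_vertex T (head T d)"
    unfolding nxt_def by blast+
qed

text \<open>Identifies the block entered at a cut-vertex: there are only two blocks, so excluding
  one determines the other.\<close>

lemma two_blocks_at:
  assumes "block T A" "block T B" "block T C" "v \<in> verts A" "v \<in> verts B" "v \<in> verts C" "A \<noteq> B" "C \<noteq> B"
  shows "A = C"
proof -
  have "cut_vertex T v" using non_cut_block_unique assms by metis
  then show ?thesis using cut_vertex_other_block[of v B] assms by metis
qed

text \<open>The block of \<open>d\<close> can be recovered from \<open>nxt d\<close>: it is the
  other one at a cut-vertex and the only one elsewhere. Then \<open>d\<close> is the unique dart of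
  that block entering the vertex.\<close>

lemma nxt_inj: "inj_on nxt darts"
proof (rule inj_onI)
  fix d d' assume d: "d \<in> darts" "d' \<in> darts" "nxt d = nxt d'"
  have h: "head T d = head T d'" using nxt(2)[OF d(1)] nxt(2)[OF d(2)] d(3) by simp
  have "dblk d = dblk d'"
  proof (cases "cut_vertex T (head T d)")
    case True
    then have "dblk d \<noteq> dblk (nxt d)" "dblk d' \<noteq> dblk (nxt d)" using nxt(3)[OF d(1)] nxt(3)[OF d(2)] d(3) h by auto
    then show ?thesis
      using two_blocks_at[of "dblk d" "dblk (nxt d)" "dblk d'" "head T d"] dart_block[OF d(1)] dart_block[OF d(2)]
        dart_block(1,3)[OF nxt(1)[OF d(1)]] nxt(2)[OF d(1)] h by simp
  next
    case False
    then show ?thesis using non_cut_block_unique dart_block[OF d(1)] dart_block[OF d(2)] h by metis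
  qed
  then show "d = d'" using in_dart_eq d h by blast
qed

lemma nxt_darts: "nxt ` darts \<subseteq> darts"
  using nxt(1) by blast

lemma iter_darts: "d \<in> darts \<Longrightarrow> (nxt ^^ n) d \<in> darts"
  by (induction n) (simp_all add: nxt(1))

text \<open>The orbit of a dart cannot stay forever on one side of a cut-vertex \<open>v\<close>, so it contains
  both darts that leave \<open>v\<close>.\<close>

lemma darts_single_orbit:
  assumes Y: "Y \<subseteq> darts" "Y \<noteq> {}" "\<And>d. d \<in> Y \<Longrightarrow> nxt d \<in> Y"
  shows "Y = darts"
proof -
  have finY: "finite Y" using Y(1) finite_darts finite_subset by blast
  \<comment> \<open>An injective self-map of the finite set \<open>Y\<close> is onto, so
    \<open>Y\<close> is closed under predecessors as well.\<close>
  have "nxt ` Y = Y" using endo_inj_surj[OF finY _ inj_on_subset[OF nxt_inj Y(1)]] Y(3) by blast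
  have pred: "d \<in> Y" if d: "d \<in> darts" "nxt d \<in> Y" for d
  proof -
    obtain d' where "d' \<in> Y" "nxt d = nxt d'" using d(2) \<open>nxt ` Y = Y\<close> by blast
    then show ?thesis using inj_onD[OF nxt_inj, of d d'] d(1) Y(1) by blast
  qed
  have iterY: "(nxt ^^ n) d \<in> Y" if "d \<in> Y" for d n using that by (induction n) (simp_all add: Y(3))
  have same_tail: "d2 \<in> Y" if d: "d1 \<in> Y" "d2 \<in> darts" "tail T d1 = tail T d2" for d1 d2
  proof (cases "dblk d1 = dblk d2")
    case True
    then show ?thesis using out_dart_eq[of d1 d2] d Y(1) by blast
  next
    case False
    let ?v = "tail T d1"
    have d1: "d1 \<in> darts" using d Y by blast
    have bl: "block T (dblk d1)" "?v \<in> verts (dblk d1)" using dart_block[OF d1] by auto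
    have cut: "cut_vertex T ?v"
      using False non_cut_block_unique[of "dblk d1" "dblk d2" ?v] dart_block[OF d1] dart_block[OF d(2)] d(3) by auto
    obtain S where S: "\<And>e b. e \<in> edges T \<Longrightarrow> endpt T e b = ?v \<Longrightarrow> e \<in> S \<longleftrightarrow> e \<in> edges (dblk d1)"
      "\<And>e g b c. e \<in> S \<Longrightarrow> g \<in> edges T \<Longrightarrow> endpt T e b = endpt T g c \<Longrightarrow> endpt T e b \<noteq> ?v \<Longrightarrow> g \<in> S"
      using block_side[OF bl(1) signed_graph_T bl(2)] by blast
    \<comment> \<open>The dart \<open>p\<close> before the return to \<open>d1\<close> arrives from
      the other block, hence lies outside \<open>S\<close>; so the orbit must leave \<open>S\<close>
      at some time.\<close>
    obtain N where N: "N > 0" "(nxt ^^ N) d1 = d1" using funpow_return[OF finite_darts nxt_inj nxt_darts d1] .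
    then obtain m where m: "N = Suc m" using gr0_implies_Suc by blast
    define p where "p = (nxt ^^ m) d1"
    have p: "p \<in> darts" "nxt p = d1" using iter_darts[OF d1] N m by (simp_all add: p_def)
    have hp: "head T p = ?v" using nxt(2)[OF p(1)] p(2) by simp
    have "dblk p \<noteq> dblk d1" using nxt(3)[OF p(1)] p(2) cut hp by auto
    then have "fst p \<notin> edges (dblk d1)" using dblk_eq[OF bl(1), of p] by auto
    then have "fst p \<notin> S" using S(1)[OF dart_edge[OF p(1)] hp] by simp
    then have ex: "\<exists>n. fst ((nxt ^^ n) d1) \<notin> S" unfolding p_def by blast
    define n where "n = (LEAST n. fst ((nxt ^^ n) d1) \<notin> S)"
    have n: "fst ((nxt ^^ n) d1) \<notin> S" using LeastI_ex[OF ex] unfolding n_def .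
    have "fst d1 \<in> S" using S(1)[OF dart_edge[OF d1] refl] dart_block[OF d1] by simp
    then have "n \<noteq> 0" using n by (metis funpow_0)
    then obtain k where k: "n = Suc k" using not0_implies_Suc by blast
    define x where "x = (nxt ^^ k) d1"
    have x: "fst x \<in> S" using not_less_Least[of k "\<lambda>n. fst ((nxt ^^ n) d1) \<notin> S"] k unfolding n_def x_def by simp
    have xD: "x \<in> darts" "nxt x \<in> darts" using iter_darts[OF d1] nxt(1) by (simp_all add: x_def)
    \<comment> \<open>The first exit from \<open>S\<close> can only be at \<open>?v\<close>, and
      there it leads into the other block, that is, to \<open>d2\<close>.\<close>
    have nx: "fst (nxt x) \<notin> S" using n k by (simp add: x_def)
    then have hx: "head T x = ?v"
      using S(2)[OF x dart_edge[OF xD(2)], of "\<not> snd x" "snd (nxt x)"] nxt(2)[OF xD(1)] by auto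
    then have tnx: "tail T (nxt x) = ?v" using nxt(2)[OF xD(1)] by simp
    then have "fst (nxt x) \<notin> edges (dblk d1)" using nx S(1)[OF dart_edge[OF xD(2)] tnx] by simp
    then have "dblk (nxt x) \<noteq> dblk d1" using dart_block(2)[OF xD(2)] by auto
    then have "dblk (nxt x) = dblk d2"
      using two_blocks_at[of "dblk (nxt x)" "dblk d1" "dblk d2" ?v] False dart_block[OF xD(2)] dart_block[OF d(2)] bl tnx d(3) by auto
    then have "nxt x = d2" using out_dart_eq[OF xD(2) d(2)] tnx d(3) by simp
    then show ?thesis using iterY[OF d(1), of "Suc k"] by (simp add: x_def)
  qed
  let ?X = "tail T ` Y"
  have step: "endpt T e (\<not> b) \<in> ?X" if e: "e \<in> edges T" "endpt T e b \<in> ?X" for e b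
  proof -
    obtain d1 where d1: "d1 \<in> Y" "tail T d1 = endpt T e b" using e(2) by auto
    obtain c where c: "(e, c) \<in> darts" using dart_exists e(1) by blast
    show ?thesis
    proof (cases "c = b")
      case True
      then have "(e, c) \<in> Y" using same_tail[OF d1(1) c] d1(2) by simp
      then have "nxt (e, c) \<in> Y" using Y(3) by blast
      then show ?thesis using nxt(2)[OF c] True by (intro image_eqI[of _ _ "nxt (e, c)"]) simp_all
    next
      \<comment> \<open>The available dart points towards the known vertex. Its successor leaves
        that vertex, so it is in \<open>Y\<close>, and the dart itself is recovered as a
        predecessor.\<close>
      case False
      then have cb: "c = (\<not> b)" by auto
      then have "nxt (e, c) \<in> Y" using same_tail[OF d1(1) nxt(1)[OF c]] d1(2) nxt(2)[OF c] by simp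
      then have "(e, c) \<in> Y" using pred c by blast
      then show ?thesis using cb by (intro image_eqI[of _ _ "(e, c)"]) simp_all
    qed
  qed
  obtain y where y: "y \<in> Y" using Y(2) by blast
  have X: "v \<in> ?X" if v: "v \<in> verts T" for v
  proof -
    have "tail T y \<in> verts T" using dart_block(5) y Y(1) by blast
    then obtain p where "walk T (tail T y) p v" using v connected_T unfolding connected_graph_def by blast
    then show ?thesis using walk_closed_set[of T "tail T y" p v ?X] step y by blast
  qed
  have "d \<in> Y" if d: "d \<in> darts" for d
  proof -
    obtain d1 where "d1 \<in> Y" "tail T d1 = tail T d" using X[OF dart_block(5)[OF d]] by auto
    then show ?thesis using same_tail d by blast
  qed
  then show ?thesis using Y(1) by blast
qed

lemma orbit_meets:
  assumes "d \<in> darts" "d' \<in> darts"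
  obtains n where "(nxt ^^ n) d = d'"
proof -
  have "range (\<lambda>n. (nxt ^^ n) d) = darts"
  proof (rule darts_single_orbit)
    show "range (\<lambda>n. (nxt ^^ n) d) \<subseteq> darts" using iter_darts[OF assms(1)] by blast
    show "nxt x \<in> range (\<lambda>n. (nxt ^^ n) d)" if "x \<in> range (\<lambda>n. (nxt ^^ n) d)" for x
    proof -
      obtain n where "x = (nxt ^^ n) d" using \<open>x \<in> _\<close> by blast
      then have "nxt x = (nxt ^^ Suc n) d" by simp
      then show ?thesis by blast
    qed
  qed auto
  then show ?thesis using that assms(2) by (metis (mono_tags, lifting) rangeE)
qed

text \<open>For a circle this is the sink-or-source condition of a direction; a bridge has only one
  end at \<open>v\<close>.\<close>

lemma block_values_at_cut_vertex:
  assumes "block T B" "v \<in> verts B" "cut_vertex T v" "e \<in> edges B" "endpt T e b = v" "f \<in> edges B" "endpt T f c = v"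
  shows "\<omega> e b = \<omega> f c"
proof (cases "circle B")
  case True
  then have "sink B \<omega> v \<or> source B \<omega> v" using direction assms by (auto simp: direction_def circle_block_def)
  then show ?thesis using assms(4-7) block_T(6)[OF assms(1)] by (auto simp: sink_def source_def ends_at_def)
next
  case False
  obtain g where g: "edges B = {g}" "verts B = {endpt T g True, endpt T g False}" "endpt T g True \<noteq> endpt T g False"
    using non_circle_blockE[OF assms(1) False] .
  then have "e = g" "f = g" using assms by auto
  then show ?thesis using g(3) assms(5,7) by (cases b; cases c) auto
qed

text \<open>The vertex is neither a sink nor a source, so some end there is opposite to the arriving
  one. At a cut-vertex that end must lie in the other block, whose ends there all agree; elsewhere
  it is the only other end of the circle at that vertex. In both cases the departing end has its
  value.\<close>

lemma nxt_coherent: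
  assumes d: "d \<in> darts"
  shows "\<omega> (fst (nxt d)) (snd (nxt d)) = - \<omega> (fst d) (\<not> snd d)"
proof -
  let ?v = "head T d" and ?d' = "nxt d"
  note d' = nxt[OF d]
  have eT: "fst d \<in> edges T" "fst ?d' \<in> edges T" using dart_edge d d' by blast+
  have v: "?v \<in> verts T" using dart_block d by blast
  obtain f c where f: "f \<in> edges T" "endpt T f c = ?v" "\<omega> f c = - \<omega> (fst d) (\<not> snd d)"
    using both_values_at[OF v, of "- \<omega> (fst d) (\<not> snd d)"] orientation_value[OF eT(1), of "\<not> snd d"] by auto
  define B where "B = dblk (f, c)"
  have B: "block T B" "f \<in> edges B" using dblk[of "(f, c)"] f(1) by (simp_all add: B_def)
  have vB: "?v \<in> verts B" using block_endpt[OF B, of c] f(2) by simp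
  show ?thesis
  proof (cases "cut_vertex T ?v")
    case True
    have "B \<noteq> dblk d"
    proof
      assume "B = dblk d"
      then have "\<omega> f c = \<omega> (fst d) (\<not> snd d)"
        using block_values_at_cut_vertex[OF B(1) vB True B(2) f(2), of "fst d" "\<not> snd d"] dart_block[OF d] by simp
      then show False using f(3) orientation_value[OF eT(1), of "\<not> snd d"] by auto
    qed
    moreover have "dblk ?d' \<noteq> dblk d" using d'(3) True by simp
    ultimately have "B = dblk ?d'"
      using two_blocks_at[of B "dblk d" "dblk ?d'" ?v] B vB dart_block[OF d] dart_block[OF d'(1)] d'(2) by auto
    then have "\<omega> f c = \<omega> (fst ?d') (snd ?d')"
      using block_values_at_cut_vertex[OF B(1) vB True B(2) f(2), of "fst ?d'" "snd ?d'"] dart_block[OF d'(1)] d'(2) by simp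
    then show ?thesis using f(3) by simp
  next
    case False
    let ?C = "dblk d"
    have C: "block T ?C" "?v \<in> verts ?C" "circle ?C"
      using dart_block[OF d] non_circle_block_cut_vertex False by blast+
    have same: "dblk ?d' = ?C" "B = ?C" using d'(3) False non_cut_block_unique[OF B(1) C(1) vB C(2)] by auto
    have card: "card (ends_at ?C ?v) = 2" using C by (auto simp: circle_def)
    have in_ends: "(fst d, \<not> snd d) \<in> ends_at ?C ?v" "(fst ?d', snd ?d') \<in> ends_at ?C ?v" "(f, c) \<in> ends_at ?C ?v"
      using dart_block[OF d] dart_block[OF d'(1)] d'(2) same B(2) f(2) block_T(6)[OF C(1)]
      by (simp_all add: ends_at_def case_prod_beta)
    \<comment> \<open>A circle edge is a dart in one direction only, so the tour does not turn back
      at this vertex.\<close>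
    have "(fst d, \<not> snd d) \<noteq> (fst ?d', snd ?d')"
    proof
      assume "(fst d, \<not> snd d) = (fst ?d', snd ?d')"
      then have "(fst d, \<not> snd d) \<in> darts" "(fst d, snd d) \<in> darts" using d d'(1) by auto
      moreover have "\<exists>!c. (fst d, c) \<in> darts" using unique_circle_dart[of "fst d" "snd d"] eT(1) C(3) by simp
      ultimately have "snd d = (\<not> snd d)" by blast
      then show False by simp
    qed
    moreover have "(f, c) \<noteq> (fst d, \<not> snd d)"
    proof
      assume "(f, c) = (fst d, \<not> snd d)"
      then have "\<omega> f c = \<omega> (fst d) (\<not> snd d)" by simp
      then show False using f(3) orientation_value[OF eT(1), of "\<not> snd d"] by auto
    qed
    ultimately have "(f, c) = (fst ?d', snd ?d')"
      using in_ends card unfolding card_2_iff by auto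
    then have "f = fst ?d'" "c = snd ?d'" unfolding prod.inject by blast+
    then show ?thesis using f(3) by simp
  qed
qed

section \<open>Pieces of the tour as walks\<close>

definition run :: "'e \<times> bool \<Rightarrow> nat \<Rightarrow> ('e \<times> bool) list" where
  "run d n = map (\<lambda>k. (nxt ^^ k) d) [0..<n]"

definition dart_walk :: "('e \<times> bool) list \<Rightarrow> ('e \<times> 'v) list" where
  "dart_walk ds = map (\<lambda>d. (fst d, head T d)) ds"

lemma run_0 [simp]: "run d 0 = []"
  by (simp add: run_def)

lemma run_Suc: "run d (Suc n) = run d n @ [(nxt ^^ n) d]"
  by (simp add: run_def)

lemma run_add: "run d (m + n) = run d m @ run ((nxt ^^ m) d) n"
  by (induction n) (simp_all add: run_Suc funpow_add add.commute[of m])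

lemma set_run: "set (run d n) = (\<lambda>k. (nxt ^^ k) d) ` {..<n}"
  by (auto simp: run_def)

lemma dart_walk_append [simp]: "dart_walk (xs @ ys) = dart_walk xs @ dart_walk ys"
  by (simp add: dart_walk_def)

lemma dart_walk_Nil_iff [simp]: "dart_walk xs = [] \<longleftrightarrow> xs = []"
  by (simp add: dart_walk_def)

lemma walk_edges_dart_walk: "walk_edges (dart_walk ds) = fst ` set ds"
  by (simp add: walk_edges_def dart_walk_def image_image)

lemma tail_nxt_iter: "d \<in> darts \<Longrightarrow> tail T ((nxt ^^ Suc n) d) = head T ((nxt ^^ n) d)"
  using nxt(2)[OF iter_darts] by simp

lemma map_snd_dart_walk_run:
  "d \<in> darts \<Longrightarrow> map snd (dart_walk (run d n)) = map (\<lambda>k. tail T ((nxt ^^ Suc k) d)) [0..<n]"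
  unfolding dart_walk_def run_def map_map by (intro map_cong) (simp_all only: tail_nxt_iter o_apply snd_conv)

lemma walk_verts_dart_walk_run:
  assumes "d \<in> darts"
  shows "walk_verts (tail T d) (dart_walk (run d n)) = (\<lambda>k. tail T ((nxt ^^ k) d)) ` {..n}"
proof -
  have "snd ` set (dart_walk (run d n)) = set (map snd (dart_walk (run d n)))" by simp
  also have "\<dots> = (\<lambda>k. tail T ((nxt ^^ Suc k) d)) ` {..<n}"
    unfolding map_snd_dart_walk_run[OF assms] by (simp only: set_map set_upt lessThan_atLeast0)
  also have "\<dots> = (\<lambda>k. tail T ((nxt ^^ k) d)) ` (Suc ` {..<n})" by (simp only: image_image)
  finally show ?thesis
    unfolding walk_verts_def lessThan_Suc_atMost[symmetric] lessThan_Suc_eq_insert_0 by simp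
qed

lemma run_walk: "d \<in> darts \<Longrightarrow> walk T (tail T d) (dart_walk (run d n)) (tail T ((nxt ^^ n) d))"
proof (induction n)
  case 0
  then show ?case using dart_block(5) by (simp add: dart_walk_def)
next
  case (Suc n)
  let ?x = "(nxt ^^ n) d"
  have x: "?x \<in> darts" using iter_darts Suc.prems by blast
  have "walk T (tail T ?x) [(fst ?x, head T ?x)] (head T ?x)"
    using walk_edge[OF dart_edge[OF x] signed_graph_T, of "snd ?x"] by simp
  then have "walk T (tail T ?x) (dart_walk [?x]) (tail T ((nxt ^^ Suc n) d))"
    using tail_nxt_iter[OF Suc.prems, of n] by (simp add: dart_walk_def)
  then show ?case unfolding run_Suc dart_walk_append using walk_append[OF Suc.IH[OF Suc.prems]] by blast
qed

text \<open>A telescoping product: by coherence, the sign of an edge is its departing value times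
  the departing value of the next dart. For a run that returns to its first dart the result is a
  square, that is, 1.\<close>

lemma run_sign:
  assumes "d \<in> darts"
  shows "walk_sign T (dart_walk (run d n)) = \<omega> (fst d) (snd d) * \<omega> (fst ((nxt ^^ n) d)) (snd ((nxt ^^ n) d))"
proof (induction n)
  case 0
  show ?case using orientation_value[OF dart_edge[OF assms], of "snd d"] by (auto simp: walk_sign_def dart_walk_def)
next
  case (Suc n)
  let ?x = "(nxt ^^ n) d"
  have x: "?x \<in> darts" using iter_darts assms by blast
  have "walk_sign T (dart_walk (run d (Suc n))) = walk_sign T (dart_walk (run d n)) * esign T (fst ?x)"
    by (simp add: run_Suc walk_sign_def dart_walk_def)
  also have "\<dots> = \<omega> (fst d) (snd d) * (\<omega> (fst ?x) (snd ?x) * \<omega> (fst ?x) (snd ?x)) * (- \<omega> (fst ?x) (\<not> snd ?x))"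
    unfolding Suc.IH orientation_sign[OF dart_edge[OF x], of "snd ?x"] by simp
  also have "\<omega> (fst ?x) (snd ?x) * \<omega> (fst ?x) (snd ?x) = 1"
    using orientation_value[OF dart_edge[OF x], of "snd ?x"] by auto
  finally show ?case using nxt_coherent[OF x] by simp
qed

text \<open>A dart of \<open>B\<close> at a visited vertex is the one by which the run leaves it or
  the one by which it arrives, so the visited vertices are closed under the edges of
  \<open>B\<close>. Only the vertex is assumed to recur, not the dart.\<close>

lemma run_within_block:
  assumes B: "block T B" and d: "d \<in> darts" "m > 0" "\<And>j. j < m \<Longrightarrow> dblk ((nxt ^^ j) d) = B"
    and ret: "tail T ((nxt ^^ m) d) = tail T d"
  shows "verts B = (\<lambda>j. tail T ((nxt ^^ j) d)) ` {..<m}"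
    and "{x \<in> darts. dblk x = B} = (\<lambda>j. (nxt ^^ j) d) ` {..<m}"
proof -
  let ?d = "\<lambda>j. (nxt ^^ j) d"
  let ?X = "(\<lambda>j. tail T (?d j)) ` {..<m}"
  note dj = iter_darts[OF d(1)]
  have X: "tail T (?d j) \<in> ?X" if "j \<le> m" for j
  proof (cases "j = m")
    case True
    then have "tail T (?d j) = tail T (?d 0)" using ret by simp
    then show ?thesis using d(2) by blast
  next
    case False
    then show ?thesis using that by auto
  qed
  have XB: "?X \<subseteq> verts B" using dart_block(3)[OF dj] d(3) by fastforce
  have step: "endpt B e (\<not> b) \<in> ?X" if e: "e \<in> edges B" "endpt B e b \<in> ?X" for e b
  proof -
    have eT: "e \<in> edges T" "endpt B = endpt T" using e(1) block_T[OF B] by auto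
    obtain c where c: "(e, c) \<in> darts" using dart_exists[OF eT(1)] by blast
    have cB: "dblk (e, c) = B" using dblk_eq[OF B, of "(e, c)"] e(1) by simp
    obtain j where j: "j < m" "endpt T e b = tail T (?d j)" using e(2) eT(2) by auto
    show ?thesis
    proof (cases "c = b")
      case True
      then have "(e, b) = ?d j" using out_dart_eq[OF c dj[of j]] cB d(3)[OF j(1)] j(2) by simp
      then have "head T (?d j) = endpt T e (\<not> b)" by (simp add: \<open>(e, b) = ?d j\<close>[symmetric])
      then show ?thesis using X[of "Suc j"] j(1) tail_nxt_iter[OF d(1), of j] eT(2) by simp
    next
      case False
      then have cb: "c = (\<not> b)" by auto
      \<comment> \<open>The dart of the run that arrives at vertex number \<open>j\<close>; for
        \<open>j = 0\<close> it is the last dart, because the run is closed.\<close>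
      obtain i where i: "i < m" "head T (?d i) = tail T (?d j)"
      proof (cases j)
        case 0
        obtain k where "m = Suc k" using d(2) gr0_implies_Suc by blast
        then show ?thesis using that[of k] tail_nxt_iter[OF d(1), of k] ret 0 by simp
      next
        case (Suc k)
        then show ?thesis using that[of k] tail_nxt_iter[OF d(1), of k] j(1) by simp
      qed
      have "(e, c) = ?d i" using in_dart_eq[OF c dj[of i]] cB d(3)[OF i(1)] i(2) j(2) cb by simp
      then have "tail T (?d i) = endpt T e (\<not> b)" using cb by (simp add: \<open>(e, c) = ?d i\<close>[symmetric])
      then show ?thesis using X[of i] i(1) eT(2) by simp
    qed
  qed
  have t0: "tail T d \<in> ?X" using X[of 0] by simp
  have "v \<in> ?X" if v: "v \<in> verts B" for v
  proof -
    have "tail T d \<in> verts B" using t0 XB by blast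
    then obtain p where "walk B (tail T d) p v"
      using v block_T(2)[OF B] unfolding connected_graph_def by blast
    then show ?thesis using walk_closed_set[of B "tail T d" p v ?X] step t0 by blast
  qed
  then show VB: "verts B = ?X" using XB by blast
  show "{x \<in> darts. dblk x = B} = ?d ` {..<m}"
  proof
    show "{x \<in> darts. dblk x = B} \<subseteq> ?d ` {..<m}"
    proof
      fix x assume x: "x \<in> {x \<in> darts. dblk x = B}"
      then have xd: "x \<in> darts" "dblk x = B" by blast+
      then have "tail T x \<in> ?X" using dart_block(3)[OF xd(1)] VB by simp
      then obtain j where j: "j < m" "tail T x = tail T (?d j)" by blast
      then have "x = ?d j" using out_dart_eq[OF xd(1) dj[of j]] xd(2) d(3)[OF j(1)] by simp
      then show "x \<in> ?d ` {..<m}" using j(1) by blast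
    qed
  qed (use dj d(3) in blast)
qed

text \<open>Otherwise no edge of \<open>T\<close> leaves \<open>B\<close>, so \<open>B\<close>
  contains all vertices of the connected graph \<open>T\<close>, among them a cut-vertex.\<close>

lemma block_has_cut_vertex:
  assumes B: "block T B"
  shows "\<exists>v\<in>verts B. cut_vertex T v"
proof (rule ccontr)
  assume none: "\<not> ?thesis"
  have step: "endpt T e (\<not> b) \<in> verts B" if e: "e \<in> edges T" "endpt T e b \<in> verts B" for e b
  proof -
    have "block T (dblk (e, b))" "e \<in> edges (dblk (e, b))" using dblk[of "(e, b)"] e(1) by simp_all
    then have "dblk (e, b) = B" using non_cut_block_unique[OF _ B _ e(2)] block_endpt[of _ e b] none e(2) by blast
    then show ?thesis using block_endpt[OF B] \<open>e \<in> edges (dblk (e, b))\<close> by blast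
  qed
  obtain v where v: "cut_vertex T v" using cut_vertex_exists by blast
  obtain u where u: "u \<in> verts B" using block_T(2)[OF B] unfolding connected_graph_def by blast
  then have "u \<in> verts T" "v \<in> verts T" using block_T(4)[OF B] v by (auto simp: cut_vertex_def)
  then obtain p where "walk T u p v" using connected_T unfolding connected_graph_def by blast
  then have "v \<in> verts B" using walk_closed_set[of T u p v "verts B"] u step by blast
  then show False using none v by blast
qed

text \<open>Distinct cut-vertices on \<open>C\<close> lead to distinct neighbouring blocks, since
  two blocks share at most one vertex. Conversely, every shared vertex is a cut-vertex, and at a
  cut-vertex there is just one other block.\<close>

lemma end_block_iff:
  "end_block T C \<longleftrightarrow> block T C \<and> circle C \<and> (\<exists>!v. v \<in> verts C \<and> cut_vertex T v)"
proof
  assume C: "end_block T C"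
  then have b: "block T C" "circle C" using circle_tree by (auto simp: end_block_def circle_tree_def)
  obtain B' where B': "\<And>B''. block T B'' \<and> B'' \<noteq> C \<and> verts C \<inter> verts B'' \<noteq> {} \<Longrightarrow> B'' = B'"
    using C unfolding end_block_def by blast
  obtain v where v: "v \<in> verts C" "cut_vertex T v" using block_has_cut_vertex[OF b(1)] by blast
  have "w = v" if w: "w \<in> verts C" "cut_vertex T w" for w
  proof (rule ccontr)
    assume "w \<noteq> v"
    obtain B1 where B1: "block T B1" "v \<in> verts B1" "B1 \<noteq> C" using cut_vertex_other_block[OF v(2) b(1) v(1)] by blast
    obtain B2 where B2: "block T B2" "w \<in> verts B2" "B2 \<noteq> C" using cut_vertex_other_block[OF w(2) b(1) w(1)] by blast
    have "B1 = B2" using B'[of B1] B'[of B2] B1 B2 v w by blast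
    then have "B1 = C" using blocks_share_two_vertices[OF B1(1) b(1) signed_graph_T, of v w] B1 B2 v w \<open>w \<noteq> v\<close> by blast
    then show False using B1 by blast
  qed
  then show "block T C \<and> circle C \<and> (\<exists>!v. v \<in> verts C \<and> cut_vertex T v)" using b v by blast
next
  assume "block T C \<and> circle C \<and> (\<exists>!v. v \<in> verts C \<and> cut_vertex T v)"
  then obtain v where b: "block T C" "v \<in> verts C" "cut_vertex T v" "\<And>w. w \<in> verts C \<Longrightarrow> cut_vertex T w \<Longrightarrow> w = v"
    by blast
  obtain B' where B': "block T B'" "v \<in> verts B'" "B' \<noteq> C"
    "\<And>B''. block T B'' \<Longrightarrow> v \<in> verts B'' \<Longrightarrow> B'' = C \<or> B'' = B'"
    using cut_vertex_other_block[OF b(3,1,2)] by blast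
  have "B'' = B'" if B'': "block T B''" "B'' \<noteq> C" "verts C \<inter> verts B'' \<noteq> {}" for B''
  proof -
    obtain u where u: "u \<in> verts C" "u \<in> verts B''" using B''(3) by blast
    then have "u = v" using non_cut_block_unique[OF b(1) B''(1) u] B''(2) b(4) by blast
    then show ?thesis using B'(4)[OF B''(1)] u B''(2) by blast
  qed
  then show "end_block T C" unfolding end_block_def using b B' by blast
qed

text \<open>A shortest closed piece of the tour cannot change blocks, since it would have to come back
  through the same cut-vertex; so it runs once around a circle with a single cut-vertex.\<close>

lemma closed_run_end_block:
  assumes "d \<in> darts" "m > 0" "tail T ((nxt ^^ m) d) = tail T d"
  shows "\<exists>j<m. end_block T (dblk ((nxt ^^ j) d))"
  using assms
proof (induction m arbitrary: d rule: less_induct)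
  case (less m)
  let ?d = "\<lambda>j. (nxt ^^ j) d"
  let ?t = "\<lambda>j. tail T (?d j)"
  note d = less.prems(1) and dj = iter_darts[OF less.prems(1)]
  show ?case
  \<comment> \<open>A repetition other than the closing one gives a shorter closed piece, to which
    induction applies.\<close>
  proof (cases "\<exists>i j. i < j \<and> j \<le> m \<and> j - i < m \<and> ?t i = ?t j")
    case True
    then obtain i j where ij: "i < j" "j \<le> m" "j - i < m" "?t i = ?t j" by blast
    have comp: "(nxt ^^ k) (?d i) = ?d (k + i)" for k by (simp add: funpow_add)
    have "?t (j - i + i) = ?t i" using ij by simp
    then have "tail T ((nxt ^^ (j - i)) (?d i)) = tail T (?d i)" unfolding comp .
    then obtain k where "k < j - i" "end_block T (dblk ((nxt ^^ k) (?d i)))"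
      using less.IH[of "j - i" "?d i"] ij dj[of i] by auto
    then show ?thesis unfolding comp using ij by (intro exI[of _ "k + i"]) auto
  next
    case False
    then have inj: "?t i \<noteq> ?t j" if "i < j" "j \<le> m" "j - i < m" for i j using that by blast
    have hd: "head T (?d j) = ?t (Suc j)" for j using tail_nxt_iter[OF d] by simp
    \<comment> \<open>After leaving an inner cut-vertex, the run stays on the side \<open>S\<close>
      of the block it enters until it arrives at that vertex again, so it arrives from the same
      block. But at a cut-vertex the tour switches blocks.\<close>
    have ncut: "\<not> cut_vertex T (?t i)" if i: "0 < i" "i < m" for i
    proof
      assume cut: "cut_vertex T (?t i)"
      let ?B = "dblk (?d i)"
      obtain S where S: "\<And>e b. e \<in> edges T \<Longrightarrow> endpt T e b = ?t i \<Longrightarrow> e \<in> S \<longleftrightarrow> e \<in> edges ?B"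
        "\<And>e g b c. e \<in> S \<Longrightarrow> g \<in> edges T \<Longrightarrow> endpt T e b = endpt T g c \<Longrightarrow> endpt T e b \<noteq> ?t i \<Longrightarrow> g \<in> S"
        using block_side[OF dart_block(1)[OF dj[of i]] signed_graph_T dart_block(3)[OF dj[of i]]] by blast
      have move: "fst (?d k) \<in> S" if "fst (?d j) \<in> S" "?t (Suc j) = ?t k" "?t k \<noteq> ?t i" for j k
        using S(2)[of "fst (?d j)" "fst (?d k)" "\<not> snd (?d j)" "snd (?d k)"] that hd[of j] dart_edge[OF dj[of k]] by simp
      have A: "fst (?d (i + j)) \<in> S" if "i + j < m" for j
        using that
      proof (induction j)
        case 0
        then show ?case using S(1)[OF dart_edge[OF dj[of i]] refl] dart_block(2)[OF dj[of i]] by simp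
      next
        case (Suc j)
        then show ?case using move[of "i + j" "i + Suc j"] inj[of i "i + Suc j"] i by auto
      qed
      have "fst (?d (m - 1)) \<in> S" using A[of "m - 1 - i"] i by auto
      \<comment> \<open>Wrapping around: only the vertices agree here, dart number \<open>m\<close>
        need not be dart number 0. This suffices for \<open>move\<close>.\<close>
      moreover have "?t (Suc (m - 1)) = ?t 0" using less.prems(2,3) by simp
      ultimately have 0: "fst (?d 0) \<in> S" using move[of "m - 1" 0] inj[of 0 i] i by auto
      have "fst (?d j) \<in> S" if "j < i" for j
        using that
      proof (induction j)
        case (Suc j)
        then show ?case using move[of j "Suc j"] inj[of "Suc j" i] i by auto
      qed (use 0 in simp)
      then have p: "fst (?d (i - 1)) \<in> S" using i by auto
      have hp: "head T (?d (i - 1)) = ?t i" using hd[of "i - 1"] i by simp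
      have "fst (?d (i - 1)) \<in> edges ?B" using S(1)[OF dart_edge[OF dj] hp] p by simp
      then have "dblk (?d (i - 1)) = ?B" using dblk_eq[OF dart_block(1)[OF dj[of i]]] by blast
      moreover have "?d i = nxt (?d (i - 1))" using i by (cases i) auto
      ultimately show False using nxt(3)[OF dj[of "i - 1"]] hp cut by simp
    qed
    let ?B = "dblk d"
    have B: "block T ?B" using dart_block d by blast
    have same: "dblk (?d j) = ?B" if "j < m" for j
      using that
    proof (induction j)
      case (Suc j)
      then show ?case using nxt(3)[OF dj[of j]] ncut[of "Suc j"] hd[of j] by simp
    qed simp
    note VB = run_within_block(1)[OF B d less.prems(2) same less.prems(3)]
    \<comment> \<open>On a bridge the run would have to continue beyond the other endpoint, which is
      a cut-vertex, against \<open>ncut\<close>.\<close>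
    have circ: "circle ?B"
    proof (rule ccontr)
      assume nc: "\<not> circle ?B"
      obtain e where e: "edges ?B = {e}" "verts ?B = {endpt T e True, endpt T e False}" "endpt T e True \<noteq> endpt T e False"
        using non_circle_blockE[OF B nc] .
      have "fst d = e" using dart_block(2)[OF d] e(1) by simp
      then have "?t 1 \<noteq> ?t 0" using e(3) hd[of 0] by (cases "snd d") auto
      then have "1 < m" using less.prems(2,3) by (cases "m = 1") auto
      then show False
        using ncut[of 1] non_circle_block_cut_vertex[OF B nc, of "?t 1"] dart_block(4)[OF d] hd[of 0] by simp
    qed
    have only: "v = tail T d" if v: "v \<in> verts ?B" "cut_vertex T v" for v
    proof -
      obtain j where j: "j < m" "v = ?t j" using v(1) VB by blast
      then have "j = 0" using ncut[of j] v(2) by blast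
      then show ?thesis using j by simp
    qed
    have "end_block T ?B"
      using end_block_iff B circ block_has_cut_vertex[OF B] only by metis
    then show ?thesis using less.prems(2) by (intro exI[of _ 0]) simp
  qed
qed

text \<open>An end block has exactly one cut-vertex, so its sesqui-Eulerian sign is
  \<open>(-1) ^ 1\<close>.\<close>

lemma end_block_sign:
  assumes "end_block T C"
  shows "circle_sign C = -1"
proof -
  have C: "block T C" "circle C" "\<exists>!v. v \<in> verts C \<and> cut_vertex T v" using assms end_block_iff by auto
  then obtain v where "{v \<in> verts C. cut_vertex T v} = {v}" by blast
  then show ?thesis using sesqui_Eulerian C by (auto simp: sesqui_Eulerian_def circle_block_def)
qed

text \<open>The common vertex is the only cut-vertex on either circle and lies in no third block, so
  no edge of the connected graph \<open>T\<close> leaves the two circles.\<close>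

lemma end_blocks_meet_type2:
  assumes C: "end_block T C" and C': "end_block T C'" and ne: "C \<noteq> C'" and v: "v \<in> verts C" "v \<in> verts C'"
  shows "circuit_type2 T"
proof -
  have b: "block T C" "circle C" "block T C'" "circle C'" using C C' end_block_iff by auto
  have cut: "cut_vertex T v" using non_cut_block_unique[OF b(1,3)] v ne by blast
  have step: "e \<in> edges C \<union> edges C'" if e: "e \<in> edges T" "endpt T e b \<in> verts C \<union> verts C'" for e b
  proof -
    let ?u = "endpt T e b" and ?D = "dblk (e, b)"
    have D: "block T ?D" "e \<in> edges ?D" using dblk[of "(e, b)"] e(1) by simp_all
    have u: "?u \<in> verts ?D" using block_endpt[OF D] .
    have "?D = C \<or> ?D = C'"
    proof (cases "cut_vertex T ?u")
      case True
      then have "?u = v" using C C' end_block_iff e(2) v cut by blast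
      then show ?thesis using two_blocks_at[OF D(1) b(1,3) _ v(1) v(2)] u ne by auto
    next
      case False
      then show ?thesis using non_cut_block_unique[OF D(1) _ u] b e(2) by blast
    qed
    then show ?thesis using D(2) by auto
  qed
  have endp: "endpt T e c \<in> verts C \<union> verts C'" if "e \<in> edges C \<union> edges C'" for e c
    using that block_endpt[OF b(1)] block_endpt[OF b(3)] by blast
  have vT: "v \<in> verts T" using block_T(4)[OF b(1)] v by blast
  have "w \<in> verts C \<union> verts C'" if w: "w \<in> verts T" for w
  proof -
    obtain p where "walk T v p w" using connected_T w vT unfolding connected_graph_def by blast
    then show ?thesis using walk_closed_set[of T v p w "verts C \<union> verts C'"] v step endp by blast
  qed
  then have V: "verts T = verts C \<union> verts C'" using block_T(4)[OF b(1)] block_T(4)[OF b(3)] by blast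
  have "e \<in> edges C \<union> edges C'" if e: "e \<in> edges T" for e
  proof -
    have "endpt T e True \<in> verts T" using e signed_graph_T by (auto simp: signed_graph_def)
    then show ?thesis using step[OF e] V by blast
  qed
  then have E: "edges T = edges C \<union> edges C'" using block_T(5)[OF b(1)] block_T(5)[OF b(3)] by blast
  have "T = graph_union C C'" using V E block_T(6,7)[OF b(1)] by (intro sgraph.equality) simp_all
  moreover have "verts C \<inter> verts C' = {v}"
    using blocks_share_two_vertices[OF b(1,3) signed_graph_T, of v] v ne by blast
  moreover have "subgraph C T" "subgraph C' T" using blockD b by blast+
  ultimately show ?thesis
    unfolding circuit_type2_def using b ne end_block_sign[OF C] end_block_sign[OF C'] by blast
qed

end

section \<open>End blocks along the tour\<close>

lemma funpow_cancel:
  assumes "inj_on g A" "g ` A \<subseteq> A" "x \<in> A" "y \<in> A" "(g ^^ i) x = (g ^^ (i + k)) y"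
  shows "x = (g ^^ k) y"
proof -
  have inA: "(g ^^ n) z \<in> A" if "z \<in> A" for n z using that assms(2) by (induction n) auto
  show ?thesis using assms(5)
  proof (induction i)
    case (Suc i)
    then have "g ((g ^^ i) x) = g ((g ^^ (i + k)) y)" by simp
    then show ?case using Suc.IH inj_onD[OF assms(1)] inA assms(3,4) by metis
  qed simp
qed

text \<open>The iterates of \<open>x\<close> up to its least period form an invariant set, hence all
  of \<open>A\<close>. Applied to \<open>nextc\<close>, this yields the cyclic numbering of the end
  blocks.\<close>

lemma single_orbit_enumeration:
  assumes A: "finite A" "inj_on g A" "g ` A \<subseteq> A" "x \<in> A"
    and orbit: "\<And>Y. Y \<subseteq> A \<Longrightarrow> Y \<noteq> {} \<Longrightarrow> g ` Y \<subseteq> Y \<Longrightarrow> Y = A"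
  shows "bij_betw (\<lambda>i. (g ^^ i) x) {..<card A} A" "(g ^^ card A) x = x"
proof -
  have inA: "(g ^^ n) x \<in> A" for n using A(3,4) by (induction n) auto
  define N where "N = (LEAST n. n > 0 \<and> (g ^^ n) x = x)"
  have "\<exists>n. n > 0 \<and> (g ^^ n) x = x" using funpow_return[OF A] by metis
  then have N: "N > 0 \<and> (g ^^ N) x = x" unfolding N_def by (rule LeastI_ex)
  have Nmin: "(g ^^ n) x \<noteq> x" if "0 < n" "n < N" for n
    using not_less_Least[of n "\<lambda>n. n > 0 \<and> (g ^^ n) x = x"] that unfolding N_def by blast
  have neq: "(g ^^ i) x \<noteq> (g ^^ j) x" if "i < j" "j < N" for i j
    using funpow_cancel[OF A(2,3,4,4), of i "j - i"] Nmin[of "j - i"] that by force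
  have inj: "inj_on (\<lambda>i. (g ^^ i) x) {..<N}"
    by (rule linorder_inj_onI) (use neq in auto)
  let ?Y = "(\<lambda>i. (g ^^ i) x) ` {..<N}"
  have "g y \<in> ?Y" if y: "y \<in> ?Y" for y
  proof -
    obtain i where i: "i < N" "y = (g ^^ i) x" using y by blast
    show ?thesis
    proof (cases "Suc i = N")
      case True
      then have "g y = (g ^^ 0) x" using i N by auto
      then show ?thesis using N by blast
    next
      case False
      then have "Suc i < N" "g y = (g ^^ Suc i) x" using i by auto
      then show ?thesis by blast
    qed
  qed
  then have Y: "?Y = A" using N inA by (intro orbit) auto
  then have "card A = N" using card_image[OF inj] by simp
  then show "bij_betw (\<lambda>i. (g ^^ i) x) {..<card A} A" "(g ^^ card A) x = x"
    using inj Y N by (auto simp: bij_betw_def)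
qed

context directed_circle_tree
begin

section \<open>One turn around an end block\<close>

lemma end_blockD:
  assumes "end_block T C"
  shows "block T C" "circle C" "circle_block T C"
  using assms end_block_iff by (auto simp: circle_block_def)

definition cutv :: "('v, 'e) sgraph \<Rightarrow> 'v" where
  "cutv C = (THE v. v \<in> verts C \<and> cut_vertex T v)"

lemma cutv:
  assumes "end_block T C"
  shows "cutv C \<in> verts C" "cut_vertex T (cutv C)" "\<And>v. v \<in> verts C \<Longrightarrow> cut_vertex T v \<Longrightarrow> v = cutv C"
proof -
  have ex: "\<exists>!v. v \<in> verts C \<and> cut_vertex T v" using assms end_block_iff by blast
  from theI'[OF ex] show "cutv C \<in> verts C" "cut_vertex T (cutv C)" unfolding cutv_def by blast+
  then show "\<And>v. v \<in> verts C \<Longrightarrow> cut_vertex T v \<Longrightarrow> v = cutv C" using ex by blast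
qed

definition outd :: "('v, 'e) sgraph \<Rightarrow> 'e \<times> bool" where
  "outd C = (THE d. d \<in> darts \<and> tail T d = cutv C \<and> dblk d = C)"

lemma outd:
  assumes "end_block T C"
  shows "outd C \<in> darts" "tail T (outd C) = cutv C" "dblk (outd C) = C"
  using theI'[OF out_dart[OF end_blockD(1)[OF assms] cutv(1)[OF assms]]] unfolding outd_def by blast+

text \<open>A return time; \<open>around_darts\<close> and \<open>around_inj\<close> show that this
  piece of the tour uses each dart of \<open>C\<close> exactly once.\<close>

definition clen :: "('v, 'e) sgraph \<Rightarrow> nat" where
  "clen C = (LEAST m. m > 0 \<and> tail T ((nxt ^^ m) (outd C)) = cutv C)"

lemma clen:
  assumes "end_block T C"
  shows "clen C > 0" "tail T ((nxt ^^ clen C) (outd C)) = cutv C"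
    "\<And>j. 0 < j \<Longrightarrow> j < clen C \<Longrightarrow> tail T ((nxt ^^ j) (outd C)) \<noteq> cutv C"
proof -
  note o = outd[OF assms]
  obtain n where n: "n > 0" "(nxt ^^ n) (outd C) = outd C"
    using funpow_return[OF finite_darts nxt_inj nxt_darts o(1)] .
  then have "\<exists>m. m > 0 \<and> tail T ((nxt ^^ m) (outd C)) = cutv C" using o(2) by (intro exI[of _ n]) simp
  from LeastI_ex[OF this] show "clen C > 0" "tail T ((nxt ^^ clen C) (outd C)) = cutv C"
    unfolding clen_def by blast+
  show "tail T ((nxt ^^ j) (outd C)) \<noteq> cutv C" if "0 < j" "j < clen C" for j
    using not_less_Least[of j "\<lambda>m. m > 0 \<and> tail T ((nxt ^^ m) (outd C)) = cutv C"] that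
    unfolding clen_def by blast
qed

text \<open>Before the return to \<open>cutv C\<close> the tour meets no cut-vertex, so it has no
  occasion to leave \<open>C\<close>.\<close>

lemma around_block:
  assumes C: "end_block T C"
  shows "j < clen C \<Longrightarrow> dblk ((nxt ^^ j) (outd C)) = C"
proof (induction j)
  case 0
  then show ?case using outd[OF C] by simp
next
  case (Suc j)
  let ?x = "(nxt ^^ j) (outd C)"
  have x: "?x \<in> darts" "dblk ?x = C" using iter_darts[OF outd(1)[OF C]] Suc by auto
  have "head T ?x = tail T ((nxt ^^ Suc j) (outd C))" using tail_nxt_iter[OF outd(1)[OF C]] by simp
  then have "head T ?x \<noteq> cutv C" using clen(3)[OF C, of "Suc j"] Suc.prems by simp
  moreover have "head T ?x \<in> verts C" using dart_block(4)[OF x(1)] x(2) by simp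
  ultimately have "\<not> cut_vertex T (head T ?x)" using cutv(3)[OF C] by blast
  then show ?case using nxt(3)[OF x(1)] x(2) by simp
qed

lemma around_darts:
  assumes C: "end_block T C"
  shows "{x \<in> darts. dblk x = C} = (\<lambda>j. (nxt ^^ j) (outd C)) ` {..<clen C}"
    and "verts C = (\<lambda>j. tail T ((nxt ^^ j) (outd C))) ` {..<clen C}"
  using run_within_block[OF end_blockD(1)[OF C] outd(1)[OF C] clen(1)[OF C] around_block[OF C]]
    clen(2)[OF C] outd(2)[OF C] by simp_all

lemma iter_cancel:
  assumes "x \<in> darts" "y \<in> darts" "(nxt ^^ i) x = (nxt ^^ j) y" "i \<le> j"
  shows "x = (nxt ^^ (j - i)) y"
  using funpow_cancel[OF nxt_inj nxt_darts assms(1,2), of i "j - i"] assms(3,4) by simp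

lemma around_inj:
  assumes C: "end_block T C"
  shows "inj_on (\<lambda>j. (nxt ^^ j) (outd C)) {..<clen C}"
proof (rule linorder_inj_onI)
  fix i j assume ij: "i < j" "i \<in> {..<clen C}" "j \<in> {..<clen C}"
  show "(nxt ^^ i) (outd C) \<noteq> (nxt ^^ j) (outd C)"
  proof
    assume eq: "(nxt ^^ i) (outd C) = (nxt ^^ j) (outd C)"
    have "(nxt ^^ (j - i)) (outd C) = outd C"
      using iter_cancel[OF outd(1)[OF C] outd(1)[OF C] eq] ij by simp
    moreover have "0 < j - i" "j - i < clen C" using ij by auto
    ultimately show False using clen(3)[OF C, of "j - i"] outd(2)[OF C] by simp
  qed
qed auto

abbreviation around :: "('v, 'e) sgraph \<Rightarrow> ('e \<times> bool) list" where
  "around C \<equiv> run (outd C) (clen C)"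

lemma once_around:
  assumes C: "end_block T C"
  shows "once_around C (cutv C) (dart_walk (around C))"
proof -
  note b = end_blockD[OF C] and o = outd[OF C]
  note bT = block_T[OF b(1)]
  have setD: "set (around C) = {x \<in> darts. dblk x = C}" using around_darts(1)[OF C] by (simp add: set_run)
  have E: "walk_edges (dart_walk (around C)) = edges C"
  proof
    show "walk_edges (dart_walk (around C)) \<subseteq> edges C"
      unfolding walk_edges_dart_walk setD using dart_block(2) by auto
    show "edges C \<subseteq> walk_edges (dart_walk (around C))"
    proof
      fix e assume e: "e \<in> edges C"
      then obtain c where c: "(e, c) \<in> darts" using dart_exists bT(5) by blast
      then have "dblk (e, c) = C" using dblk_eq[OF b(1)] e by simp
      then have "(e, c) \<in> set (around C)" using c setD by simp
      then show "e \<in> walk_edges (dart_walk (around C))" unfolding walk_edges_dart_walk by force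
    qed
  qed
  have V: "walk_verts (cutv C) (dart_walk (around C)) \<subseteq> verts C"
  proof -
    have "tail T ((nxt ^^ k) (outd C)) \<in> verts C" if "k \<le> clen C" for k
    proof (cases "k = clen C")
      case True
      then show ?thesis using clen(2)[OF C] cutv(1)[OF C] by simp
    next
      case False
      then show ?thesis using that around_darts(2)[OF C] by auto
    qed
    then show ?thesis using walk_verts_dart_walk_run[OF o(1), of "clen C"] o(2) by auto
  qed
  have "walk T (cutv C) (dart_walk (around C)) (cutv C)"
    using run_walk[OF o(1), of "clen C"] clen(2)[OF C] o(2) by simp
  then have "walk C (cutv C) (dart_walk (around C)) (cutv C)"
    by (rule walk_within_walk_subgraph) (use E V bT(6) in auto)
  then have cw: "closed_walk C (cutv C) (dart_walk (around C))"
    unfolding closed_walk_def using clen(1)[OF C] by (simp add: run_def dart_walk_def)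
  have dist: "distinct (around C)"
    unfolding run_def distinct_map using around_inj[OF C] by (simp add: lessThan_atLeast0)
  have inj1: "inj_on fst (set (around C))"
  proof (rule inj_onI)
    fix x y assume xy: "x \<in> set (around C)" "y \<in> set (around C)" "fst x = fst y"
    have "\<exists>!c. (fst x, c) \<in> darts"
      using unique_circle_dart[of "fst x" "snd x"] xy(1) setD b(2) dart_edge[of x] by simp
    moreover have "x \<in> darts" "y \<in> darts" using xy(1,2) unfolding setD by blast+
    then have "(fst x, snd x) \<in> darts" "(fst y, snd y) \<in> darts" by simp_all
    then have "(fst x, snd x) \<in> darts" "(fst x, snd y) \<in> darts" unfolding xy(3) .
    ultimately have "snd x = snd y" by blast
    then show "x = y" using xy(3) by (simp add: prod_eq_iff)
  qed
  have inj2: "inj_on (\<lambda>d. head T d) (set (around C))"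
  proof (rule inj_onI)
    fix x y assume xy: "x \<in> set (around C)" "y \<in> set (around C)" "head T x = head T y"
    then have "x \<in> darts" "y \<in> darts" "dblk x = dblk y" using setD by auto
    then show "x = y" using in_dart_eq xy(3) by blast
  qed
  have "distinct (map fst (dart_walk (around C)))" "distinct (map snd (dart_walk (around C)))"
    using dist inj1 inj2 by (simp_all add: dart_walk_def comp_def distinct_map)
  then show ?thesis unfolding once_around_def using b(2) cw E by blast
qed

section \<open>Connecting pieces between consecutive end blocks\<close>

definition startd :: "('v, 'e) sgraph \<Rightarrow> 'e \<times> bool" where
  "startd C = (nxt ^^ clen C) (outd C)"

lemma startd:
  assumes C: "end_block T C"
  shows "startd C \<in> darts" "tail T (startd C) = cutv C" "dblk (startd C) \<noteq> C"
    and "\<exists>p\<in>darts. nxt p = startd C \<and> dblk p = C"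
proof -
  note o = outd[OF C]
  show 1: "startd C \<in> darts" "tail T (startd C) = cutv C"
    using iter_darts[OF o(1)] clen(2)[OF C] unfolding startd_def by auto
  obtain k where k: "clen C = Suc k" using clen(1)[OF C] gr0_implies_Suc by blast
  let ?p = "(nxt ^^ k) (outd C)"
  have p: "?p \<in> darts" "nxt ?p = startd C" "dblk ?p = C"
    using iter_darts[OF o(1)] k around_block[OF C, of k] by (auto simp: startd_def)
  then show "\<exists>p\<in>darts. nxt p = startd C \<and> dblk p = C" by blast
  show "dblk (startd C) \<noteq> C"
    using nxt(2,3)[OF p(1)] p(2,3) 1(2) cutv(2)[OF C] by simp
qed

text \<open>The minimum exists because the tour meets every dart. It may be 0 when two end blocks
  share a vertex; \<open>plen_pos\<close> excludes this for disjoint end blocks.\<close>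

definition plen :: "('v, 'e) sgraph \<Rightarrow> nat" where
  "plen C = (LEAST k. end_block T (dblk ((nxt ^^ k) (startd C))))"

definition nextc :: "('v, 'e) sgraph \<Rightarrow> ('v, 'e) sgraph" where
  "nextc C = dblk ((nxt ^^ plen C) (startd C))"

abbreviation conn :: "('v, 'e) sgraph \<Rightarrow> ('e \<times> bool) list" where
  "conn C \<equiv> run (startd C) (plen C)"

lemma nextc:
  assumes C: "end_block T C"
  shows "end_block T (nextc C)"
    and plen_min: "\<And>j. j < plen C \<Longrightarrow> \<not> end_block T (dblk ((nxt ^^ j) (startd C)))"
proof -
  obtain n where "(nxt ^^ n) (startd C) = outd C" using orbit_meets[OF startd(1)[OF C] outd(1)[OF C]] .
  then have "\<exists>k. end_block T (dblk ((nxt ^^ k) (startd C)))" using outd(3)[OF C] C by metis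
  from LeastI_ex[OF this] show "end_block T (nextc C)" unfolding nextc_def plen_def .
  show "\<not> end_block T (dblk ((nxt ^^ j) (startd C)))" if "j < plen C" for j
    using not_less_Least[of j "\<lambda>k. end_block T (dblk ((nxt ^^ k) (startd C)))"] that unfolding plen_def by blast
qed

text \<open>The tour changes blocks only at cut-vertices, and an end block has only one; so the turn
  around the next end block starts exactly here.\<close>

lemma conn_end:
  assumes C: "end_block T C"
  shows "(nxt ^^ plen C) (startd C) = outd (nextc C)"
proof -
  let ?x = "(nxt ^^ plen C) (startd C)"
  note N = nextc(1)[OF C]
  have x: "?x \<in> darts" "dblk ?x = nextc C" using iter_darts[OF startd(1)[OF C]] by (auto simp: nextc_def)
  have "cut_vertex T (tail T ?x)"
  proof (cases "plen C")
    case 0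
    then show ?thesis using startd(2)[OF C] cutv(2)[OF C] by simp
  next
    case (Suc k)
    let ?y = "(nxt ^^ k) (startd C)"
    have y: "?y \<in> darts" "nxt ?y = ?x" using iter_darts[OF startd(1)[OF C]] Suc by auto
    have "\<not> end_block T (dblk ?y)" using plen_min[OF C, of k] Suc by simp
    then have "dblk ?x \<noteq> dblk ?y" using N x(2) by metis
    then show ?thesis using nxt(2,3)[OF y(1)] y(2) by simp
  qed
  then have "tail T ?x = cutv (nextc C)" using cutv(3)[OF N] dart_block(3)[OF x(1)] x(2) by simp
  then show ?thesis using out_dart_eq[OF x(1) outd(1)[OF N]] outd[OF N] x(2) by simp
qed

text \<open>A repeated vertex would close up a piece of the tour, which by
  \<open>closed_run_end_block\<close> contains a dart of an end block, against the minimality of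
  \<open>plen C\<close>.\<close>

lemma conn_tails_inj:
  assumes C: "end_block T C"
  shows "inj_on (\<lambda>j. tail T ((nxt ^^ j) (startd C))) {..plen C}"
proof (rule linorder_inj_onI)
  fix i j assume ij: "i < j" "i \<in> {..plen C}" "j \<in> {..plen C}"
  let ?x = "(nxt ^^ i) (startd C)"
  have comp: "(nxt ^^ k) ?x = (nxt ^^ (k + i)) (startd C)" for k by (simp add: funpow_add)
  show "tail T ?x \<noteq> tail T ((nxt ^^ j) (startd C))"
  proof
    assume "tail T ?x = tail T ((nxt ^^ j) (startd C))"
    then have "tail T ((nxt ^^ (j - i)) ?x) = tail T ?x" unfolding comp using ij by simp
    then obtain k where k: "k < j - i" "end_block T (dblk ((nxt ^^ k) ?x))"
      using closed_run_end_block[OF iter_darts[OF startd(1)[OF C]], of "j - i" i] ij by auto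
    have "k + i < plen C" using k(1) ij by auto
    then show False using plen_min[OF C, of "k + i"] k(2) unfolding comp by simp
  qed
qed auto

lemma run_path:
  assumes "d \<in> darts" "inj_on (\<lambda>j. tail T ((nxt ^^ j) d)) {..n}"
  shows "path T (tail T d) (dart_walk (run d n)) (tail T ((nxt ^^ n) d))"
proof -
  let ?t = "\<lambda>j. tail T ((nxt ^^ j) d)"
  have "tail T d # map snd (dart_walk (run d n)) = map ?t (0 # map Suc [0..<n])"
    unfolding map_snd_dart_walk_run[OF assms(1)] by (simp add: comp_def)
  also have "\<dots> = map ?t [0..<Suc n]" by (simp only: upt_conv_Cons zero_less_Suc map_Suc_upt)
  finally have "distinct (tail T d # map snd (dart_walk (run d n)))"
    using assms(2) by (simp only: distinct_map set_upt distinct_upt lessThan_Suc_atMost[symmetric] lessThan_atLeast0)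
  then show ?thesis unfolding path_def using run_walk[OF assms(1)] by blast
qed

lemma conn_path:
  assumes C: "end_block T C"
  shows "path T (cutv C) (dart_walk (conn C)) (cutv (nextc C))"
  using run_path[OF startd(1)[OF C] conn_tails_inj[OF C]] startd(2)[OF C] conn_end[OF C]
    outd(2)[OF nextc(1)[OF C]] by simp

lemma end_block_exists: "\<exists>C. end_block T C"
proof -
  obtain e where "e \<in> edges T" using edges_T by blast
  then obtain b where "(e, b) \<in> darts" using dart_exists by blast
  moreover from this obtain n where "n > 0" "(nxt ^^ n) (e, b) = (e, b)"
    using funpow_return[OF finite_darts nxt_inj nxt_darts] by blast
  ultimately show ?thesis using closed_run_end_block[of "(e, b)" n] by auto
qed

text \<open>The darts on the circles of \<open>E\<close> and on the connecting pieces after them are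
  closed under \<open>nxt\<close>, and the tour is a single orbit.\<close>

lemma closed_family_covers:
  assumes E: "E \<subseteq> {C. end_block T C}" "E \<noteq> {}" "nextc ` E \<subseteq> E"
  shows "darts = {d \<in> darts. dblk d \<in> E \<or> (\<exists>C\<in>E. d \<in> set (conn C))}" (is "_ = ?Y")
proof (rule darts_single_orbit[symmetric])
  obtain C where C: "C \<in> E" using E by blast
  then have "outd C \<in> darts" "dblk (outd C) = C" using outd E(1) by blast+
  then have "outd C \<in> ?Y" using C by simp
  then show "?Y \<noteq> {}" by blast
next
  fix d assume "d \<in> ?Y"
  then have d: "d \<in> darts" "dblk d \<in> E \<or> (\<exists>C\<in>E. d \<in> set (conn C))" by blast+
  have nd: "nxt d \<in> darts" using nxt(1)[OF d(1)] .
  from d(2) have "dblk (nxt d) \<in> E \<or> (\<exists>C\<in>E. nxt d \<in> set (conn C))"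
  proof
    assume dE: "dblk d \<in> E"
    let ?C = "dblk d"
    have C: "end_block T ?C" using dE E(1) by blast
    have "d \<in> {x \<in> darts. dblk x = ?C}" using d(1) by blast
    then obtain j where j: "j < clen ?C" "d = (nxt ^^ j) (outd ?C)" using around_darts(1)[OF C] by blast
    show ?thesis
    proof (cases "Suc j = clen ?C")
      case False
      then have "dblk (nxt d) = ?C" using around_block[OF C, of "Suc j"] j by simp
      then show ?thesis using dE by simp
    next
      case True
      have "nxt d = (nxt ^^ Suc j) (outd ?C)" using arg_cong[OF j(2), of nxt] by simp
      then have s: "nxt d = startd ?C" unfolding startd_def True .
      show ?thesis
      proof (cases "plen ?C")
        case 0
        then have "dblk (nxt d) = nextc ?C" using s by (simp add: nextc_def)
        then show ?thesis using E(3) dE by auto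
      next
        case (Suc k)
        then have "nxt d \<in> set (conn ?C)" using s unfolding set_run by (intro image_eqI[of _ _ 0]) simp_all
        then show ?thesis using dE by blast
      qed
    qed
  next
    assume "\<exists>C\<in>E. d \<in> set (conn C)"
    then obtain C j where C: "C \<in> E" and j: "j < plen C" "d = (nxt ^^ j) (startd C)" unfolding set_run by blast
    have nd: "nxt d = (nxt ^^ Suc j) (startd C)" using j by simp
    show ?thesis
    proof (cases "Suc j = plen C")
      case True
      then have "dblk (nxt d) = nextc C" using nd by (simp only: nextc_def)
      then show ?thesis using E(3) C by auto
    next
      case False
      then have "nxt d \<in> set (conn C)" using nd j unfolding set_run by (intro image_eqI[of _ _ "Suc j"]) simp_all
      then show ?thesis using C by blast
    qed
  qed
  then show "nxt d \<in> ?Y" using nd by blast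
qed blast

lemma conn_not_end:
  assumes "end_block T C" "d \<in> set (conn C)"
  shows "d \<in> darts" "\<not> end_block T (dblk d)"
  using assms plen_min[OF assms(1)] iter_darts[OF startd(1)[OF assms(1)]] unfolding set_run by auto

text \<open>By the covering, the departing dart of any end block lies on a circle of
  \<open>E\<close> or in a connecting piece; the latter contain no darts of end blocks.\<close>

lemma nextc_single_orbit:
  assumes "E \<subseteq> {C. end_block T C}" "E \<noteq> {}" "nextc ` E \<subseteq> E"
  shows "E = {C. end_block T C}"
proof -
  have "C \<in> E" if C: "end_block T C" for C
  proof -
    have "outd C \<in> {d \<in> darts. dblk d \<in> E \<or> (\<exists>C\<in>E. d \<in> set (conn C))}"
      using closed_family_covers[OF assms] outd(1)[OF C] by blast
    then have "C \<in> E \<or> (\<exists>C'\<in>E. outd C \<in> set (conn C'))" using outd(3)[OF C] by simp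
    then show ?thesis using conn_not_end(2) C outd(3)[OF C] assms(1) by fastforce
  qed
  then show ?thesis using assms(1) by blast
qed

text \<open>Going back from a common dart to \<open>startd C\<close> and one step further leads to a
  dart of the end block \<open>C\<close>, which cannot lie in the connecting piece of
  \<open>C'\<close>. The bound \<open>j \<le> plen C'\<close> includes the arrival at the next end
  block, as \<open>nextc_inj\<close> needs.\<close>

lemma startd_cancel:
  assumes C: "end_block T C" "end_block T C'" and eq: "(nxt ^^ i) (startd C) = (nxt ^^ j) (startd C')"
    and ij: "i \<le> j" "j \<le> plen C'"
  shows "C = C'"
proof -
  have s: "startd C = (nxt ^^ (j - i)) (startd C')"
    using iter_cancel[OF startd(1)[OF C(1)] startd(1)[OF C(2)] eq ij(1)] .
  obtain p where p: "p \<in> darts" "nxt p = startd C" "dblk p = C" using startd(4)[OF C(1)] by blast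
  obtain p' where p': "p' \<in> darts" "nxt p' = startd C'" "dblk p' = C'" using startd(4)[OF C(2)] by blast
  show ?thesis
  proof (cases "j - i")
    case 0
    then have "nxt p = nxt p'" using s unfolding p(2) p'(2) by simp
    then have "p = p'" using inj_onD[OF nxt_inj] p(1) p'(1) by blast
    then show ?thesis using p(3) p'(3) by simp
  next
    case (Suc k)
    let ?q = "(nxt ^^ k) (startd C')"
    have "nxt p = nxt ?q" using p(2) s Suc by simp
    then have "p = ?q" using inj_onD[OF nxt_inj] p(1) iter_darts[OF startd(1)[OF C(2)]] by blast
    then have "end_block T (dblk ?q)" using p(3) C(1) by simp
    moreover have "k < plen C'" using Suc ij(2) by linarith
    ultimately show ?thesis using plen_min[OF C(2), of k] by blast
  qed
qed

lemma nextc_inj: "inj_on nextc {C. end_block T C}"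
proof (rule inj_onI)
  fix C C' assume C: "C \<in> {C. end_block T C}" "C' \<in> {C. end_block T C}" "nextc C = nextc C'"
  then have "(nxt ^^ plen C) (startd C) = (nxt ^^ plen C') (startd C')" using conn_end by simp
  then show "C = C'"
    using startd_cancel[of C C' "plen C" "plen C'"] startd_cancel[of C' C "plen C'" "plen C"] C
      nat_le_linear[of "plen C" "plen C'"] by auto
qed

lemma dart_owner:
  assumes "d \<in> darts" "\<not> end_block T (dblk d)"
  shows "\<exists>!C. end_block T C \<and> d \<in> set (conn C)"
proof -
  have "darts = {d \<in> darts. dblk d \<in> {C. end_block T C} \<or> (\<exists>C\<in>{C. end_block T C}. d \<in> set (conn C))}"
    using end_block_exists nextc(1) by (intro closed_family_covers) auto
  then obtain C where C: "end_block T C" "d \<in> set (conn C)" using assms by blast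
  have "C' = C" if C': "end_block T C'" "d \<in> set (conn C')" for C'
  proof -
    obtain i where i: "i < plen C" "d = (nxt ^^ i) (startd C)" using C(2) unfolding set_run by blast
    obtain j where j: "j < plen C'" "d = (nxt ^^ j) (startd C')" using C'(2) unfolding set_run by blast
    have eq: "(nxt ^^ i) (startd C) = (nxt ^^ j) (startd C')" using i j by simp
    then show ?thesis
      using startd_cancel[OF C(1) C'(1) eq] startd_cancel[OF C'(1) C(1) eq[symmetric]] i(1) j(1)
        nat_le_linear[of i j] by auto
  qed
  then show ?thesis using C by blast
qed

text \<open>Opposite darts at positions \<open>i\<close> and \<open>j\<close> would give
  \<open>j = i + 1\<close> and \<open>i = j + 1\<close>, since the vertices of a connecting piece
  are distinct.\<close>

lemma conn_not_both_darts:
  assumes C: "end_block T C" and "(e, b) \<in> set (conn C)" "(e, \<not> b) \<in> set (conn C)"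
  shows False
proof -
  let ?t = "\<lambda>j. tail T ((nxt ^^ j) (startd C))"
  obtain i where i: "i < plen C" "(e, b) = (nxt ^^ i) (startd C)" using assms(2) unfolding set_run by blast
  obtain j where j: "j < plen C" "(e, \<not> b) = (nxt ^^ j) (startd C)" using assms(3) unfolding set_run by blast
  have "?t j = ?t (Suc i)" "?t i = ?t (Suc j)"
    using tail_nxt_iter[OF startd(1)[OF C], of i] tail_nxt_iter[OF startd(1)[OF C], of j]
    by (simp_all add: i(2)[symmetric] j(2)[symmetric] del: funpow.simps)
  then have "j = Suc i" "i = Suc j"
    using inj_onD[OF conn_tails_inj[OF C], of j "Suc i"] inj_onD[OF conn_tails_inj[OF C], of i "Suc j"] i(1) j(1)
    by simp_all
  then show False by simp
qed

lemma dblk_edge: "dblk (e, b) = dblk (e, c)"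
  by (simp add: dblk_def)

text \<open>Each dart outside the end blocks belongs to exactly one connecting piece. A circle edge
  has one dart; the two darts of a bridge lie in different pieces.\<close>

lemma conn_edge_count:
  assumes e: "e \<in> edges T" "\<not> end_block T (dblk (e, b))"
  shows "card {C. end_block T C \<and> e \<in> walk_edges (dart_walk (conn C))} = (if circle (dblk (e, b)) then 1 else 2)"
proof -
  let ?A = "{C. end_block T C \<and> e \<in> walk_edges (dart_walk (conn C))}"
  have ne: "\<not> end_block T (dblk (e, c))" for c using e(2) dblk_edge[of e b c] by simp
  have mem: "C \<in> ?A \<longleftrightarrow> end_block T C \<and> ((e, True) \<in> set (conn C) \<or> (e, False) \<in> set (conn C))" for C
  proof -
    have "e \<in> fst ` set (conn C) \<longleftrightarrow> (\<exists>c. (e, c) \<in> set (conn C))" by force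
    then show ?thesis unfolding walk_edges_dart_walk by (simp add: ex_bool_eq)
  qed
  show ?thesis
  proof (cases "circle (dblk (e, b))")
    case True
    obtain c where c: "(e, c) \<in> darts" "\<And>c'. (e, c') \<in> darts \<Longrightarrow> c' = c"
      using unique_circle_dart[OF e(1) True] by blast
    obtain C where C: "end_block T C" "(e, c) \<in> set (conn C)" "\<And>C'. end_block T C' \<Longrightarrow> (e, c) \<in> set (conn C') \<Longrightarrow> C' = C"
      using dart_owner[OF c(1)] ne by blast
    have "?A = {C}"
    proof
      show "?A \<subseteq> {C}" using mem C(3) c(2) conn_not_end(1) by blast
      show "{C} \<subseteq> ?A" using mem C(1,2) by (cases c) auto
    qed
    then show ?thesis using True by simp
  next
    case False
    have D: "(e, c) \<in> darts" for c
      using non_circle_dart[of "(e, c)"] False dblk_edge[of e b c] e(1) by simp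
    obtain C1 where C1: "end_block T C1" "(e, True) \<in> set (conn C1)" "\<And>C'. end_block T C' \<Longrightarrow> (e, True) \<in> set (conn C') \<Longrightarrow> C' = C1"
      using dart_owner[OF D[of True] ne] by blast
    obtain C2 where C2: "end_block T C2" "(e, False) \<in> set (conn C2)" "\<And>C'. end_block T C' \<Longrightarrow> (e, False) \<in> set (conn C') \<Longrightarrow> C' = C2"
      using dart_owner[OF D[of False] ne] by blast
    have "C1 \<noteq> C2" using conn_not_both_darts[OF C1(1), of e True] C1(2) C2(2) by auto
    moreover have "?A = {C1, C2}" using mem C1 C2 by blast
    ultimately show ?thesis using False by simp
  qed
qed

end

section \<open>The Type III circuits\<close>

lemma block_in_subgraph: "block G B \<Longrightarrow> subgraph B H \<Longrightarrow> subgraph H G \<Longrightarrow> block H B"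
  unfolding block_def using subgraph_trans by blast

context directed_circle_tree
begin

text \<open>A bridge block contains no circle, and a circle block contains no smaller one. This
  carries the circle blocks of the subgraphs \<open>part C\<close> back to \<open>T\<close>.\<close>

lemma circle_in_circle_block:
  assumes D: "circle D" "nonseparable D" "subgraph D T"
  shows "circle_block T D"
proof -
  obtain B where B: "block T B" "subgraph D B" using nonseparable_in_block[OF D(2,3) signed_graph_T] .
  have "circle B"
  proof (rule ccontr)
    assume nc: "\<not> circle B"
    obtain e where e: "edges B = {e}" "verts B = {endpt T e True, endpt T e False}" "endpt T e True \<noteq> endpt T e False"
      using non_circle_blockE[OF B(1) nc] .
    have "e \<in> edges T" using e block_T(5)[OF B(1)] by blast
    then have "walk T (endpt T e True) [(e, endpt T e False)] (endpt T e False)"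
      using walk_edge[OF _ signed_graph_T, of e True] by simp
    then have "path T (endpt T e True) [(e, endpt T e False)] (endpt T e False)"
      using e(3) by (simp add: path_def)
    moreover have "edges D \<subseteq> walk_edges [(e, endpt T e False)]"
      using subgraphD(3)[OF B(2)] e(1) by (simp add: walk_edges_def)
    ultimately show False by (rule no_circle_in_path[OF _ D(1) subgraphD(4)[OF D(3)]])
  qed
  then have "D = B" using circle_subgraph_eq D(1) B(2) by blast
  then show ?thesis using B(1) D(1) by (simp add: circle_block_def)
qed

lemma block_path_edge:
  assumes "block_path T u p v" "e \<in> walk_edges p"
  shows "e \<in> edges T" "\<not> circle (dblk (e, b))"
proof -
  obtain B where B: "block T B" "\<not> circle B" "e \<in> edges B" using assms unfolding block_path_def by blast
  then show "e \<in> edges T" "\<not> circle (dblk (e, b))" using dblk_eq[OF B(1), of "(e, b)"] block_T(5)[OF B(1)] by auto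
qed

text \<open>Follow the tour from the bridge forwards and backwards to the nearest circle blocks. In
  between there are only bridges, so by \<open>closed_run_end_block\<close> no vertex repeats. This
  gives every bridge the value 2 in the indicator.\<close>

lemma non_circle_edge_on_block_path:
  assumes e: "e \<in> edges T" "\<not> circle (dblk (e, b))"
  obtains u p v where "block_path T u p v" "e \<in> walk_edges p"
proof -
  define d where "d = (e, b)"
  have d: "d \<in> darts" using e by (simp add: d_def non_circle_dart)
  obtain C where C: "end_block T C" using end_block_exists by blast
  note o = outd[OF C] and circ = end_blockD[OF C]
  \<comment> \<open>The least such \<open>j\<close> leads back to the last dart in a circle block
    before \<open>d\<close>.\<close>
  define Q where "Q j \<longleftrightarrow> (\<exists>t\<in>darts. circle (dblk t) \<and> (nxt ^^ j) t = d)" for j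
  have "\<exists>j. Q j" using orbit_meets[OF o(1) d] o circ(2) unfolding Q_def by metis
  define j where "j = (LEAST j. Q j)"
  have "Q j" using LeastI_ex[OF \<open>\<exists>j. Q j\<close>] unfolding j_def .
  then obtain t where t: "t \<in> darts" "circle (dblk t)" "(nxt ^^ j) t = d" unfolding Q_def by blast
  have "j \<noteq> 0" using t e(2) by (metis funpow_0 d_def)
  then obtain j' where j': "j = Suc j'" using not0_implies_Suc by blast
  have "\<exists>m. circle (dblk ((nxt ^^ m) d))" using orbit_meets[OF d o(1)] o circ(2) by metis
  define m where "m = (LEAST m. circle (dblk ((nxt ^^ m) d)))"
  have m: "circle (dblk ((nxt ^^ m) d))" using LeastI_ex[OF \<open>\<exists>m. circle (dblk ((nxt ^^ m) d))\<close>] unfolding m_def .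
  have m_min: "\<not> circle (dblk ((nxt ^^ k) d))" if "k < m" for k
    using not_less_Least[of k "\<lambda>m. circle (dblk ((nxt ^^ m) d))"] that unfolding m_def by blast
  have "m \<noteq> 0" using m e(2) by (metis funpow_0 d_def)
  define s where "s = nxt t"
  have s: "s \<in> darts" using nxt(1)[OF t(1)] by (simp add: s_def)
  have st: "(nxt ^^ Suc k) t = (nxt ^^ k) s" for k by (simp only: funpow_Suc_right o_apply s_def)
  have sd: "(nxt ^^ j') s = d" using t(3) st[of j'] j' by simp
  define n where "n = j' + m"
  have sn: "(nxt ^^ n) s = (nxt ^^ m) d" using sd unfolding n_def by (simp add: funpow_add add.commute[of j'])
  have bridge: "\<not> circle (dblk ((nxt ^^ i) s))" if i: "i < n" for i
  proof (cases "i < j'")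
    case True
    have "\<not> Q (j - Suc i)" using not_less_Least[of "j - Suc i" Q] j' unfolding j_def[symmetric] by simp
    moreover have "(nxt ^^ (j - Suc i)) ((nxt ^^ Suc i) t) = d"
      using t(3) True j' by (simp only: funpow_add[THEN fun_cong, unfolded o_apply, symmetric]) simp
    ultimately have "\<not> circle (dblk ((nxt ^^ Suc i) t))" using iter_darts[OF t(1)] unfolding Q_def by blast
    then show ?thesis unfolding st .
  next
    case False
    then have "(nxt ^^ i) s = (nxt ^^ (i - j')) ((nxt ^^ j') s)"
      by (simp only: funpow_add[THEN fun_cong, unfolded o_apply, symmetric]) simp
    moreover have "i - j' < m" using False i n_def by linarith
    ultimately show ?thesis using m_min[of "i - j'"] sd by simp
  qed
  let ?t = "\<lambda>j. tail T ((nxt ^^ j) s)"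
  have inj: "inj_on ?t {..n}"
  proof (rule linorder_inj_onI)
    fix i k assume ik: "i < k" "i \<in> {..n}" "k \<in> {..n}"
    let ?x = "(nxt ^^ i) s"
    have comp: "(nxt ^^ k) ?x = (nxt ^^ (k + i)) s" for k by (simp add: funpow_add)
    show "?t i \<noteq> ?t k"
    proof
      assume "?t i = ?t k"
      then have "tail T ((nxt ^^ (k - i)) ?x) = tail T ?x" unfolding comp using ik by simp
      then obtain l where l: "l < k - i" "end_block T (dblk ((nxt ^^ l) ?x))"
        using closed_run_end_block[OF iter_darts[OF s], of "k - i" i] ik by auto
      have "l + i < n" using l(1) ik by auto
      then show False using bridge[of "l + i"] end_blockD(2)[OF l(2)] unfolding comp by simp
    qed
  qed auto
  have pth: "path T (tail T s) (dart_walk (run s n)) (?t n)" using run_path[OF s inj] .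
  have n0: "0 < n" using \<open>m \<noteq> 0\<close> by (simp add: n_def)
  let ?C1 = "dblk t" and ?C2 = "dblk ((nxt ^^ m) d)"
  have C1: "circle_block T ?C1" "tail T s \<in> verts ?C1"
    using dart_block[OF t(1)] t(2) nxt(2)[OF t(1)] by (simp_all add: circle_block_def s_def)
  have C2: "circle_block T ?C2" "?t n \<in> verts ?C2"
    using dart_block[OF iter_darts[OF d, of m]] m sn by (simp_all add: circle_block_def)
  \<comment> \<open>Otherwise \<open>block_contains_path\<close> would put the bridges of the run
    into the circle block.\<close>
  have ne: "?C1 \<noteq> ?C2"
  proof
    assume eq: "?C1 = ?C2"
    have "tail T s \<noteq> ?t n" using inj_onD[OF inj, of 0 n] n0 by auto
    then have "walk_edges (dart_walk (run s n)) \<subseteq> edges ?C1"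
      using block_contains_path[OF dart_block(1)[OF t(1)] signed_graph_T pth C1(2)] C2(2) eq by simp
    moreover have "s \<in> set (run s n)" unfolding set_run using n0 by (intro image_eqI[of _ _ 0]) simp_all
    ultimately have "fst s \<in> edges ?C1" unfolding walk_edges_dart_walk by blast
    then have "dblk s = ?C1" using dblk_eq[OF dart_block(1)[OF t(1)]] by blast
    then show False using bridge[OF n0] t(2) by simp
  qed
  have "\<exists>B. block T B \<and> \<not> circle B \<and> f \<in> edges B" if f: "f \<in> walk_edges (dart_walk (run s n))" for f
  proof -
    obtain i where i: "i < n" "f = fst ((nxt ^^ i) s)" using f unfolding walk_edges_dart_walk set_run by blast
    then show ?thesis using bridge[OF i(1)] dart_block(1,2)[OF iter_darts[OF s, of i]] by blast
  qed
  then have "block_path T (tail T s) (dart_walk (run s n)) (?t n)"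
    unfolding block_path_def using pth C1 C2 ne by blast
  moreover have "d \<in> set (run s n)"
    unfolding set_run using sd \<open>m \<noteq> 0\<close> by (intro image_eqI[of _ _ j']) (simp_all add: n_def)
  then have "e \<in> walk_edges (dart_walk (run s n))" unfolding walk_edges_dart_walk by (force simp: d_def)
  ultimately show ?thesis using that by blast
qed

lemma indicator_T:
  "indicator T e = (if e \<notin> edges T then 0 else if circle (dblk (e, b)) then 1 else 2)"
proof -
  have c: "(\<exists>C. circle_block T C \<and> e \<in> edges C) \<longleftrightarrow> e \<in> edges T \<and> circle (dblk (e, b))"
    using dblk_eq[of _ "(e, b)"] dblk[of "(e, b)"] block_T(5) by (auto simp: circle_block_def)
  have p: "(\<exists>u p v. block_path T u p v \<and> e \<in> walk_edges p) \<longleftrightarrow> e \<in> edges T \<and> \<not> circle (dblk (e, b))"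
    using block_path_edge(1)[of _ _ _ e] block_path_edge(2)[of _ _ _ e b] non_circle_edge_on_block_path[of e b] by metis
  show ?thesis unfolding indicator_def c p by simp
qed

end

text \<open>If two end blocks meet, \<open>T\<close> is a Type II circuit by
  \<open>end_blocks_meet_type2\<close>. Disjointness makes all connecting pieces nonempty.\<close>

locale directed_circle_tree_disjoint = directed_circle_tree T \<omega>
  for T :: "('v, 'e) sgraph" and \<omega> :: "'e \<Rightarrow> bool \<Rightarrow> int" +
  assumes end_blocks_disjoint:
    "end_block T C \<Longrightarrow> end_block T C' \<Longrightarrow> C \<noteq> C' \<Longrightarrow> verts C \<inter> verts C' = {}"
begin

text \<open>Around an empty connecting piece, two distinct end blocks would share their
  cut-vertex.\<close>

lemma plen_pos:
  assumes C: "end_block T C"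
  shows "plen C > 0"
proof (rule ccontr)
  assume "\<not> plen C > 0"
  then have "outd (nextc C) = startd C" using conn_end[OF C] by simp
  then have "nextc C \<noteq> C" "cutv (nextc C) = cutv C" using startd(2,3)[OF C] outd[OF nextc(1)[OF C]] by auto
  then show False
    using end_blocks_disjoint[OF nextc(1)[OF C] C] cutv(1)[OF C] cutv(1)[OF nextc(1)[OF C]] by auto
qed

text \<open>A return to \<open>C\<close> would repeat the vertex \<open>cutv C\<close> on the
  connecting piece.\<close>

lemma nextc_neq:
  assumes C: "end_block T C"
  shows "nextc C \<noteq> C"
proof
  assume "nextc C = C"
  then have "tail T ((nxt ^^ plen C) (startd C)) = tail T ((nxt ^^ 0) (startd C))"
    using conn_end[OF C] startd(2)[OF C] outd(2)[OF C] by simp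
  then show False using inj_onD[OF conn_tails_inj[OF C], of "plen C" 0] plen_pos[OF C] by simp
qed

text \<open>The subgraph T_i of the theorem, for \<open>C\<close> the end block C_i.\<close>

definition part :: "('v, 'e) sgraph \<Rightarrow> ('v, 'e) sgraph" where
  "part C = graph_union (graph_union C (walk_subgraph T (cutv C) (dart_walk (conn C)))) (nextc C)"

lemma part_simps:
  assumes C: "end_block T C"
  shows "verts (part C) = verts C \<union> walk_verts (cutv C) (dart_walk (conn C)) \<union> verts (nextc C)"
    "edges (part C) = edges C \<union> walk_edges (dart_walk (conn C)) \<union> edges (nextc C)"
    "endpt (part C) = endpt T" "esign (part C) = esign T"
  using block_T(6,7)[OF end_blockD(1)[OF C]] by (simp_all add: part_def)

lemma conn_walk_verts:
  assumes C: "end_block T C"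
  shows "walk_verts (cutv C) (dart_walk (conn C)) = (\<lambda>k. tail T ((nxt ^^ k) (startd C))) ` {..plen C}"
  using walk_verts_dart_walk_run[OF startd(1)[OF C], of "plen C"] startd(2)[OF C] by simp

lemma conn_edge_not_end:
  assumes C: "end_block T C" and D: "end_block T D" and e: "e \<in> walk_edges (dart_walk (conn C))"
  shows "e \<notin> edges D"
proof
  assume eD: "e \<in> edges D"
  obtain d where d: "d \<in> set (conn C)" "e = fst d" using e unfolding walk_edges_dart_walk by blast
  then have "dblk d = D" using dblk_eq[OF end_blockD(1)[OF D]] eD by blast
  then show False using conn_not_end(2)[OF C d(1)] D by simp
qed

lemma part_subgraph:
  assumes C: "end_block T C"
  shows "subgraph (part C) T"
proof -
  let ?p = "dart_walk (conn C)"
  note b = block_T[OF end_blockD(1)[OF C]] and b' = block_T[OF end_blockD(1)[OF nextc(1)[OF C]]]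
  have w: "walk T (cutv C) ?p (cutv (nextc C))" using conn_path[OF C] by (simp add: path_def)
  have wT: "walk_edges ?p \<subseteq> edges T" "walk_verts (cutv C) ?p \<subseteq> verts T"
    using walk_edges_subset[OF w] walk_verts_subset[OF w signed_graph_T] .
  have sub: "verts (part C) \<subseteq> verts T" "edges (part C) \<subseteq> edges T"
    using part_simps[OF C] b(4,5) b'(4,5) wT by auto
  have fin: "finite (verts (part C))" "finite (edges (part C))"
    using sub signed_graph_T by (auto simp: signed_graph_def intro: finite_subset)
  have ep: "endpt T e c \<in> verts (part C)" if e: "e \<in> edges (part C)" for e c
    using e unfolding part_simps[OF C]
    using block_endpt[OF end_blockD(1)[OF C]] block_endpt[OF end_blockD(1)[OF nextc(1)[OF C]]]
      walk_edges_endpoints[OF w] by blast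
  have "signed_graph (part C)"
    using fin ep sub signed_graph_T unfolding signed_graph_def part_simps(3,4)[OF C] by blast
  then show ?thesis using sub part_simps[OF C] by (simp add: subgraph_def)
qed

lemma end_in_part:
  assumes C: "end_block T C"
  shows "subgraph C (part C)" "subgraph (nextc C) (part C)"
  using block_T[OF end_blockD(1)[OF C]] block_T[OF end_blockD(1)[OF nextc(1)[OF C]]] part_simps[OF C]
  by (auto simp: subgraph_def)

text \<open>Such a vertex on an end block \<open>D\<close> would lie in another block as well, hence
  be \<open>cutv D\<close>; but this is an endpoint of the connecting piece and is visited only
  once.\<close>

lemma conn_interior:
  assumes C: "end_block T C" and j: "0 < j" "j < plen C"
  shows "tail T ((nxt ^^ j) (startd C)) \<notin> verts C \<union> verts (nextc C)"
proof
  let ?x = "(nxt ^^ j) (startd C)"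
  note N = nextc(1)[OF C]
  have x: "?x \<in> darts" "\<not> end_block T (dblk ?x)" using iter_darts[OF startd(1)[OF C]] plen_min[OF C j(2)] by auto
  assume "tail T ?x \<in> verts C \<union> verts (nextc C)"
  then obtain D where D: "D = C \<or> D = nextc C" "tail T ?x \<in> verts D" by blast
  then have DE: "end_block T D" using C N by blast
  then have "dblk ?x \<noteq> D" using x(2) by auto
  then have "cut_vertex T (tail T ?x)"
    using non_cut_block_unique[OF dart_block(1)[OF x(1)] end_blockD(1)[OF DE] dart_block(3)[OF x(1)] D(2)] by blast
  then have "tail T ?x = cutv D" using cutv(3)[OF DE D(2)] by blast
  moreover have "cutv C = tail T ((nxt ^^ 0) (startd C))" "cutv (nextc C) = tail T ((nxt ^^ plen C) (startd C))"
    using startd(2)[OF C] conn_end[OF C] outd(2)[OF N] by simp_all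
  ultimately have "j = 0 \<or> j = plen C"
    using D(1) inj_onD[OF conn_tails_inj[OF C], of j 0] inj_onD[OF conn_tails_inj[OF C], of j "plen C"] j by auto
  then show False using j by auto
qed

lemma conn_path_in_part:
  assumes C: "end_block T C"
  shows "path (part C) (cutv C) (dart_walk (conn C)) (cutv (nextc C))"
proof -
  have w: "walk T (cutv C) (dart_walk (conn C)) (cutv (nextc C))" using conn_path[OF C] by (simp add: path_def)
  have "walk (part C) (cutv C) (dart_walk (conn C)) (cutv (nextc C))"
    by (rule walk_within_walk_subgraph[OF w]) (use part_simps[OF C] in blast)+
  then show ?thesis using conn_path[OF C] by (simp add: path_def)
qed

lemma part_type3:
  assumes C: "end_block T C"
  shows "circuit_type3 (part C)"
proof -
  let ?p = "dart_walk (conn C)" and ?N = "nextc C"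
  note N = nextc(1)[OF C]
  have pth: "path (part C) (cutv C) ?p (cutv ?N)"
    using conn_path_in_part[OF C] .
  obtain k where k: "plen C = Suc k" using plen_pos[OF C] gr0_implies_Suc by blast
  \<comment> \<open>\<open>butlast\<close> removes the arrival at \<open>nextc C\<close>, leaving
    the vertices in positions 1 to \<open>plen C - 1\<close>.\<close>
  have "butlast ?p = dart_walk (run (startd C) k)" by (simp add: k run_Suc dart_walk_def)
  then have "snd ` set (butlast ?p) = set (map snd (dart_walk (run (startd C) k)))" by simp
  also have "\<dots> = (\<lambda>j. tail T ((nxt ^^ Suc j) (startd C))) ` {..<k}"
    unfolding map_snd_dart_walk_run[OF startd(1)[OF C]] by (simp only: set_map set_upt lessThan_atLeast0)
  finally have "snd ` set (butlast ?p) \<inter> (verts C \<union> verts ?N) = {}"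
    using conn_interior[OF C, of "Suc _"] k by auto
  moreover have "part C = graph_union (graph_union C (walk_subgraph (part C) (cutv C) ?p)) ?N"
    by (simp add: part_def graph_union_def walk_subgraph_def)
  moreover have "verts C \<inter> verts ?N = {}" using end_blocks_disjoint[OF C N] nextc_neq[OF C] by metis
  moreover have "?p \<noteq> []" using plen_pos[OF C] by (simp add: run_def)
  ultimately show ?thesis
    unfolding circuit_type3_def
    using end_in_part[OF C] end_blockD(2)[OF C] end_blockD(2)[OF N] end_block_sign[OF C] end_block_sign[OF N]
      pth cutv(1)[OF C] cutv(1)[OF N] by blast
qed

lemma part_connected:
  assumes C: "end_block T C"
  shows "connected_graph (part C)"
proof -
  let ?S = "part C" and ?N = "nextc C" and ?p = "dart_walk (conn C)"
  note S = subgraphD[OF part_subgraph[OF C]] and N = nextc(1)[OF C]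
  have pth: "path ?S (cutv C) ?p (cutv ?N)"
    using conn_path_in_part[OF C] .
  have uS: "cutv C \<in> verts ?S" using cutv(1)[OF C] part_simps(1)[OF C] by blast
  have "\<exists>p. walk ?S x p y" if xy: "x \<in> verts ?S" "y \<in> verts ?S" for x y
  proof (rule connected_viaI[OF S(1), of "{cutv C}"])
    have "walk ?S (cutv C) [] (cutv C)" using uS by simp
    then show "\<exists>p. walk ?S a p b" if "a \<in> {cutv C}" "b \<in> {cutv C}" for a b using that by blast
    have "\<exists>p. walk ?S a p (cutv C)" if a: "a \<in> verts ?S" for a
    proof -
      consider "a \<in> verts C" | "a \<in> walk_verts (cutv C) ?p" | "a \<in> verts ?N" using a part_simps(1)[OF C] by blast
      then show ?thesis
      proof cases
        case 1
        then obtain q where "walk C a q (cutv C)"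
          using block_T(2)[OF end_blockD(1)[OF C]] cutv(1)[OF C] unfolding connected_graph_def by blast
        then show ?thesis using walk_subgraphI[OF end_in_part(1)[OF C]] by blast
      next
        case 2
        obtain q r where "walk ?S (cutv C) q a" using path_split[OF pth S(1) 2] by metis
        from walk_rev[OF this S(1)] show ?thesis .
      next
        case 3
        then obtain q where "walk ?N a q (cutv ?N)"
          using block_T(2)[OF end_blockD(1)[OF N]] cutv(1)[OF N] unfolding connected_graph_def by blast
        then have q: "walk ?S a q (cutv ?N)" using walk_subgraphI[OF end_in_part(2)[OF C]] by blast
        obtain r where "walk ?S (cutv ?N) r (cutv C)" using pth walk_rev[OF _ S(1)] unfolding path_def by blast
        then show ?thesis using walk_append[OF q] by blast
      qed
    qed
    then show "\<exists>b\<in>{cutv C}. \<exists>p. walk ?S a p b" if "a \<in> verts ?S" for a using that by blast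
  qed (use xy in auto)
  then show ?thesis using uS unfolding connected_graph_def by blast
qed

text \<open>Any further circle block would be edge-disjoint from both circles and so lie on the
  connecting path, which contains no circle.\<close>

lemma part_circle_block_iff:
  assumes C: "end_block T C"
  shows "circle_block (part C) D \<longleftrightarrow> D = C \<or> D = nextc C"
proof
  note N = nextc(1)[OF C]
  assume D: "circle_block (part C) D"
  then have d: "circle D" "nonseparable D" "subgraph D (part C)" using blockD by (auto simp: circle_block_def)
  have DT: "circle_block T D" using circle_in_circle_block d subgraph_trans[OF d(3) part_subgraph[OF C]] by blast
  then have bl: "block T D" by (simp add: circle_block_def)
  show "D = C \<or> D = nextc C"
  proof (rule ccontr)
    assume ne: "\<not> (D = C \<or> D = nextc C)"
    then have "edges D \<inter> edges C = {}" "edges D \<inter> edges (nextc C) = {}"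
      using blocks_share_edge[OF bl _ signed_graph_T] end_blockD(1)[OF C] end_blockD(1)[OF N] by blast+
    then have "edges D \<subseteq> walk_edges (dart_walk (conn C))"
      using subgraphD(3)[OF d(3)] part_simps(2)[OF C] by blast
    then show False using no_circle_in_path[OF conn_path[OF C] d(1)] block_T(6)[OF bl] by blast
  qed
next
  assume "D = C \<or> D = nextc C"
  then show "circle_block (part C) D"
    using block_in_subgraph[OF _ _ part_subgraph[OF C]] end_in_part[OF C] end_blockD[OF C]
      end_blockD[OF nextc(1)[OF C]] unfolding circle_block_def by blast
qed

text \<open>Inside the part the edges of the connecting path lie in non-circle blocks, although in
  \<open>T\<close> some of them may lie on circle blocks; this is why all of them count 2.\<close>

lemma indicator_part:
  assumes C: "end_block T C"
  shows "indicator (part C) e = of_bool (e \<in> edges C) + of_bool (e \<in> edges (nextc C)) +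
    2 * of_bool (e \<in> walk_edges (dart_walk (conn C)))"
proof -
  let ?S = "part C" and ?N = "nextc C" and ?p = "dart_walk (conn C)"
  note S = subgraphD[OF part_subgraph[OF C]] and N = nextc(1)[OF C]
  have c: "(\<exists>D. circle_block ?S D \<and> e \<in> edges D) \<longleftrightarrow> e \<in> edges C \<or> e \<in> edges ?N"
    unfolding part_circle_block_iff[OF C] by auto
  have pth: "path ?S (cutv C) ?p (cutv ?N)"
    using conn_path_in_part[OF C] .
  have "\<exists>B. block ?S B \<and> \<not> circle B \<and> f \<in> edges B" if f: "f \<in> walk_edges ?p" for f
  proof -
    have "f \<in> edges ?S" using f part_simps(2)[OF C] by blast
    then obtain B where B: "block ?S B" "f \<in> edges B" using edge_in_block[OF S(1)] by blast
    then have "\<not> circle B"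
      using part_circle_block_iff[OF C, of B] conn_edge_not_end[OF C C f] conn_edge_not_end[OF C N f]
      unfolding circle_block_def by blast
    then show ?thesis using B by blast
  qed
  moreover have "circle_block ?S C" "circle_block ?S ?N" "C \<noteq> ?N"
    using part_circle_block_iff[OF C] nextc_neq[OF C] by auto
  ultimately have bp: "block_path ?S (cutv C) ?p (cutv ?N)"
    unfolding block_path_def using pth cutv(1)[OF C] cutv(1)[OF N] by blast
  have in_S: "e \<in> edges ?S" if q: "block_path ?S u q v" "e \<in> walk_edges q" for u q v
  proof -
    have "walk ?S u q v" using q(1) by (simp add: block_path_def path_def)
    from walk_edges_subset[OF this] show ?thesis using q(2) by blast
  qed
  have p: "(\<exists>u q v. block_path ?S u q v \<and> e \<in> walk_edges q) \<longleftrightarrow> e \<in> walk_edges ?p"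
    if out: "\<not> (e \<in> edges C \<or> e \<in> edges ?N)"
  proof
    assume "\<exists>u q v. block_path ?S u q v \<and> e \<in> walk_edges q"
    then have "e \<in> edges ?S" using in_S by metis
    then show "e \<in> walk_edges ?p" using out part_simps(2)[OF C] by blast
  qed (use bp in blast)
  have "edges C \<inter> edges ?N = {}"
    using blocks_share_edge[OF end_blockD(1)[OF C] end_blockD(1)[OF N] signed_graph_T] nextc_neq[OF C]
    by (metis disjoint_iff)
  then have "\<not> (e \<in> edges C \<and> e \<in> edges ?N)" by blast
  moreover have "\<not> (e \<in> edges C \<and> e \<in> walk_edges ?p)" "\<not> (e \<in> edges ?N \<and> e \<in> walk_edges ?p)"
    using conn_edge_not_end[OF C C] conn_edge_not_end[OF C N] by blast+
  ultimately show ?thesis unfolding indicator_def c using p by auto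
qed

text \<open>Consecutive darts contribute ends of opposite values, so it is enough that both edges
  survive in the subgraph.\<close>

lemma coherent_not_sink_source:
  assumes d: "d \<in> darts" "fst d \<in> edges H" "fst (nxt d) \<in> edges H" and H: "endpt H = endpt T"
  shows "\<not> sink H \<omega> (head T d)" "\<not> source H \<omega> (head T d)"
proof -
  have ends: "(fst d, \<not> snd d) \<in> ends_at H (head T d)" "(fst (nxt d), snd (nxt d)) \<in> ends_at H (head T d)"
    using d H nxt(2)[OF d(1)] unfolding ends_at_def by auto
  have opp: "\<omega> (fst (nxt d)) (snd (nxt d)) = - \<omega> (fst d) (\<not> snd d)" using nxt_coherent[OF d(1)] .
  show "\<not> sink H \<omega> (head T d)"
  proof
    assume "sink H \<omega> (head T d)"
    then have "\<forall>(e, b)\<in>ends_at H (head T d). \<omega> e b = 1" by (simp add: sink_def)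
    then have "\<omega> (fst d) (\<not> snd d) = 1" "\<omega> (fst (nxt d)) (snd (nxt d)) = 1" using ends by blast+
    then show False using opp by simp
  qed
  show "\<not> source H \<omega> (head T d)"
  proof
    assume "source H \<omega> (head T d)"
    then have "\<forall>(e, b)\<in>ends_at H (head T d). \<omega> e b = -1" by (simp add: source_def)
    then have "\<omega> (fst d) (\<not> snd d) = -1" "\<omega> (fst (nxt d)) (snd (nxt d)) = -1" using ends by blast+
    then show False using opp by simp
  qed
qed

text \<open>Inside a circle or the path, the two darts are neighbours in that piece of the tour. At
  \<open>cutv C\<close> they are the last dart of the circle and \<open>startd C\<close>, at the
  other cut-vertex the last dart of the path and \<open>outd (nextc C)\<close>.\<close>

lemma part_coherent_at:
  assumes C: "end_block T C" and w: "w \<in> verts (part C)"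
  obtains d where "d \<in> darts" "fst d \<in> edges (part C)" "fst (nxt d) \<in> edges (part C)" "head T d = w"
proof -
  note found = that
  let ?E = "edges (part C)" and ?N = "nextc C"
  note N = nextc(1)[OF C]
  have sub: "edges C \<subseteq> ?E" "edges ?N \<subseteq> ?E" "fst ` set (conn C) \<subseteq> ?E"
    using part_simps(2)[OF C] unfolding walk_edges_dart_walk by auto
  have connE: "fst ((nxt ^^ k) (startd C)) \<in> ?E" if "k < plen C" for k
    using sub(3) that unfolding set_run by blast
  have aroundE: "fst ((nxt ^^ k) (outd D)) \<in> edges D" if "end_block T D" "k < clen D" for k D
    using dart_block(2)[OF iter_darts[OF outd(1)[OF that(1)]]] around_block[OF that] by metis
  have at_circle: thesis if D: "end_block T D" "edges D \<subseteq> ?E" and w: "w \<in> verts D" "w \<noteq> cutv D" for D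
  proof -
    obtain j where j: "j < clen D" "w = tail T ((nxt ^^ j) (outd D))" using around_darts(2)[OF D(1)] w(1) by blast
    have "j \<noteq> 0" using j(2) w(2) outd(2)[OF D(1)] by (metis funpow_0)
    then obtain k where k: "j = Suc k" using not0_implies_Suc by blast
    show thesis
    proof (rule found)
      show "(nxt ^^ k) (outd D) \<in> darts" using iter_darts[OF outd(1)[OF D(1)]] .
      show "fst ((nxt ^^ k) (outd D)) \<in> ?E" using aroundE[OF D(1), of k] D(2) j(1) k by auto
      show "fst (nxt ((nxt ^^ k) (outd D))) \<in> ?E" using aroundE[OF D(1), of j] D(2) j(1) k by auto
      show "head T ((nxt ^^ k) (outd D)) = w" using tail_nxt_iter[OF outd(1)[OF D(1)], of k] j(2) k by simp
    qed
  qed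
  have at_C: thesis if w: "w = cutv C"
  proof -
    obtain p where p: "p \<in> darts" "nxt p = startd C" "dblk p = C" using startd(4)[OF C] by blast
    show thesis
    proof (rule found[OF p(1)])
      show "fst p \<in> ?E" using dart_block(2)[OF p(1)] p(3) sub(1) by auto
      show "fst (nxt p) \<in> ?E" using p(2) connE[of 0] plen_pos[OF C] by simp
      show "head T p = w" using nxt(2)[OF p(1)] p(2) startd(2)[OF C] w by simp
    qed
  qed
  obtain k where k: "plen C = Suc k" using plen_pos[OF C] gr0_implies_Suc by blast
  have at_N: thesis if w: "w = cutv ?N"
  proof (rule found)
    let ?d = "(nxt ^^ k) (startd C)"
    show d: "?d \<in> darts" using iter_darts[OF startd(1)[OF C]] .
    show "fst ?d \<in> ?E" using connE[of k] k by simp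
    have nd: "nxt ?d = outd ?N" using conn_end[OF C] k by simp
    then show "fst (nxt ?d) \<in> ?E" using dart_block(2)[OF outd(1)[OF N]] outd(3)[OF N] sub(2) by auto
    show "head T ?d = w" using nxt(2)[OF d] nd outd(2)[OF N] w by simp
  qed
  have at_conn: thesis if w: "w = tail T ((nxt ^^ j) (startd C))" and j: "0 < j" "j < plen C" for j
  proof -
    obtain i where i: "j = Suc i" using j(1) gr0_implies_Suc by blast
    show thesis
    proof (rule found)
      show "(nxt ^^ i) (startd C) \<in> darts" using iter_darts[OF startd(1)[OF C]] .
      show "fst ((nxt ^^ i) (startd C)) \<in> ?E" using connE[of i] j i by simp
      show "fst (nxt ((nxt ^^ i) (startd C))) \<in> ?E" using connE[of j] j i by simp
      show "head T ((nxt ^^ i) (startd C)) = w" using tail_nxt_iter[OF startd(1)[OF C], of i] w i by simp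
    qed
  qed
  consider "w \<in> verts C" | "w \<in> verts ?N" | j where "j \<le> plen C" "w = tail T ((nxt ^^ j) (startd C))"
    using w part_simps(1)[OF C] conn_walk_verts[OF C] by auto
  then show thesis
  proof cases
    case 1
    then show thesis using at_circle[OF C sub(1)] at_C by blast
  next
    case 2
    then show thesis using at_circle[OF N sub(2)] at_N by blast
  next
    case 3
    consider "j = 0" | "j = plen C" | "0 < j" "j < plen C" using 3(1) by linarith
    then show thesis
    proof cases
      case 1
      then have "w = cutv C" using 3(2) startd(2)[OF C] by simp
      then show thesis using at_C by blast
    next
      case 2
      then have "w = cutv ?N" using 3(2) conn_end[OF C] outd(2)[OF N] by simp
      then show thesis using at_N by blast
    next
      case 3
      then show thesis using at_conn \<open>w = _\<close> by blast
    qed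
  qed
qed

text \<open>Sinks and sources are excluded by consecutive darts of the tour. The condition at
  cut-vertices is inherited, because a cut-vertex of the part on one of its circles is also one of
  \<open>T\<close>.\<close>

lemma part_direction:
  assumes C: "end_block T C"
  shows "direction (part C) \<omega>"
proof -
  let ?S = "part C"
  note SG = part_subgraph[OF C]
  note S = subgraphD[OF SG]
  have or: "orientation ?S \<omega>"
    using direction S(3,5) by (auto simp: direction_def orientation_def)
  have ss: "\<not> sink ?S \<omega> w" "\<not> source ?S \<omega> w" for w
  proof -
    have "\<not> sink ?S \<omega> w \<and> \<not> source ?S \<omega> w"
    proof (cases "w \<in> verts ?S")
      case True
      obtain d where d: "d \<in> darts" "fst d \<in> edges ?S" "fst (nxt d) \<in> edges ?S" "head T d = w"
        using part_coherent_at[OF C True] .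
      then show ?thesis using coherent_not_sink_source[OF d(1-3) S(4)] by simp
    qed (simp add: sink_def source_def)
    then show "\<not> sink ?S \<omega> w" "\<not> source ?S \<omega> w" by auto
  qed
  have "sink D \<omega> v \<or> source D \<omega> v" if D: "circle_block ?S D" "v \<in> verts D" "cut_vertex ?S v" for D v
  proof -
    have "D = C \<or> D = nextc C" using D(1) unfolding part_circle_block_iff[OF C] .
    then have DE: "end_block T D" using C nextc(1)[OF C] by auto
    note bD = end_blockD[OF DE]
    have "cut_vertex T v"
    proof (rule ccontr)
      assume nc: "\<not> cut_vertex T v"
      have DS: "subgraph D ?S" using D(1) blockD by (auto simp: circle_block_def)
      have "\<not> cut_vertex ?S v"
      proof (rule not_cut_vertex_in_single_block[OF S(1) part_connected[OF C] DS block_T(3)[OF bD(1)] D(2)])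
        fix e b assume e: "e \<in> edges ?S" "endpt ?S e b = v"
        then have eT: "e \<in> edges T" "endpt T e b = v" using S(3,4) by auto
        have B: "block T (dblk (e, b))" "e \<in> edges (dblk (e, b))" using dblk[of "(e, b)"] eT(1) by simp_all
        then have "dblk (e, b) = D"
          using non_cut_block_unique[OF B(1) bD(1) _ D(2) nc] block_endpt[OF B, of b] eT(2) by blast
        then show "e \<in> edges D" using B(2) by simp
      qed
      then show False using D(3) by blast
    qed
    then show ?thesis using direction bD(3) D(2) by (auto simp: direction_def)
  qed
  then show ?thesis unfolding direction_def using or ss by blast
qed

end

section \<open>The decomposition\<close>

lemma bij_betw_card_Collect:
  assumes "bij_betw f A B"
  shows "card {a \<in> A. Q (f a)} = card {b \<in> B. Q b}"
proof (rule bij_betw_same_card[of f], rule bij_betw_imageI)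
  show "inj_on f {a \<in> A. Q (f a)}" using assms by (auto simp: bij_betw_def intro: inj_on_subset)
  show "f ` {a \<in> A. Q (f a)} = {b \<in> B. Q b}" using assms by (auto simp: bij_betw_def)
qed

context directed_circle_tree_disjoint
begin

abbreviation ends :: "('v, 'e) sgraph set" where
  "ends \<equiv> {C. end_block T C}"

lemma finite_ends: "finite ends"
proof (rule finite_subset)
  show "ends \<subseteq> dblk ` darts"
  proof
    fix C assume "C \<in> ends"
    then have "outd C \<in> darts" "C = dblk (outd C)" using outd by auto
    then show "C \<in> dblk ` darts" by blast
  qed
qed (use finite_darts in blast)

lemma nextc_bij: "bij_betw nextc ends ends"
proof -
  have "nextc ` ends \<subseteq> ends" using nextc(1) by blast
  then have "nextc ` ends = ends" using endo_inj_surj[OF finite_ends _ nextc_inj] by blast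
  then show ?thesis using nextc_inj by (simp add: bij_betw_def)
qed

lemma end_of_edge: "end_block T C \<Longrightarrow> e \<in> edges C \<longleftrightarrow> e \<in> edges T \<and> dblk (e, b) = C"
  using dblk_eq[of C "(e, b)"] dblk(2)[of "(e, b)"] end_blockD(1)[of C] block_T(5)[of C] by auto

text \<open>An edge of an end block counts 1 in two parts, an edge of another circle block 2 in one
  part, a bridge 2 in two parts. The sums 2, 2 and 4 are twice the values 1, 1 and 2 of the
  indicator of \<open>T\<close>; hence the factor one half.\<close>

lemma indicator_decomposition:
  "indicator T e = 1 / 2 * (\<Sum>C\<in>ends. indicator (part C) e)"
proof -
  let ?k = "\<Sum>C\<in>ends. of_bool (e \<in> edges C) :: real"
  let ?A = "{C. end_block T C \<and> e \<in> walk_edges (dart_walk (conn C))}"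
  have k': "(\<Sum>C\<in>ends. of_bool (e \<in> edges (nextc C))) = ?k"
    using sum.reindex_bij_betw[OF nextc_bij, of "\<lambda>C. of_bool (e \<in> edges C) :: real"] .
  have A: "(\<Sum>C\<in>ends. of_bool (e \<in> walk_edges (dart_walk (conn C))) :: real) = real (card ?A)"
  proof -
    have "ends \<inter> {C. e \<in> walk_edges (dart_walk (conn C))} = ?A" by blast
    then show ?thesis using finite_ends by (simp add: of_bool_def sum.If_cases)
  qed
  have "(\<Sum>C\<in>ends. indicator (part C) e) = (\<Sum>C\<in>ends. of_bool (e \<in> edges C) + of_bool (e \<in> edges (nextc C)) +
    2 * of_bool (e \<in> walk_edges (dart_walk (conn C))))"
    by (intro sum.cong) (simp_all add: indicator_part)
  also have "\<dots> = 2 * ?k + 2 * real (card ?A)"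
    unfolding sum.distrib k' A[symmetric] by (simp add: sum_distrib_left)
  finally have S: "1 / 2 * (\<Sum>C\<in>ends. indicator (part C) e) = ?k + real (card ?A)" by simp
  let ?D = "dblk (e, True)"
  show ?thesis
  proof (cases "e \<in> edges T")
    case False
    have "e \<notin> walk_edges (dart_walk (conn C))" if "end_block T C" for C
      using False conn_not_end(1)[OF that] dart_edge unfolding walk_edges_dart_walk by blast
    then have "?A = {}" by blast
    moreover have "?k = 0" using False end_of_edge[of _ e True] by (intro sum.neutral) simp
    ultimately have "?k + real (card ?A) = 0" by (simp only: card.empty of_nat_0 add_0_right)
    then show ?thesis unfolding S using False indicator_T[of e True] by simp
  next
    case True
    have k: "?k = of_bool (end_block T ?D)"
    proof -
      have "?k = (\<Sum>C\<in>ends. of_bool (C = ?D))"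
        using end_of_edge[of _ e True] True by (intro sum.cong) auto
      also have "\<dots> = of_bool (end_block T ?D)"
        using finite_ends by (simp add: of_bool_def sum.delta)
      finally show ?thesis .
    qed
    show ?thesis
    proof (cases "end_block T ?D")
      case end_e: True
      have "e \<notin> walk_edges (dart_walk (conn C))" if "end_block T C" for C
        using conn_edge_not_end[OF that end_e, of e] end_of_edge[OF end_e, of e True] True by blast
      then have "?A = {}" by blast
      then have "?k + real (card ?A) = 1" using k end_e by (simp only: card.empty of_nat_0 add_0_right of_bool_eq)
      then show ?thesis unfolding S using True end_blockD(2)[OF end_e] indicator_T[of e True] by simp
    next
      case False
      have "?k + real (card ?A) = (if circle ?D then 1 else 2)"
        using k False conn_edge_count[OF True False] by simp
      then show ?thesis unfolding S using True indicator_T[of e True] by simp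
    qed
  qed
qed

text \<open>Joins the pieces into one run of the tour. \<open>P i\<close> precedes circle number
  \<open>i\<close>, so the run starts after circle number \<open>n - 1\<close>; the index in the
  conclusion is that of the last circle completed.\<close>

lemma tour_decomposition:
  fixes C :: "nat \<Rightarrow> ('v, 'e) sgraph" and P c :: "nat \<Rightarrow> ('e \<times> 'v) list"
  assumes C: "\<And>i. i < n \<Longrightarrow> end_block T (C i)"
    and nx: "\<And>i. i < n \<Longrightarrow> C (Suc i mod n) = nextc (C i)"
    and P: "\<And>i. i < n \<Longrightarrow> P (Suc i mod n) = dart_walk (conn (C i))"
    and c: "\<And>i. i < n \<Longrightarrow> c i = dart_walk (around (C i))"
    and n: "n > 0" and m: "m \<le> n"
  shows "\<exists>M. concat (map (\<lambda>i. P i @ c i) [0..<m]) = dart_walk (run (startd (C (n - 1))) M) \<and>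
    (nxt ^^ M) (startd (C (n - 1))) = startd (C (if m = 0 then n - 1 else m - 1))"
  using m
proof (induction m)
  case 0
  show ?case by (intro exI[of _ 0]) (simp add: dart_walk_def)
next
  case (Suc m)
  let ?s = "startd (C (n - 1))"
  define i where "i = (if m = 0 then n - 1 else m - 1)"
  have i: "i < n" "Suc i mod n = m" using Suc.prems n by (auto simp: i_def)
  obtain M where M: "concat (map (\<lambda>i. P i @ c i) [0..<m]) = dart_walk (run ?s M)" "(nxt ^^ M) ?s = startd (C i)"
    using Suc unfolding i_def by auto
  let ?D = "C i" and ?D' = "C m"
  have D: "end_block T ?D" "?D' = nextc ?D" "P m = dart_walk (conn ?D)" "c m = dart_walk (around ?D')"
    using C[OF i(1)] nx[OF i(1)] P[OF i(1)] c[of m] i Suc.prems by auto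
  have 1: "(nxt ^^ (M + plen ?D)) ?s = outd ?D'"
    using conn_end[OF D(1)] M(2) D(2) by (simp add: funpow_add add.commute[of M])
  have 2: "(nxt ^^ (M + plen ?D + clen ?D')) ?s = startd ?D'"
    using 1 unfolding startd_def by (simp add: funpow_add add.commute[of "M + plen ?D"])
  have "concat (map (\<lambda>i. P i @ c i) [0..<Suc m]) = dart_walk (run ?s (M + plen ?D + clen ?D'))"
    unfolding run_add[of _ "M + plen ?D"] run_add[of _ M] 1 M(2) using M(1) D(3,4) by simp
  then show ?case using 2 by auto
qed

lemma circuit_decomposition:
  "\<exists>(n :: nat) (C :: nat \<Rightarrow> ('v, 'e) sgraph) (x :: nat \<Rightarrow> 'v)
       (P :: nat \<Rightarrow> ('e \<times> 'v) list) (c :: nat \<Rightarrow> ('e \<times> 'v) list)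
       (W :: ('e \<times> 'v) list) (S :: nat \<Rightarrow> ('v, 'e) sgraph).
      n \<ge> 2 \<and>
      W = concat (map (\<lambda>i. P i @ c i) [0..<n]) \<and>
      closed_walk T (x (n - 1)) W \<and> walk_sign T W = 1 \<and>
      (\<forall>i<n. once_around (C i) (x i) (c i)) \<and>
      bij_betw C {..<n} {B. end_block T B} \<and>
      (\<forall>i<n. path T (x i) (P (Suc i mod n)) (x (Suc i mod n)) \<and> P (Suc i mod n) \<noteq> []) \<and>
      (\<forall>B e. circle_block T B \<and> \<not> end_block T B \<and> e \<in> edges B \<longrightarrow>
         card {i. i < n \<and> e \<in> walk_edges (P i)} = 1) \<and>
      (\<forall>u p v e. block_path T u p v \<and> e \<in> walk_edges p \<longrightarrow>
         card {i. i < n \<and> e \<in> walk_edges (P i)} = 2) \<and>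
      (\<forall>i<n. S i = graph_union (graph_union (C i) (walk_subgraph T (x i) (P (Suc i mod n))))
                     (C (Suc i mod n))) \<and>
      (\<forall>i<n. subgraph (S i) T \<and> circuit_type3 (S i) \<and> direction (S i) \<omega>) \<and>
      indicator T = (\<lambda>e. 1 / 2 * (\<Sum>i<n. indicator (S i) e))"
proof -
  obtain C0 where C0: "end_block T C0" using end_block_exists by blast
  define n where "n = card ends"
  define C where "C i = (nextc ^^ i) C0" for i
  define x where "x i = cutv (C i)" for i
  \<comment> \<open>The cyclic predecessor: \<open>P i\<close> starts at the end block numbered
    \<open>pr i\<close> and arrives at number \<open>i\<close>.\<close>
  define pr where "pr i = (if i = 0 then n - 1 else i - 1)" for i
  define P where "P i = dart_walk (conn (C (pr i)))" for i
  define c where "c i = dart_walk (around (C i))" for i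
  define W where "W = concat (map (\<lambda>i. P i @ c i) [0..<n])"
  define S where "S i = part (C i)" for i
  have n2: "n \<ge> 2"
  proof -
    have "card {C0, nextc C0} \<le> n"
      unfolding n_def using C0 nextc(1)[OF C0] finite_ends by (intro card_mono) auto
    then show ?thesis using nextc_neq[OF C0] by auto
  qed
  have enum: "bij_betw C {..<n} ends" "(nextc ^^ n) C0 = C0"
  proof -
    have maps: "nextc ` ends \<subseteq> ends" "C0 \<in> ends" using nextc(1) C0 by auto
    have "bij_betw (\<lambda>i. (nextc ^^ i) C0) {..<card ends} ends \<and> (nextc ^^ card ends) C0 = C0"
      using single_orbit_enumeration[OF finite_ends nextc_inj maps nextc_single_orbit] by blast
    then show "bij_betw C {..<n} ends" "(nextc ^^ n) C0 = C0" unfolding C_def n_def by auto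
  qed
  have C: "end_block T (C i)" if "i < n" for i using enum(1) that by (auto simp: bij_betw_def)
  have nx: "C (Suc i mod n) = nextc (C i)" if "i < n" for i
  proof (cases "Suc i = n")
    case True
    then have "nextc (C i) = C0" using enum(2) unfolding C_def by (metis funpow.simps(2) o_apply)
    then show ?thesis using True by (simp add: C_def)
  next
    case False
    then show ?thesis using that by (simp add: C_def)
  qed
  have pr_Suc: "pr (Suc i mod n) = i" if "i < n" for i
    using that by (cases "Suc i = n") (auto simp: pr_def)
  have P: "P (Suc i mod n) = dart_walk (conn (C i))" if "i < n" for i
    using pr_Suc[OF that] by (simp add: P_def)
  have pr_bij: "bij_betw pr {..<n} {..<n}"
  proof (rule bij_betw_byWitness[of _ "\<lambda>i. Suc i mod n"])
    show "\<forall>i\<in>{..<n}. Suc (pr i) mod n = i" "pr ` {..<n} \<subseteq> {..<n}" using n2 by (auto simp: pr_def)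
    show "\<forall>i\<in>{..<n}. pr (Suc i mod n) = i" using pr_Suc by blast
    show "(\<lambda>i. Suc i mod n) ` {..<n} \<subseteq> {..<n}" using n2 by auto
  qed
  have n1: "n - 1 < n" "0 < n" using n2 by auto
  have "\<exists>M. W = dart_walk (run (startd (C (n - 1))) M) \<and> (nxt ^^ M) (startd (C (n - 1))) = startd (C (n - 1))"
    using tour_decomposition[of n C P c n, OF C nx P c_def n1(2)] n2 unfolding W_def by auto
  then obtain M where M: "W = dart_walk (run (startd (C (n - 1))) M)" "(nxt ^^ M) (startd (C (n - 1))) = startd (C (n - 1))"
    by blast
  note s = startd[OF C[OF n1(1)]]
  have "P 0 \<noteq> []" using plen_pos[OF C[OF n1(1)]] by (simp add: P_def pr_def run_def)
  then have "W \<noteq> []" unfolding W_def using n1(2) by auto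
  then have closed: "closed_walk T (x (n - 1)) W"
    unfolding closed_walk_def using run_walk[OF s(1), of M] M s(2) by (simp add: x_def)
  \<comment> \<open>The run ends at its first dart, so the two values in \<open>run_sign\<close>
    coincide and their product is 1.\<close>
  have sign: "walk_sign T W = 1"
    unfolding M(1) run_sign[OF s(1)] M(2)
    using orientation_value[OF dart_edge[OF s(1)], of "snd (startd (C (n - 1)))"] by auto
  \<comment> \<open>Reindexing by \<open>C \<circ> pr\<close> turns the count over indices into the
    count over end blocks in \<open>conn_edge_count\<close>.\<close>
  have count: "card {i. i < n \<and> e \<in> walk_edges (P i)} = (if circle (dblk (e, True)) then 1 else 2)"
    if "e \<in> edges T" "\<not> end_block T (dblk (e, True))" for e
  proof -
    let ?Q = "\<lambda>D. e \<in> walk_edges (dart_walk (conn D))"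
    have "card {i \<in> {..<n}. ?Q ((C \<circ> pr) i)} = card {D \<in> ends. ?Q D}"
      by (rule bij_betw_card_Collect) (use bij_betw_trans[OF pr_bij enum(1)] in blast)
    then show ?thesis using conn_edge_count[OF that] by (simp add: P_def)
  qed
  have b1: "card {i. i < n \<and> e \<in> walk_edges (P i)} = 1"
    if B: "circle_block T B" "\<not> end_block T B" "e \<in> edges B" for B e
  proof -
    have bl: "block T B" "circle B" using B(1) by (auto simp: circle_block_def)
    then have "dblk (e, True) = B" "e \<in> edges T" using dblk_eq[OF bl(1), of "(e, True)"] block_T(5)[OF bl(1)] B(3) by auto
    then show ?thesis using count[of e] bl B(2) by simp
  qed
  have b2: "card {i. i < n \<and> e \<in> walk_edges (P i)} = 2"
    if bp: "block_path T u p v" "e \<in> walk_edges p" for u p v e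
  proof -
    have e: "e \<in> edges T" "\<not> circle (dblk (e, True))" using block_path_edge[OF bp] by blast+
    then have "\<not> end_block T (dblk (e, True))" using end_blockD(2) by blast
    then show ?thesis using count[of e] e by simp
  qed
  have ind: "indicator T = (\<lambda>e. 1 / 2 * (\<Sum>i<n. indicator (S i) e))"
  proof
    fix e
    have "(\<Sum>i<n. indicator (S i) e) = (\<Sum>D\<in>ends. indicator (part D) e)"
      unfolding S_def by (rule sum.reindex_bij_betw[OF enum(1)])
    then show "indicator T e = 1 / 2 * (\<Sum>i<n. indicator (S i) e)" using indicator_decomposition by simp
  qed
  have once: "\<forall>i<n. once_around (C i) (x i) (c i)"
    using once_around[OF C] by (simp add: x_def c_def)
  have paths: "\<forall>i<n. path T (x i) (P (Suc i mod n)) (x (Suc i mod n)) \<and> P (Suc i mod n) \<noteq> []"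
  proof (intro allI impI conjI)
    fix i assume i: "i < n"
    show "path T (x i) (P (Suc i mod n)) (x (Suc i mod n))"
      using conn_path[OF C[OF i]] unfolding x_def P[OF i] nx[OF i] .
    show "P (Suc i mod n) \<noteq> []" using plen_pos[OF C[OF i]] unfolding P[OF i] by (simp add: run_def)
  qed
  have S_eq: "\<forall>i<n. S i = graph_union (graph_union (C i) (walk_subgraph T (x i) (P (Suc i mod n)))) (C (Suc i mod n))"
    using P nx by (simp add: S_def part_def x_def)
  have S_props: "\<forall>i<n. subgraph (S i) T \<and> circuit_type3 (S i) \<and> direction (S i) \<omega>"
    using part_subgraph part_type3 part_direction C unfolding S_def by blast
  show ?thesis
    by (rule exI[of _ n], rule exI[of _ C], rule exI[of _ x], rule exI[of _ P], rule exI[of _ c],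
        rule exI[of _ W], rule exI[of _ S])
      (intro conjI n2 W_def closed sign once enum(1) paths S_eq S_props ind allI impI; (elim conjE)?; rule b1 b2; assumption)
qed

end

text \<open>\<open>T\<close> is itself a block. A single edge with distinct endpoints would end in a
  sink or a source, so \<open>T\<close> is a circle, and its sign is
  \<open>(-1) ^ 0\<close>.\<close>

lemma circle_tree_without_cut_vertex:
  assumes ct: "circle_tree T" and se: "sesqui_Eulerian T" and dr: "direction T \<omega>" and nc: "\<nexists>v. cut_vertex T v"
  shows "circuit_type1 T"
proof -
  have T: "signed_graph T" "connected_graph T" using ct by (auto simp: circle_tree_def)
  then have ns: "nonseparable T" using nc by (simp add: nonseparable_def)
  have bl: "block T T"
    unfolding block_def using T nc by (auto simp: subgraph_def)
  have circ: "circle T"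
  proof (rule ccontr)
    assume nC: "\<not> circle T"
    then have "card (edges T) = 1" using ct bl by (auto simp: circle_tree_def)
    then obtain e where e: "edges T = {e}" "verts T = {endpt T e True, endpt T e False}"
      "endpt T e True \<noteq> endpt T e False"
      using single_edge_block[OF ns nC] by blast
    have "ends_at T (endpt T e True) = {(e, True)}"
    proof
      show "ends_at T (endpt T e True) \<subseteq> {(e, True)}"
      proof clarify
        fix f b assume "(f, b) \<in> ends_at T (endpt T e True)"
        then show "f = e \<and> b = True" using e(1,3) by (cases b) (auto simp: ends_at_def)
      qed
    qed (use e(1) in \<open>auto simp: ends_at_def\<close>)
    moreover have "\<omega> e True = 1 \<or> \<omega> e True = -1" using dr e(1) by (auto simp: direction_def orientation_def)
    ultimately have "sink T \<omega> (endpt T e True) \<or> source T \<omega> (endpt T e True)"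
      using e(2) by (auto simp: sink_def source_def)
    then show False using dr by (auto simp: direction_def)
  qed
  then have "circle_sign T = (-1) ^ card {v \<in> verts T. cut_vertex T v}"
    using se bl by (auto simp: sesqui_Eulerian_def circle_block_def)
  then show ?thesis using circ nc by (simp add: circuit_type1_def)
qed

text \<open>Only Types I and II are split off. A Type III circuit also has cut-vertices and disjoint
  end blocks, so it comes under the second alternative.\<close>

theorem theorem4p9:
  fixes T :: "('v, 'e) sgraph" and \<omega> :: "'e \<Rightarrow> bool \<Rightarrow> int"
  assumes "circle_tree T" and "sesqui_Eulerian T" and "direction T \<omega>"
  shows "sg_circuit T \<or>
    (\<exists>(n :: nat) (C :: nat \<Rightarrow> ('v, 'e) sgraph) (x :: nat \<Rightarrow> 'v)
       (P :: nat \<Rightarrow> ('e \<times> 'v) list) (c :: nat \<Rightarrow> ('e \<times> 'v) list)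
       (W :: ('e \<times> 'v) list) (S :: nat \<Rightarrow> ('v, 'e) sgraph).
      n \<ge> 2 \<and>
      W = concat (map (\<lambda>i. P i @ c i) [0..<n]) \<and>
      closed_walk T (x (n - 1)) W \<and> walk_sign T W = 1 \<and>
      (\<forall>i<n. once_around (C i) (x i) (c i)) \<and>
      bij_betw C {..<n} {B. end_block T B} \<and>
      (\<forall>i<n. path T (x i) (P (Suc i mod n)) (x (Suc i mod n)) \<and> P (Suc i mod n) \<noteq> []) \<and>
      (\<forall>B e. circle_block T B \<and> \<not> end_block T B \<and> e \<in> edges B \<longrightarrow>
         card {i. i < n \<and> e \<in> walk_edges (P i)} = 1) \<and>
      (\<forall>u p v e. block_path T u p v \<and> e \<in> walk_edges p \<longrightarrow>
         card {i. i < n \<and> e \<in> walk_edges (P i)} = 2) \<and>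
      (\<forall>i<n. S i = graph_union (graph_union (C i) (walk_subgraph T (x i) (P (Suc i mod n))))
                     (C (Suc i mod n))) \<and>
      (\<forall>i<n. subgraph (S i) T \<and> circuit_type3 (S i) \<and> direction (S i) \<omega>) \<and>
      indicator T = (\<lambda>e. 1 / 2 * (\<Sum>i<n. indicator (S i) e)))"
proof (cases "\<exists>v. cut_vertex T v")
  case False
  then show ?thesis using circle_tree_without_cut_vertex[OF assms] unfolding sg_circuit_def by blast
next
  case True
  interpret directed_circle_tree T \<omega> using assms True by unfold_locales
  show ?thesis
  proof (cases "\<exists>C C'. end_block T C \<and> end_block T C' \<and> C \<noteq> C' \<and> verts C \<inter> verts C' \<noteq> {}")
    case True
    then obtain C C' v where "end_block T C" "end_block T C'" "C \<noteq> C'" "v \<in> verts C" "v \<in> verts C'" by blast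
    then have "circuit_type2 T" using end_blocks_meet_type2 by blast
    then show ?thesis unfolding sg_circuit_def by blast
  next
    case False
    interpret directed_circle_tree_disjoint T \<omega> using False by unfold_locales blast
    show ?thesis by (rule disjI2) (rule circuit_decomposition)
  qed
qed

end
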